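(* Let $A$ be a unital C*-algebra and let $X$ be a (nonempty) compact Hausdorff space of covering dimension at most $n$. Then $$csr(C(X)\otimes A)\leq \max\{csr(A), \mathrm{surj}_k(A), \mathrm{inj}_{k-1}(A) : 1\leq k\leq n\}.$$
   Context: For a unital C*-algebra $A$ and $m\ge 1$, $Lg_m(A)$ is the set of left unimodular vectors, i.e. $(a_1,\dots,a_m)\in A^m$ with $Aa_1+\dots+Aa_m=A$, topologized as a subspace of $A^m$. $GL_m(A)$ is the group of invertible elements of $M_m(A)$, with base point the identity, acting on $Lg_m(A)$ by left multiplication, $GL_m^0(A)$ is its identity component, and $GL_0(A)=\{1\}$. The connected stable rank $csr(A)$ is the least $N\ge 1$ such that $GL_m^0(A)$ acts transitively on $Lg_m(A)$ for all $m\ge N$ (equivalently, $Lg_m(A)$ is connected for all $m\ge N$). For $k\ge 0$, $\mathrm{inj}_k(A)$ (resp. $\mathrm{surj}_k(A)$) is the least $N\ge 1$ such that the map $\pi_k(GL_{m-1}(A))\to\pi_k(GL_m(A))$ induced by $a\mapsto \begin{pmatrix} a & 0\\ 0& 1\end{pmatrix}$ is injective (resp. surjective) for all $m\ge N$. All these quantities are $+\infty$ if no such $N$ exists. *)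

theory Defs
  imports "HOL-Analysis.Analysis" "HOL-Library.Extended_Nat"
begin

section \<open>Unital C*-algebras\<close>

text \<open>
  HOL-Analysis only provides real normed algebras, so the complex scalar multiplication and the
  involution are class parameters; the complex structure extends the real one.
  The unit comes from \<^class>\<open>monoid_mult\<close> (and not from \<^class>\<open>ring_1\<close>, hence not from
  \<^class>\<open>real_normed_algebra_1\<close>), so that the zero algebra is not excluded;
  \<open>norm 1 = 1\<close> in nonzero algebras follows from the C*-identity.
\<close>

class unital_cstar_algebra = real_normed_algebra + banach + monoid_mult +
  fixes scaleC :: "complex \<Rightarrow> 'a \<Rightarrow> 'a" (infixr "*\<^sub>C" 75)
    and star :: "'a \<Rightarrow> 'a"
  assumes scaleC_add_right: "c *\<^sub>C (x + y) = c *\<^sub>C x + c *\<^sub>C y"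
    and scaleC_add_left: "(c + d) *\<^sub>C x = c *\<^sub>C x + d *\<^sub>C x"
    and scaleC_scaleC: "c *\<^sub>C d *\<^sub>C x = (c * d) *\<^sub>C x"
    and scaleC_of_real: "complex_of_real r *\<^sub>C x = r *\<^sub>R x"
    and mult_scaleC_left: "(c *\<^sub>C x) * y = c *\<^sub>C (x * y)"
    and mult_scaleC_right: "x * (c *\<^sub>C y) = c *\<^sub>C (x * y)"
    and norm_scaleC: "norm (c *\<^sub>C x) = cmod c * norm x"
    and star_star: "star (star x) = x"
    and star_add: "star (x + y) = star x + star y"
    and star_scaleC: "star (c *\<^sub>C x) = cnj c *\<^sub>C star x"
    and star_mult: "star (x * y) = star y * star x"
    and cstar_identity: "norm (star x * x) = (norm x)\<^sup>2"
begin

lemma star_scaleR: "star (r *\<^sub>R x) = r *\<^sub>R star x"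
  using star_scaleC[of "complex_of_real r" x] by (simp add: scaleC_of_real)

lemma star_zero: "star 0 = 0"
  using star_add[of 0 0] by simp

lemma star_diff: "star (x - y) = star x - star y"
  using star_add[of "x - y" y] by simp

lemma star_one: "star 1 = 1"
  by (metis mult_1_left mult_1_right star_mult star_star)

lemma norm_star_le: "norm x \<le> norm (star x)"
proof (cases "norm x = 0")
  case False
  have "norm x * norm x \<le> norm (star x) * norm x"
    using norm_mult_ineq[of "star x" x] by (simp add: cstar_identity monoid_mult_class.power2_eq_square)
  then show ?thesis
    using False by (simp add: mult_le_cancel_right)
qed simp

lemma norm_star: "norm (star x) = norm x"
  using norm_star_le[of x] norm_star_le[of "star x"] by (simp add: star_star)

end

lemma bounded_linear_star: "bounded_linear (star :: 'a::unital_cstar_algebra \<Rightarrow> 'a)"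
  by (rule bounded_linear_intro[where K = 1]) (simp_all add: star_add star_scaleR norm_star)

lemma bounded_linear_scaleC: "bounded_linear (\<lambda>x :: 'a::unital_cstar_algebra. c *\<^sub>C x)"
  by (rule bounded_linear_intro[where K = "cmod c"])
    (simp_all add: scaleC_add_right norm_scaleC mult_scaleC_left scaleC_scaleC mult.commute
      flip: scaleC_of_real)

lemma bounded_bilinear_scaleC:
  "bounded_bilinear (scaleC :: complex \<Rightarrow> 'a::unital_cstar_algebra \<Rightarrow> 'a)"
proof
  fix r c and x :: 'a
  show "(r *\<^sub>R c) *\<^sub>C x = r *\<^sub>R c *\<^sub>C x"
    by (simp add: scaleR_conv_of_real scaleC_scaleC flip: scaleC_of_real)
  show "c *\<^sub>C r *\<^sub>R x = r *\<^sub>R c *\<^sub>C x"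
    by (simp add: scaleC_scaleC mult.commute flip: scaleC_of_real)
  show "\<exists>K. \<forall>c (x :: 'a). norm (c *\<^sub>C x) \<le> norm c * norm x * K"
    by (rule exI[of _ 1]) (simp add: norm_scaleC)
qed (simp_all add: scaleC_add_left scaleC_add_right)

instantiation complex :: unital_cstar_algebra
begin

definition "scaleC_complex = ((*) :: complex \<Rightarrow> complex \<Rightarrow> complex)"
definition "star_complex = cnj"

instance
  by standard
    (simp_all add: scaleC_complex_def star_complex_def algebra_simps norm_mult power2_eq_square
      scaleR_conv_of_real)

end


section \<open>The C*-algebra of bounded continuous functions\<close>

lemma mult_bcontfun:
  fixes f g :: "'x::topological_space \<Rightarrow> 'a::real_normed_algebra"
  assumes "f \<in> bcontfun" "g \<in> bcontfun"
  shows "(\<lambda>x. f x * g x) \<in> bcontfun"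
proof -
  obtain B C where "\<And>x. norm (f x) \<le> B" "\<And>x. norm (g x) \<le> C"
    using assms by (force simp: bcontfun_def bounded_iff)
  then have "norm (f x * g x) \<le> B * C" for x
    by (meson mult_mono norm_ge_zero norm_mult_ineq order_trans)
  then show ?thesis
    using assms by (intro bcontfun_normI) (auto simp: bcontfun_def intro!: continuous_intros)
qed

lemma bounded_linear_bcontfun:
  assumes "bounded_linear h" "f \<in> bcontfun"
  shows "(\<lambda>x. h (f x)) \<in> bcontfun"
  using bounded_linear.continuous_on[OF assms(1), of UNIV f]
    bounded_linear_image[OF _ assms(1), of "range f"] assms(2)
  by (auto simp: bcontfun_def image_image)

lemma scaleC_bcontfun:
  fixes a :: "'a::unital_cstar_algebra"
  assumes "f \<in> bcontfun"
  shows "(\<lambda>x. f x *\<^sub>C a) \<in> bcontfun"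
  using bounded_bilinear.bounded_linear_left[OF bounded_bilinear_scaleC] assms
  by (rule bounded_linear_bcontfun)

instance bcontfun :: (topological_space, complete_space) complete_space
proof
  fix f :: "nat \<Rightarrow> 'a \<Rightarrow>\<^sub>C 'b"
  assume "Cauchy f"
  then obtain g where "uniform_limit UNIV f g sequentially"
    using uniformly_convergent_eq_cauchy[of "\<lambda>_. True" f]
    unfolding Cauchy_def uniform_limit_sequentially_iff
    by (metis dist_fun_lt_imp_dist_val_lt)
  from uniform_limit_bcontfunE[OF this sequentially_bot]
  obtain l' where "f \<longlonglongrightarrow> l'" by metis
  then show "convergent f"
    by (rule convergentI)
qed

instance bcontfun :: (topological_space, banach) banach ..

instantiation bcontfun :: (topological_space, unital_cstar_algebra) unital_cstar_algebra
begin

definition "f * g = Bcontfun (\<lambda>x. apply_bcontfun f x * apply_bcontfun g x)"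
definition "1 = Bcontfun (\<lambda>_. 1)"
definition "c *\<^sub>C f = Bcontfun (\<lambda>x. c *\<^sub>C apply_bcontfun f x)"
definition "star f = Bcontfun (\<lambda>x. star (apply_bcontfun f x))"

lemma apply_times_bcontfun [simp]: "apply_bcontfun (f * g) x = apply_bcontfun f x * apply_bcontfun g x"
  for f g :: "'a \<Rightarrow>\<^sub>C 'b"
  by (simp add: times_bcontfun_def Bcontfun_inverse mult_bcontfun apply_bcontfun)

lemma apply_one_bcontfun [simp]: "apply_bcontfun (1 :: 'a \<Rightarrow>\<^sub>C 'b) x = 1"
  by (simp add: one_bcontfun_def Bcontfun_inverse const_bcontfun)

lemma apply_scaleC_bcontfun [simp]: "apply_bcontfun (c *\<^sub>C f) x = c *\<^sub>C apply_bcontfun f x"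
  for f :: "'a \<Rightarrow>\<^sub>C 'b"
  by (simp add: scaleC_bcontfun_def Bcontfun_inverse bounded_linear_bcontfun
      bounded_linear_scaleC apply_bcontfun)

lemma apply_star_bcontfun [simp]: "apply_bcontfun (star f) x = star (apply_bcontfun f x)"
  for f :: "'a \<Rightarrow>\<^sub>C 'b"
  by (simp add: star_bcontfun_def Bcontfun_inverse bounded_linear_bcontfun
      bounded_linear_star apply_bcontfun)

instance
proof
  fix f g :: "'a \<Rightarrow>\<^sub>C 'b" and c :: complex
  show "norm (f * g) \<le> norm f * norm g"
    by (rule norm_bound) (auto intro!: order_trans[OF norm_mult_ineq] mult_mono norm_bounded)
  have le: "norm (d *\<^sub>C h) \<le> cmod d * norm h" for d and h :: "'a \<Rightarrow>\<^sub>C 'b"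
    by (rule norm_bound) (auto simp: norm_scaleC intro!: mult_left_mono norm_bounded)
  show "norm (c *\<^sub>C f) = cmod c * norm f"
  proof (cases "c = 0")
    case False
    have "inverse c *\<^sub>C c *\<^sub>C f = f"
      using False scaleC_of_real[of 1]
      by (intro bcontfun_eqI) (simp add: scaleC_scaleC)
    then have "norm f \<le> inverse (cmod c) * norm (c *\<^sub>C f)"
      using le[of "inverse c" "c *\<^sub>C f"] by (simp add: norm_inverse)
    then show ?thesis
      using False le[of c f] by (simp add: field_simps)
  qed (use le[of 0 f] in simp)
  show "norm (star f * f) = (norm f)\<^sup>2"
  proof (rule antisym)
    show "norm (star f * f) \<le> (norm f)\<^sup>2"
      by (rule norm_bound) (simp add: cstar_identity norm_bounded power_mono)
    have "norm (apply_bcontfun f x) \<le> sqrt (norm (star f * f))" for x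
      using norm_bounded[of "star f * f" x] by (simp add: cstar_identity real_le_rsqrt)
    then have "norm f \<le> sqrt (norm (star f * f))"
      by (rule norm_bound)
    then show "(norm f)\<^sup>2 \<le> norm (star f * f)"
      by (metis norm_ge_zero power_mono real_sqrt_pow2)
  qed
qed (rule bcontfun_eqI;
    simp add: algebra_simps scaleC_add_right scaleC_add_left scaleC_scaleC scaleC_of_real
      mult_scaleC_left mult_scaleC_right star_star star_add star_scaleC star_mult)+

end


section \<open>The tensor product of \<open>C(X)\<close> and \<open>A\<close>\<close>

text \<open>
  For compact \<open>X\<close>, \<open>'x \<Rightarrow>\<^sub>C complex\<close> is \<open>C(X)\<close>, and the linear map sending \<open>f \<otimes> a\<close> to the function
  \<open>x \<mapsto> f(x) a\<close> identifies the algebraic tensor product of \<open>C(X)\<close> and \<open>A\<close> with the real span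
  of these functions (which is a complex subspace, since complex scalars are absorbed into \<open>f\<close>).
  The supremum norm is the spatial tensor norm (represent \<open>C(X)\<close> by multiplication operators
  on \<open>\<ell>\<^sup>2(X)\<close>), which is the only C*-norm because \<open>C(X)\<close> is nuclear.  The C*-tensor product
  is therefore the closure of this span in the C*-algebra of bounded continuous functions
  from \<open>X\<close> to \<open>A\<close>.
\<close>

definition elementary_tensor ::
  "('x::topological_space \<Rightarrow>\<^sub>C complex) \<Rightarrow> 'a::unital_cstar_algebra \<Rightarrow> ('x \<Rightarrow>\<^sub>C 'a)" where
  "elementary_tensor f a = Bcontfun (\<lambda>x. apply_bcontfun f x *\<^sub>C a)"

lemma apply_elementary_tensor [simp]:
  "apply_bcontfun (elementary_tensor f a) x = apply_bcontfun f x *\<^sub>C a"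
  by (simp add: elementary_tensor_def Bcontfun_inverse scaleC_bcontfun apply_bcontfun)

definition tensor_span :: "('x::topological_space \<Rightarrow>\<^sub>C 'a::unital_cstar_algebra) set" where
  "tensor_span = span {elementary_tensor f a | f a. True}"

typedef (overloaded) ('x, 'a) C_tensor =
  "closure tensor_span :: ('x::topological_space \<Rightarrow>\<^sub>C 'a::unital_cstar_algebra) set"
proof -
  have "0 \<in> (tensor_span :: ('x \<Rightarrow>\<^sub>C 'a) set)"
    unfolding tensor_span_def by (rule span_zero)
  then show ?thesis
    using closure_subset by blast
qed

setup_lifting type_definition_C_tensor

lemma closure_image_closed:
  assumes "bounded_linear h" and "h ` S \<subseteq> closure S" and "x \<in> closure S"
  shows "h x \<in> closure S"
proof -
  have "h ` closure S \<subseteq> closure (h ` S)"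
    using assms(1) by (intro image_closure_subset)
      (auto intro!: linear_continuous_on closure_subset[THEN subsetD])
  also have "\<dots> \<subseteq> closure S"
    using assms(2) closure_minimal by blast
  finally show ?thesis
    using assms(3) by blast
qed

lemma subspace_closure_tensor_span: "subspace (closure tensor_span)"
proof (rule subspaceI)
  have sub: "subspace tensor_span"
    unfolding tensor_span_def by (rule subspace_span)
  show "0 \<in> closure tensor_span"
    using subspace_0[OF sub] closure_subset by blast
  show "c *\<^sub>R x \<in> closure tensor_span" if "x \<in> closure tensor_span" for c x
    by (rule closure_image_closed[OF bounded_linear_scaleR_right _ that])
      (use subspace_scale[OF sub] closure_subset in blast)
  show "x + y \<in> closure tensor_span"
    if x: "x \<in> closure tensor_span" and y: "y \<in> closure tensor_span" for x y
  proof -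
    obtain X Y where "\<And>n. X n \<in> tensor_span" "X \<longlonglongrightarrow> x" "\<And>n. Y n \<in> tensor_span" "Y \<longlonglongrightarrow> y"
      using x y by (auto simp: closure_sequential)
    then show ?thesis
      unfolding closure_sequential
      by (intro exI[of _ "\<lambda>n. X n + Y n"]) (auto intro: tendsto_add subspace_add[OF sub])
  qed
qed

lemma bounded_linear_tensor_closed:
  fixes h :: "('x::topological_space \<Rightarrow>\<^sub>C 'a::unital_cstar_algebra) \<Rightarrow> ('x \<Rightarrow>\<^sub>C 'a)"
  assumes "bounded_linear h" "\<And>f a. h (elementary_tensor f a) \<in> closure tensor_span"
    and "x \<in> closure tensor_span"
  shows "h x \<in> closure tensor_span"
proof (rule closure_image_closed[OF assms(1) _ assms(3)], safe)
  fix x :: "'x \<Rightarrow>\<^sub>C 'a"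
  assume "x \<in> tensor_span"
  then show "h x \<in> closure tensor_span"
    unfolding tensor_span_def
  proof (induction rule: span_induct_alt)
    case base
    show ?case
      using subspace_0[OF subspace_closure_tensor_span] bounded_linear.linear[OF assms(1)]
      by (simp add: linear_0 tensor_span_def)
  next
    case (step c x y)
    then show ?case
      using subspace_closure_tensor_span assms(2) bounded_linear.linear[OF assms(1)]
      by (auto simp: linear_add linear_scale subspace_scale tensor_span_def intro!: subspace_add)
  qed
qed

lemma elementary_tensor_closure: "elementary_tensor f a \<in> closure tensor_span"
  unfolding tensor_span_def by (intro closure_subset[THEN subsetD] span_base) blast

lemma tensor_mult_closed:
  assumes "x \<in> closure tensor_span" "y \<in> closure tensor_span"
  shows "x * y \<in> closure tensor_span"
proof (rule bounded_linear_tensor_closed[OF bounded_linear_mult_left _ assms(1)])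
  fix f a
  show "elementary_tensor f a * y \<in> closure tensor_span"
  proof (rule bounded_linear_tensor_closed[OF bounded_linear_mult_right _ assms(2)])
    fix g b
    have "elementary_tensor f a * elementary_tensor g b = elementary_tensor (f * g) (a * b)"
      by (rule bcontfun_eqI)
        (simp add: mult_scaleC_left mult_scaleC_right scaleC_scaleC mult.commute)
    then show "elementary_tensor f a * elementary_tensor g b \<in> closure tensor_span"
      by (simp add: elementary_tensor_closure)
  qed
qed

lemma tensor_scaleC_closed:
  assumes "x \<in> closure tensor_span"
  shows "c *\<^sub>C x \<in> closure tensor_span"
proof (rule bounded_linear_tensor_closed[OF bounded_linear_scaleC _ assms])
  fix f a
  have "c *\<^sub>C elementary_tensor f a = elementary_tensor f (c *\<^sub>C a)"
    by (rule bcontfun_eqI) (simp add: scaleC_scaleC mult.commute)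
  then show "c *\<^sub>C elementary_tensor f a \<in> closure tensor_span"
    by (simp add: elementary_tensor_closure)
qed

lemma tensor_star_closed:
  assumes "x \<in> closure tensor_span"
  shows "star x \<in> closure tensor_span"
proof (rule bounded_linear_tensor_closed[OF bounded_linear_star _ assms])
  fix f a
  have "star (elementary_tensor f a) = elementary_tensor (star f) (star a)"
    by (rule bcontfun_eqI) (simp add: star_scaleC star_complex_def)
  then show "star (elementary_tensor f a) \<in> closure tensor_span"
    by (simp add: elementary_tensor_closure)
qed

lemma tensor_one_closed: "1 \<in> closure tensor_span"
proof -
  have "1 = elementary_tensor 1 1"
    using scaleC_of_real[of 1] by (intro bcontfun_eqI) simp
  then show ?thesis
    by (metis elementary_tensor_closure)
qed

instantiation C_tensor :: (topological_space, unital_cstar_algebra) real_normed_vector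
begin

lift_definition zero_C_tensor :: "('a, 'b) C_tensor" is 0
  by (rule subspace_0[OF subspace_closure_tensor_span])

lift_definition plus_C_tensor :: "('a, 'b) C_tensor \<Rightarrow> ('a, 'b) C_tensor \<Rightarrow> ('a, 'b) C_tensor" is "(+)"
  by (rule subspace_add[OF subspace_closure_tensor_span])

lift_definition minus_C_tensor :: "('a, 'b) C_tensor \<Rightarrow> ('a, 'b) C_tensor \<Rightarrow> ('a, 'b) C_tensor" is "(-)"
  by (rule subspace_diff[OF subspace_closure_tensor_span])

lift_definition uminus_C_tensor :: "('a, 'b) C_tensor \<Rightarrow> ('a, 'b) C_tensor" is uminus
  by (rule subspace_neg[OF subspace_closure_tensor_span])

lift_definition scaleR_C_tensor :: "real \<Rightarrow> ('a, 'b) C_tensor \<Rightarrow> ('a, 'b) C_tensor" is scaleR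
  by (rule subspace_scale[OF subspace_closure_tensor_span])

lift_definition norm_C_tensor :: "('a, 'b) C_tensor \<Rightarrow> real" is norm .

lift_definition dist_C_tensor :: "('a, 'b) C_tensor \<Rightarrow> ('a, 'b) C_tensor \<Rightarrow> real" is dist .

lift_definition sgn_C_tensor :: "('a, 'b) C_tensor \<Rightarrow> ('a, 'b) C_tensor" is sgn
  by (simp add: sgn_div_norm subspace_scale[OF subspace_closure_tensor_span])

definition "uniformity = (INF e\<in>{0 <..}. principal {(x :: ('a, 'b) C_tensor, y). dist x y < e})"

definition "open (S :: ('a, 'b) C_tensor set) \<longleftrightarrow>
  (\<forall>x\<in>S. \<forall>\<^sub>F (x', y) in uniformity. x' = x \<longrightarrow> y \<in> S)"

instance
  by standard (fact uniformity_C_tensor_def open_C_tensor_def |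
    (transfer; simp add: algebra_simps dist_norm sgn_div_norm norm_triangle_ineq))+

end

instance C_tensor :: (topological_space, unital_cstar_algebra) banach
proof
  show "convergent X" if "Cauchy X" for X :: "nat \<Rightarrow> ('a, 'b) C_tensor"
  proof -
    have "Cauchy (\<lambda>n. Rep_C_tensor (X n))"
      using that by (simp add: Cauchy_def dist_C_tensor.rep_eq)
    then obtain l where l: "(\<lambda>n. Rep_C_tensor (X n)) \<longlonglongrightarrow> l"
      using Cauchy_convergent convergent_def by blast
    then have "l \<in> closure tensor_span"
      by (rule closed_sequentially[OF closed_closure Rep_C_tensor])
    then have "dist (X n) (Abs_C_tensor l) = dist (Rep_C_tensor (X n)) l" for n
      by (simp add: dist_C_tensor.rep_eq Abs_C_tensor_inverse)
    then have "X \<longlonglongrightarrow> Abs_C_tensor l"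
      using l unfolding tendsto_iff by simp
    then show ?thesis
      by (rule convergentI)
  qed
qed

instantiation C_tensor :: (topological_space, unital_cstar_algebra) unital_cstar_algebra
begin

lift_definition times_C_tensor :: "('a, 'b) C_tensor \<Rightarrow> ('a, 'b) C_tensor \<Rightarrow> ('a, 'b) C_tensor" is "(*)"
  by (rule tensor_mult_closed)

lift_definition one_C_tensor :: "('a, 'b) C_tensor" is 1
  by (rule tensor_one_closed)

lift_definition scaleC_C_tensor :: "complex \<Rightarrow> ('a, 'b) C_tensor \<Rightarrow> ('a, 'b) C_tensor" is scaleC
  by (rule tensor_scaleC_closed)

lift_definition star_C_tensor :: "('a, 'b) C_tensor \<Rightarrow> ('a, 'b) C_tensor" is star
  by (rule tensor_star_closed)

instance
  by standard (transfer; simp add: algebra_simps norm_mult_ineq scaleC_add_right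
      scaleC_add_left scaleC_scaleC scaleC_of_real mult_scaleC_left mult_scaleC_right norm_scaleC
      star_star star_add star_scaleC star_mult cstar_identity)+

end


section \<open>Unimodular vectors, general linear groups and connected stable rank\<close>

text \<open>
  Vectors of length \<open>m\<close> and \<open>m \<times> m\<close> matrices are functions on \<^typ>\<open>nat\<close> that vanish outside the index
  range.  The product topology of the function type, restricted to these sets, is the
  topology of \<open>A\<^sup>m\<close> and the norm topology of \<open>M\<^sub>m(A)\<close>.
\<close>

definition vectors :: "nat \<Rightarrow> (nat \<Rightarrow> 'a::unital_cstar_algebra) set" where
  "vectors m = {v. \<forall>i\<ge>m. v i = 0}"

definition matrices :: "nat \<Rightarrow> (nat \<Rightarrow> nat \<Rightarrow> 'a::unital_cstar_algebra) set" where
  "matrices m = {a. \<forall>i j. i \<ge> m \<or> j \<ge> m \<longrightarrow> a i j = 0}"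

definition matrix_mult ::
  "nat \<Rightarrow> (nat \<Rightarrow> nat \<Rightarrow> 'a::unital_cstar_algebra) \<Rightarrow> (nat \<Rightarrow> nat \<Rightarrow> 'a) \<Rightarrow> nat \<Rightarrow> nat \<Rightarrow> 'a" where
  "matrix_mult m a b = (\<lambda>i j. \<Sum>l<m. a i l * b l j)"

definition matrix_one :: "nat \<Rightarrow> nat \<Rightarrow> nat \<Rightarrow> 'a::unital_cstar_algebra" where
  "matrix_one m = (\<lambda>i j. if i < m \<and> i = j then 1 else 0)"

definition matrix_act ::
  "nat \<Rightarrow> (nat \<Rightarrow> nat \<Rightarrow> 'a::unital_cstar_algebra) \<Rightarrow> (nat \<Rightarrow> 'a) \<Rightarrow> nat \<Rightarrow> 'a" where
  "matrix_act m a v = (\<lambda>i. \<Sum>j<m. a i j * v j)"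

definition GL :: "nat \<Rightarrow> (nat \<Rightarrow> nat \<Rightarrow> 'a::unital_cstar_algebra) set" where
  "GL m = {a \<in> matrices m. \<exists>b \<in> matrices m.
     matrix_mult m a b = matrix_one m \<and> matrix_mult m b a = matrix_one m}"

definition GL0 :: "nat \<Rightarrow> (nat \<Rightarrow> nat \<Rightarrow> 'a::unital_cstar_algebra) set" where
  "GL0 m = connected_component_set (GL m) (matrix_one m)"

definition Lg :: "nat \<Rightarrow> (nat \<Rightarrow> 'a::unital_cstar_algebra) set" where
  "Lg m = {a \<in> vectors m. {\<Sum>i<m. c i * a i | c. True} = UNIV}"

definition csr :: "'a::unital_cstar_algebra itself \<Rightarrow> enat" where
  "csr A = Inf {enat N | N. N \<ge> 1 \<and>
     (\<forall>m\<ge>N. \<forall>u \<in> Lg m. \<forall>v \<in> (Lg m :: (nat \<Rightarrow> 'a) set). \<exists>g \<in> GL0 m. matrix_act m g u = v)}"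


section \<open>Homotopy groups\<close>

text \<open>
  \<open>\<pi>\<^sub>k(S, s)\<close> is the set of homotopy classes, relative to the boundary, of maps from the
  \<open>k\<close>-cube to \<open>S\<close> sending the boundary to \<open>s\<close>.  The cube of dimension \<open>0\<close> is a point with empty boundary, so
  \<open>\<pi>\<^sub>0\<close> is the set of path components.  The group structure plays no role in the
  injectivity or surjectivity of induced maps and is not introduced.
\<close>

definition unit_cube :: "nat \<Rightarrow> (nat \<Rightarrow> real) set" where
  "unit_cube k = {t. (\<forall>i<k. 0 \<le> t i \<and> t i \<le> 1) \<and> (\<forall>i\<ge>k. t i = 0)}"

definition cube_boundary :: "nat \<Rightarrow> (nat \<Rightarrow> real) set" where
  "cube_boundary k = {t \<in> unit_cube k. \<exists>i<k. t i = 0 \<or> t i = 1}"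

definition cube_maps ::
  "nat \<Rightarrow> 'b::topological_space set \<Rightarrow> 'b \<Rightarrow> ((nat \<Rightarrow> real) \<Rightarrow> 'b) set" where
  "cube_maps k S s = {f. continuous_on (unit_cube k) f \<and> f ` unit_cube k \<subseteq> S \<and>
     f ` cube_boundary k \<subseteq> {s}}"

definition cube_homotopy ::
  "nat \<Rightarrow> 'b::topological_space set \<Rightarrow> 'b \<Rightarrow> (((nat \<Rightarrow> real) \<Rightarrow> 'b) \<times> ((nat \<Rightarrow> real) \<Rightarrow> 'b)) set" where
  "cube_homotopy k S s =
     {(f, g). homotopic_with_canon (\<lambda>h. h ` cube_boundary k \<subseteq> {s}) (unit_cube k) S f g}"

definition homotopy_group ::
  "nat \<Rightarrow> 'b::topological_space set \<Rightarrow> 'b \<Rightarrow> ((nat \<Rightarrow> real) \<Rightarrow> 'b) set set" where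
  "homotopy_group k S s = cube_maps k S s // cube_homotopy k S s"

text \<open>The map induced on \<open>\<pi>\<^sub>k\<close> by a map \<open>\<phi>\<close> into \<open>(T, t)\<close>: the class of \<open>f\<close> goes to the class of \<open>\<phi> \<circ> f\<close>.\<close>

definition induced_map ::
  "nat \<Rightarrow> 'c::topological_space set \<Rightarrow> 'c \<Rightarrow> ('b \<Rightarrow> 'c) \<Rightarrow>
   ((nat \<Rightarrow> real) \<Rightarrow> 'b) set \<Rightarrow> ((nat \<Rightarrow> real) \<Rightarrow> 'c) set" where
  "induced_map k T t \<phi> F = (\<Union>f\<in>F. cube_homotopy k T t `` {\<phi> \<circ> f})"


section \<open>Injective and surjective stable ranks\<close>

text \<open>Below, \<open>m\<close> is the size of the target, \<open>GL (m - 1) \<rightarrow> GL m\<close>, and is only used for \<open>m \<ge> 1\<close>.\<close>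

definition stabilise ::
  "nat \<Rightarrow> (nat \<Rightarrow> nat \<Rightarrow> 'a::unital_cstar_algebra) \<Rightarrow> nat \<Rightarrow> nat \<Rightarrow> 'a" where
  "stabilise m a = (\<lambda>i j. if i < m - 1 \<and> j < m - 1 then a i j
                          else if i = m - 1 \<and> j = m - 1 then 1 else 0)"

definition GL_homotopy_group ::
  "'a::unital_cstar_algebra itself \<Rightarrow> nat \<Rightarrow> nat \<Rightarrow> ((nat \<Rightarrow> real) \<Rightarrow> nat \<Rightarrow> nat \<Rightarrow> 'a) set set" where
  "GL_homotopy_group A k m = homotopy_group k (GL m) (matrix_one m)"

definition GL_stabilisation ::
  "'a::unital_cstar_algebra itself \<Rightarrow> nat \<Rightarrow> nat \<Rightarrow>
   ((nat \<Rightarrow> real) \<Rightarrow> nat \<Rightarrow> nat \<Rightarrow> 'a) set \<Rightarrow> ((nat \<Rightarrow> real) \<Rightarrow> nat \<Rightarrow> nat \<Rightarrow> 'a) set" where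
  "GL_stabilisation A k m = induced_map k (GL m) (matrix_one m) (stabilise m)"

definition inj_rank :: "nat \<Rightarrow> 'a::unital_cstar_algebra itself \<Rightarrow> enat" where
  "inj_rank k A = Inf {enat N | N. N \<ge> 1 \<and>
     (\<forall>m\<ge>N. inj_on (GL_stabilisation A k m) (GL_homotopy_group A k (m - 1)))}"

definition surj_rank :: "nat \<Rightarrow> 'a::unital_cstar_algebra itself \<Rightarrow> enat" where
  "surj_rank k A = Inf {enat N | N. N \<ge> 1 \<and>
     (\<forall>m\<ge>N. GL_stabilisation A k m ` GL_homotopy_group A k (m - 1) = GL_homotopy_group A k m)}"


section \<open>Covering dimension\<close>

definition covering_dim_le :: "'x::topological_space itself \<Rightarrow> nat \<Rightarrow> bool" where
  "covering_dim_le X n \<longleftrightarrow>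
     (\<forall>\<U> :: 'x set set. finite \<U> \<and> (\<forall>U\<in>\<U>. open U) \<and> \<Union>\<U> = UNIV \<longrightarrow>
        (\<exists>\<V>. (\<forall>V\<in>\<V>. open V) \<and> \<Union>\<V> = UNIV \<and> (\<forall>V\<in>\<V>. \<exists>U\<in>\<U>. V \<subseteq> U) \<and>
             (\<forall>x. finite {V \<in> \<V>. x \<in> V} \<and> card {V \<in> \<V>. x \<in> V} \<le> n + 1)))"

definition covering_dim :: "'x::topological_space itself \<Rightarrow> enat" where
  "covering_dim X = Inf {enat n | n. covering_dim_le X n}"

end

theory Submission
  imports Defs
begin

text \<open>
  Let \<open>m\<close> be at least the right-hand side.  The map \<open>GL m \<rightarrow> Lg m\<close>, \<open>g \<mapsto> g e\<^sub>m\<close>, has the homotopy lifting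
  property, because nearby unimodular vectors are moved into each other by transvections close to
  the identity, and its fibre deforms to \<open>GL (m - 1)\<close>.  The assumptions on \<open>csr\<close>, \<open>surj\<^sub>k\<close> and
  \<open>inj\<^sub>k\<^sub>-\<^sub>1\<close> therefore say that the homotopy groups of \<open>Lg m\<close> vanish up to degree \<open>n\<close>.  A continuous map
  from \<open>X\<close> to \<open>Lg m\<close>, which is the same as an element of \<open>Lg m\<close> over \<open>C(X) \<otimes> A\<close>, factors up to homotopy
  through the nerve of a finite cover, a complex of dimension at most \<open>n\<close>, and is therefore
  homotopic to a constant map.  Lifting such homotopies over \<open>X\<close> gives paths in \<open>GL m\<close> over \<open>C(X) \<otimes> A\<close>
  that start at the identity.
\<close>

section \<open>Matrices and unimodular vectors\<close>

text \<open>The degrees in the statement come from the piece \<pi>_k(GL (m-1)) -> \<pi>_k(GL m) ->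
  \<pi>_k(Lg m) -> \<pi>_{k-1}(GL (m-1)) -> \<pi>_{k-1}(GL m) of an exact sequence: surjectivity of
  the first map and injectivity of the last make the middle term vanish. No exact sequence is set
  up. Vanishing is recorded as \<open>fillable k\<close>, the extension of maps from the boundary of
  the \<open>k\<close>-cube to the cube; this is free of base points and is what a cube-by-cube
  extension consumes. Degrees up to \<open>n\<close> become cubes of dimension up to
  \<open>n + 1\<close>, the dimension of the cone over an \<open>n\<close>-dimensional nerve. The
  space \<open>X\<close> is only compact Hausdorff and has no cells to induct over. Cells enter
  through the nerve, and the comparison with it takes place in the target: \<open>Lg m\<close> is
  open in \<open>A\<^sup>m\<close>, so maps that are uniformly close are joined by straight lines.
  All lifting is done over compact parameter spaces, the cubes and \<open>X\<close>, where a
  continuous left inverse and uniform estimates replace bundle theory.\<close>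

lemma matrix_mult_assoc:
  "matrix_mult m (matrix_mult m a b) c = matrix_mult m a (matrix_mult m b c)"
proof (intro ext)
  fix i j
  have "(\<Sum>l<m. (\<Sum>k<m. a i k * b k l) * c l j) = (\<Sum>l<m. \<Sum>k<m. a i k * b k l * c l j)"
    by (simp add: sum_distrib_right)
  also have "\<dots> = (\<Sum>k<m. \<Sum>l<m. a i k * b k l * c l j)"
    by (rule sum.swap)
  also have "\<dots> = (\<Sum>k<m. a i k * (\<Sum>l<m. b k l * c l j))"
    by (simp add: sum_distrib_left mult.assoc)
  finally show "matrix_mult m (matrix_mult m a b) c i j = matrix_mult m a (matrix_mult m b c) i j"
    by (simp add: matrix_mult_def)
qed

lemma sum_indicator_mult:
  fixes f :: "nat \<Rightarrow> 'a::unital_cstar_algebra"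
  assumes "i < m"
  shows "(\<Sum>l<m. (if i = l then 1 else 0) * f l) = f i"
    and "(\<Sum>l<m. f l * (if l = i then 1 else 0)) = f i"
proof -
  have "(\<Sum>l<m. (if i = l then 1 else 0) * f l) = (\<Sum>l<m. if i = l then f l else 0)"
    by (rule sum.cong) auto
  then show "(\<Sum>l<m. (if i = l then 1 else 0) * f l) = f i"
    using assms by simp
  have "(\<Sum>l<m. f l * (if l = i then 1 else 0)) = (\<Sum>l<m. if l = i then f l else 0)"
    by (rule sum.cong) auto
  then show "(\<Sum>l<m. f l * (if l = i then 1 else 0)) = f i"
    using assms by simp
qed

lemma matrix_mult_one_left:
  assumes "a \<in> matrices m"
  shows "matrix_mult m (matrix_one m) a = a"
proof (intro ext)
  fix i j
  show "matrix_mult m (matrix_one m) a i j = a i j"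
    using assms sum_indicator_mult(1)[of i m "\<lambda>l. a l j"]
    by (cases "i < m") (simp_all add: matrix_mult_def matrix_one_def matrices_def)
qed

lemma matrix_mult_one_right:
  assumes "a \<in> matrices m"
  shows "matrix_mult m a (matrix_one m) = a"
proof (intro ext)
  fix i j
  have "(\<Sum>l<m. a i l * (if l < m \<and> l = j then 1 else 0)) = (\<Sum>l<m. a i l * (if l = j then 1 else 0))"
    by (rule sum.cong) auto
  then show "matrix_mult m a (matrix_one m) i j = a i j"
    using assms sum_indicator_mult(2)[of j m "\<lambda>l. a i l"]
    by (cases "j < m") (auto simp add: matrix_mult_def matrix_one_def matrices_def intro!: sum.neutral)
qed

lemma matrix_mult_matrices:
  assumes "a \<in> matrices m" "b \<in> matrices m"
  shows "matrix_mult m a b \<in> matrices m"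
  using assms by (auto simp: matrices_def matrix_mult_def intro!: sum.neutral)

lemma matrix_one_matrices: "matrix_one m \<in> matrices m"
  by (auto simp: matrices_def matrix_one_def)

lemma matrix_act_mult: "matrix_act m (matrix_mult m a b) v = matrix_act m a (matrix_act m b v)"
proof
  fix i
  have "(\<Sum>l<m. (\<Sum>k<m. a i k * b k l) * v l) = (\<Sum>l<m. \<Sum>k<m. a i k * b k l * v l)"
    by (simp add: sum_distrib_right)
  also have "\<dots> = (\<Sum>k<m. \<Sum>l<m. a i k * b k l * v l)"
    by (rule sum.swap)
  also have "\<dots> = (\<Sum>k<m. a i k * (\<Sum>l<m. b k l * v l))"
    by (simp add: sum_distrib_left mult.assoc)
  finally show "matrix_act m (matrix_mult m a b) v i = matrix_act m a (matrix_act m b v) i"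
    by (simp add: matrix_act_def matrix_mult_def)
qed

lemma matrix_act_one:
  assumes "v \<in> vectors m"
  shows "matrix_act m (matrix_one m) v = v"
proof
  fix i
  show "matrix_act m (matrix_one m) v i = v i"
    using assms sum_indicator_mult(1)[of i m v]
    by (cases "i < m") (simp_all add: matrix_act_def matrix_one_def vectors_def)
qed

lemma matrix_act_vectors: "a \<in> matrices m \<Longrightarrow> matrix_act m a v \<in> vectors m"
  by (auto simp: matrices_def vectors_def matrix_act_def intro!: sum.neutral)

section \<open>Inverse matrices\<close>

definition GL_inv :: "nat \<Rightarrow> (nat \<Rightarrow> nat \<Rightarrow> 'a::unital_cstar_algebra) \<Rightarrow> nat \<Rightarrow> nat \<Rightarrow> 'a" where
  "GL_inv m a = (SOME b. b \<in> matrices m \<and>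
     matrix_mult m a b = matrix_one m \<and> matrix_mult m b a = matrix_one m)"

lemma GL_I:
  assumes "a \<in> matrices m" "b \<in> matrices m"
    "matrix_mult m a b = matrix_one m" "matrix_mult m b a = matrix_one m"
  shows "a \<in> GL m"
  using assms by (auto simp: GL_def)

lemma GL_matrices: "a \<in> GL m \<Longrightarrow> a \<in> matrices m"
  by (simp add: GL_def)

lemma
  assumes "a \<in> GL m"
  shows GL_inv_matrices: "GL_inv m a \<in> matrices m"
    and GL_inv_right: "matrix_mult m a (GL_inv m a) = matrix_one m"
    and GL_inv_left: "matrix_mult m (GL_inv m a) a = matrix_one m"
proof -
  have "\<exists>b. b \<in> matrices m \<and> matrix_mult m a b = matrix_one m \<and> matrix_mult m b a = matrix_one m"
    using assms by (auto simp: GL_def)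
  from someI_ex[OF this]
  show "GL_inv m a \<in> matrices m" "matrix_mult m a (GL_inv m a) = matrix_one m"
    "matrix_mult m (GL_inv m a) a = matrix_one m"
    by (simp_all add: GL_inv_def)
qed

lemma GL_GL_inv: "a \<in> GL m \<Longrightarrow> GL_inv m a \<in> GL m"
  by (rule GL_I[of _ _ a]) (simp_all add: GL_matrices GL_inv_matrices GL_inv_left GL_inv_right)

lemma GL_one: "matrix_one m \<in> GL m"
  by (rule GL_I[of _ _ "matrix_one m"]) (simp_all add: matrix_one_matrices matrix_mult_one_left)

lemma GL_inv_mult_cancel:
  assumes "a \<in> GL m" "b \<in> matrices m"
  shows "matrix_mult m (GL_inv m a) (matrix_mult m a b) = b"
    and "matrix_mult m a (matrix_mult m (GL_inv m a) b) = b"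
    and "matrix_mult m (matrix_mult m b a) (GL_inv m a) = b"
    and "matrix_mult m (matrix_mult m b (GL_inv m a)) a = b"
  using assms
  by (simp_all add: GL_inv_left GL_inv_right matrix_mult_one_left matrix_mult_one_right matrix_mult_assoc)
    (simp_all add: GL_inv_left GL_inv_right matrix_mult_one_left matrix_mult_assoc[symmetric])

lemma GL_mult:
  assumes "a \<in> GL m" "b \<in> GL m"
  shows "matrix_mult m a b \<in> GL m"
proof (rule GL_I[of _ _ "matrix_mult m (GL_inv m b) (GL_inv m a)"])
  show "matrix_mult m (matrix_mult m a b) (matrix_mult m (GL_inv m b) (GL_inv m a)) = matrix_one m"
    using assms by (simp add: matrix_mult_assoc GL_inv_mult_cancel GL_inv_matrices GL_inv_right)
  show "matrix_mult m (matrix_mult m (GL_inv m b) (GL_inv m a)) (matrix_mult m a b) = matrix_one m"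
    using assms by (simp add: matrix_mult_assoc GL_inv_mult_cancel GL_matrices GL_inv_left)
qed (use assms in \<open>simp_all add: matrix_mult_matrices GL_matrices GL_inv_matrices\<close>)

section \<open>Unimodular vectors and the action of \<open>GL m\<close>\<close>

text \<open>A left ideal is the whole algebra as soon as it contains 1: multiply a representation of
  1 by \<open>y\<close> from the left.\<close>

lemma Lg_iff:
  "u \<in> Lg m \<longleftrightarrow> u \<in> vectors m \<and> (\<exists>c. (\<Sum>i<m. c i * u i) = (1 :: 'a::unital_cstar_algebra))"
proof -
  have "y \<in> {\<Sum>i<m. c i * u i | c. True}" if "(\<Sum>i<m. c i * u i) = 1" for c and y :: 'a
    using that by (auto intro!: exI[of _ "\<lambda>i. y * c i"] simp: mult.assoc simp flip: sum_distrib_left)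
  then have "{\<Sum>i<m. c i * u i | c. True} = UNIV \<longleftrightarrow> (\<exists>c. (\<Sum>i<m. c i * u i) = 1)"
    by (smt (verit, ccfv_SIG) UNIV_I UNIV_eq_I mem_Collect_eq)
  then show ?thesis
    by (simp add: Lg_def)
qed

lemma Lg_vectors: "u \<in> Lg m \<Longrightarrow> u \<in> vectors m"
  by (simp add: Lg_def)

lemma matrix_act_inv_cancel:
  assumes "a \<in> GL m" "v \<in> vectors m"
  shows "matrix_act m (GL_inv m a) (matrix_act m a v) = v"
    and "matrix_act m a (matrix_act m (GL_inv m a) v) = v"
  using assms by (simp_all add: GL_inv_left GL_inv_right matrix_act_one flip: matrix_act_mult)

lemma Lg_I:
  "u \<in> vectors m \<Longrightarrow> (\<Sum>i<m. c i * u i) = (1 :: 'a::unital_cstar_algebra) \<Longrightarrow> u \<in> Lg m"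
  by (auto simp: Lg_iff)

text \<open>If the row \<open>c\<close> is a left inverse of \<open>u\<close>, then \<open>c\<close>
  times the inverse matrix is a left inverse of the image of \<open>u\<close>.\<close>

lemma matrix_act_Lg:
  assumes "a \<in> GL m" "u \<in> Lg m"
  shows "matrix_act m a u \<in> Lg m"
proof -
  obtain c where c: "(\<Sum>i<m. c i * u i) = 1"
    using assms by (auto simp: Lg_iff)
  have "(\<Sum>j<m. (\<Sum>i<m. c i * GL_inv m a i j) * matrix_act m a u j)
      = (\<Sum>i<m. c i * matrix_act m (GL_inv m a) (matrix_act m a u) i)"
    unfolding matrix_act_def[of m "GL_inv m a"] sum_distrib_left sum_distrib_right
    by (subst sum.swap) (simp add: mult.assoc)
  then show ?thesis
    using assms c
    by (intro Lg_I matrix_act_vectors GL_matrices) (simp_all add: matrix_act_inv_cancel Lg_vectors)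
qed

section \<open>Transvections\<close>

text \<open>The correction to the identity is a column times the row \<open>c\<close>; when
  \<open>c u = 1\<close> it sends \<open>u\<close> to exactly \<open>v - u\<close>, and it is small
  when \<open>v\<close> is close to \<open>u\<close>.\<close>

definition transvection ::
  "nat \<Rightarrow> (nat \<Rightarrow> 'a::unital_cstar_algebra) \<Rightarrow> (nat \<Rightarrow> 'a) \<Rightarrow> (nat \<Rightarrow> 'a) \<Rightarrow> nat \<Rightarrow> nat \<Rightarrow> 'a" where
  "transvection m c u v =
     (\<lambda>i j. if i < m \<and> j < m then (if i = j then 1 else 0) + (v i - u i) * c j else 0)"

lemma transvection_act:
  assumes "u \<in> vectors m" "v \<in> vectors m" "(\<Sum>i<m. c i * u i) = 1"
  shows "matrix_act m (transvection m c u v) u = v"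
proof
  fix i
  show "matrix_act m (transvection m c u v) u i = v i"
  proof (cases "i < m")
    case True
    then have "matrix_act m (transvection m c u v) u i
        = (\<Sum>j<m. (if i = j then 1 else 0) * u j + (v i - u i) * (c j * u j))"
      by (auto simp: matrix_act_def transvection_def distrib_right mult.assoc intro!: sum.cong)
    also have "\<dots> = u i + (v i - u i) * 1"
      unfolding sum.distrib sum_indicator_mult(1)[OF True]
      by (simp add: assms(3) flip: sum_distrib_left)
    finally show ?thesis
      by simp
  qed (use assms in \<open>simp add: matrix_act_def transvection_def vectors_def\<close>)
qed

text \<open>A transvection is \<open>1 + w c\<close> with \<open>w = v - u\<close>.  By the Sherman--Morrison formula its inverse is \<open>1 - w (1 + c w)\<^sup>-\<^sup>1 c\<close>,
  and \<open>1 + c (v - u) = c v\<close>.\<close>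

lemma transvection_GL:
  fixes u v :: "nat \<Rightarrow> 'a::unital_cstar_algebra"
  assumes "(\<Sum>i<m. c i * u i) = 1" "y * (\<Sum>i<m. c i * v i) = 1" "(\<Sum>i<m. c i * v i) * y = 1"
  shows "transvection m c u v \<in> GL m"
proof -
  define w where "w i = v i - u i" for i
  define b where "b = (\<lambda>i j. if i < m \<and> j < m then (if i = j then 1 else 0) - w i * y * c j else 0)"
  have cw: "(\<Sum>i<m. c i * w i) = (\<Sum>i<m. c i * v i) - 1"
    by (simp add: w_def right_diff_distrib sum_subtractf assms(1))
  \<comment> \<open>The product of two rank-one perturbations of the identity in general form; both
    one-sided inverse laws are instances, with different \<open>p\<close> and
    \<open>q\<close>.\<close>
  have prod: "(\<Sum>l<m. ((if i = l then 1 else 0) + p * c l) * ((if l = j then 1 else 0) + w l * q))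
      = (if i = j then 1 else 0) + p * c j + w i * q + p * (\<Sum>l<m. c l * w l) * q"
    if "i < m" "j < m" for i j p q
  proof -
    have "(\<Sum>l<m. ((if i = l then 1 else 0) + p * c l) * ((if l = j then 1 else 0) + w l * q))
        = (\<Sum>l<m. (if i = l then 1 else 0) * (if l = j then 1 else 0)
              + (if i = l then 1 else 0) * (w l * q)
              + p * c l * (if l = j then 1 else 0) + p * (c l * w l) * q)"
      by (simp add: algebra_simps)
    also have "\<dots> = (if i = j then 1 else 0) + w i * q + p * c j + p * (\<Sum>l<m. c l * w l) * q"
      unfolding sum.distrib sum_indicator_mult(1)[OF that(1)] sum_indicator_mult(2)[OF that(2)]
      by (simp add: sum_distrib_left sum_distrib_right)
    finally show ?thesis
      by simp
  qed
  \<comment> \<open>Since \<open>c w = c v - 1\<close>, the correction terms of this product cancel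
    by \<open>(c v) y = 1\<close>. Those of the opposite product cancel by
    \<open>y (c v) = 1\<close>.\<close>
  have zero: "w i * c j + w i * (- (y * c j)) + w i * (\<Sum>l<m. c l * w l) * (- (y * c j)) = 0" for i j
  proof -
    have "w i * (\<Sum>l<m. c l * w l) * (y * c j) = w i * ((\<Sum>i<m. c i * v i) * y) * c j - w i * (y * c j)"
      unfolding cw by (simp add: algebra_simps)
    then show ?thesis
      by (simp add: assms(3))
  qed
  have zero': "- (w i * y) * c j + w i * c j + - (w i * y) * (\<Sum>l<m. c l * w l) * c j = 0" for i j
  proof -
    have "w i * y * (\<Sum>l<m. c l * w l) * c j = w i * (y * (\<Sum>i<m. c i * v i)) * c j - w i * y * c j"
      unfolding cw by (simp add: algebra_simps)
    then show ?thesis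
      by (simp add: assms(2))
  qed
  have right: "matrix_mult m (transvection m c u v) b = matrix_one m"
  proof (intro ext)
    fix i j
    show "matrix_mult m (transvection m c u v) b i j = matrix_one m i j"
    proof (cases "i < m \<and> j < m")
      case True
      then have "matrix_mult m (transvection m c u v) b i j = (\<Sum>l<m. ((if i = l then 1 else 0)
          + w i * c l) * ((if l = j then 1 else 0) + w l * (- (y * c j))))"
        by (auto simp: matrix_mult_def transvection_def b_def w_def mult.assoc intro!: sum.cong)
      also have "\<dots> = (if i = j then 1 else 0) + (w i * c j + w i * (- (y * c j))
          + w i * (\<Sum>l<m. c l * w l) * (- (y * c j)))"
        using True by (simp only: prod add.assoc)
      finally show ?thesis
        using True unfolding zero by (simp add: matrix_one_def)
    qed (auto simp: matrix_mult_def transvection_def b_def matrix_one_def)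
  qed
  have left: "matrix_mult m b (transvection m c u v) = matrix_one m"
  proof (intro ext)
    fix i j
    show "matrix_mult m b (transvection m c u v) i j = matrix_one m i j"
    proof (cases "i < m \<and> j < m")
      case True
      then have "matrix_mult m b (transvection m c u v) i j = (\<Sum>l<m. ((if i = l then 1 else 0)
          + (- (w i * y)) * c l) * ((if l = j then 1 else 0) + w l * c j))"
        by (auto simp: matrix_mult_def transvection_def b_def w_def intro!: sum.cong)
      also have "\<dots> = (if i = j then 1 else 0) + (- (w i * y) * c j + w i * c j
          + - (w i * y) * (\<Sum>l<m. c l * w l) * c j)"
        using True by (simp only: prod add.assoc)
      finally show ?thesis
        using True unfolding zero' by (simp add: matrix_one_def)
    qed (auto simp: matrix_mult_def transvection_def b_def matrix_one_def)
  qed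
  show ?thesis
    by (rule GL_I[OF _ _ right left]) (auto simp: matrices_def transvection_def b_def)
qed

section \<open>The last basis vector and its stabiliser\<close>

text \<open>The conjunct \<open>m \<ge> 1\<close> makes the vector zero for \<open>m = 0\<close>,
  where \<open>m - 1\<close> is 0 as well.\<close>

definition last_vector :: "nat \<Rightarrow> nat \<Rightarrow> 'a::unital_cstar_algebra" where
  "last_vector m = (\<lambda>i. if i = m - 1 \<and> m \<ge> 1 then 1 else 0)"

lemma last_vector_Lg: "m \<ge> 1 \<Longrightarrow> last_vector m \<in> Lg m"
  using sum_indicator_mult(1)[of "m - 1" m "last_vector m"]
  by (intro Lg_I[where c = "\<lambda>l. if m - 1 = l then 1 else 0"]) (auto simp: last_vector_def vectors_def)

lemma matrix_act_last:
  assumes "m \<ge> 1"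
  shows "matrix_act m a (last_vector m) i = a i (m - 1)"
proof -
  have "(\<Sum>j<m. a i j * (last_vector m j)) = (\<Sum>j<m. a i j * (if j = m - 1 then 1 else 0))"
    using assms by (simp add: last_vector_def)
  then show ?thesis
    using assms sum_indicator_mult(2)[of "m - 1" m "a i"] by (simp add: matrix_act_def)
qed

lemma sum_split_last: "m \<ge> 1 \<Longrightarrow> (\<Sum>l<m. f l) = (\<Sum>l<m-1. f l) + f (m - 1)"
  for f :: "nat \<Rightarrow> 'b::comm_monoid_add"
  using sum.lessThan_Suc[of f "m - 1"] by simp

lemma stabilise_matrices: "m \<ge> 1 \<Longrightarrow> stabilise m a \<in> matrices m"
  by (auto simp: matrices_def stabilise_def)

lemma stabilise_mult:
  assumes "m \<ge> 1"
  shows "stabilise m (matrix_mult (m - 1) a b) = matrix_mult m (stabilise m a) (stabilise m b)"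
  unfolding matrix_mult_def sum_split_last[OF assms] by (auto simp: fun_eq_iff stabilise_def)

lemma stabilise_one: "m \<ge> 1 \<Longrightarrow> stabilise m (matrix_one (m - 1)) = matrix_one m"
  by (auto simp: stabilise_def matrix_one_def fun_eq_iff)

lemma stabilise_GL:
  assumes "m \<ge> 1" "a \<in> GL (m - 1)"
  shows "stabilise m a \<in> GL m"
  using assms
  by (intro GL_I[of _ _ "stabilise m (GL_inv (m - 1) a)"])
    (simp_all add: stabilise_matrices GL_inv_right GL_inv_left stabilise_one del: One_nat_def
      flip: stabilise_mult)

lemma stabilise_last: "m \<ge> 1 \<Longrightarrow> matrix_act m (stabilise m a) (last_vector m) = last_vector m"
  by (auto simp: fun_eq_iff matrix_act_last) (auto simp: stabilise_def last_vector_def)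

definition corner :: "nat \<Rightarrow> (nat \<Rightarrow> nat \<Rightarrow> 'a::unital_cstar_algebra) \<Rightarrow> nat \<Rightarrow> nat \<Rightarrow> 'a" where
  "corner m a = (\<lambda>i j. if i < m - 1 \<and> j < m - 1 then a i j else 0)"

text \<open>A matrix fixing the last basis vector has that vector as its last column, so it is block
  lower triangular. The same holds for its inverse, hence the upper left blocks are inverse to each
  other.\<close>

lemma corner_GL:
  assumes "m \<ge> 1" "g \<in> GL m" "matrix_act m g (last_vector m) = last_vector m"
  shows "corner m g \<in> GL (m - 1)"
proof -
  let ?h = "GL_inv m g"
  have h: "matrix_act m ?h (last_vector m) = last_vector m"
    using matrix_act_inv_cancel(1)[OF assms(2), of "last_vector m"] assms(1,3)
    by (simp add: Lg_vectors last_vector_Lg)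
  have col: "g i (m - 1) = last_vector m i" "?h i (m - 1) = last_vector m i" for i
    using matrix_act_last[OF assms(1)] assms(3) h by metis+
  have *: "matrix_mult (m - 1) (corner m a) (corner m b) = matrix_one (m - 1)"
    if ab: "matrix_mult m a b = matrix_one m" and a: "\<And>i. a i (m - 1) = last_vector m i" for a b
  proof (intro ext)
    fix i j
    have "matrix_mult m a b i j = matrix_one m i j"
      using ab by simp
    moreover have "a i (m - 1) = 0" if "i < m - 1"
      using that a[of i] by (simp add: last_vector_def)
    ultimately show "matrix_mult (m - 1) (corner m a) (corner m b) i j = matrix_one (m - 1) i j"
      unfolding matrix_mult_def sum_split_last[OF assms(1)]
      by (cases "i < m - 1 \<and> j < m - 1")
        (auto simp: corner_def matrix_one_def)
  qed
  show ?thesis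
  proof (rule GL_I)
    show "corner m g \<in> matrices (m - 1)" "corner m ?h \<in> matrices (m - 1)"
      by (auto simp: corner_def matrices_def)
    show "matrix_mult (m - 1) (corner m g) (corner m ?h) = matrix_one (m - 1)"
      using assms by (intro * GL_inv_right col)
    show "matrix_mult (m - 1) (corner m ?h) (corner m g) = matrix_one (m - 1)"
      using assms by (intro * GL_inv_left col)
  qed
qed

lemma stabilise_corner:
  assumes "m \<ge> 1" "g \<in> matrices m" "matrix_act m g (last_vector m) = last_vector m"
    and "\<And>j. j < m - 1 \<Longrightarrow> g (m - 1) j = 0"
  shows "stabilise m (corner m g) = g"
proof (intro ext)
  fix i j
  have "g i (m - 1) = last_vector m i" for i
    using matrix_act_last[OF assms(1)] assms(3) by metis
  moreover have "i < m - 1 \<or> i = m - 1 \<or> i \<ge> m" "j < m - 1 \<or> j = m - 1 \<or> j \<ge> m"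
    by linarith+
  ultimately show "stabilise m (corner m g) i j = g i j"
    using assms(1,2,4) by (auto simp: stabilise_def corner_def last_vector_def matrices_def)
qed

text \<open>The stabiliser of the last basis vector consists of block matrices with rows
  \<open>(a, 0)\<close> and \<open>(r, 1)\<close>. Right multiplication by this unipotent matrix
  removes \<open>r\<close>, which collapses the fibre onto the image of
  \<open>GL (m - 1)\<close>.\<close>

definition clear_row :: "nat \<Rightarrow> (nat \<Rightarrow> 'a::unital_cstar_algebra) \<Rightarrow> nat \<Rightarrow> nat \<Rightarrow> 'a" where
  "clear_row m r = (\<lambda>i j. matrix_one m i j - (if i = m - 1 \<and> j < m - 1 then r j else 0))"

text \<open>The off-diagonal entries sit in the last row, left of the last column, so products of
  two of them vanish and the rows add. In particular the inverse is given by
  \<open>- r\<close>.\<close>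

lemma clear_row_mult:
  assumes "m \<ge> 1"
  shows "matrix_mult m (clear_row m r) (clear_row m s) = clear_row m (\<lambda>j. r j + s j)"
proof (intro ext)
  fix i j
  have *: "(\<Sum>l<m-1. matrix_one m i l * a l) = (if i < m - 1 then a i else 0)" for a :: "nat \<Rightarrow> 'a"
  proof -
    have "(\<Sum>l<m-1. matrix_one m i l * a l) = (\<Sum>l<m-1. (if i = l then 1 else 0) * a l)"
      by (rule sum.cong) (auto simp: matrix_one_def)
    then show ?thesis
      by (cases "i < m - 1") (auto simp: sum_indicator_mult intro!: sum.neutral)
  qed
  have "(\<Sum>l<m-1. r l * matrix_one m l j) = (if j < m - 1 then r j else 0)"
  proof -
    have "(\<Sum>l<m-1. r l * matrix_one m l j) = (\<Sum>l<m-1. r l * (if l = j then 1 else 0))"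
      by (rule sum.cong) (auto simp: matrix_one_def)
    then show ?thesis
      by (cases "j < m - 1") (auto simp: sum_indicator_mult intro!: sum.neutral)
  qed
  moreover have "(\<Sum>l<m-1. clear_row m r i l * clear_row m s l j)
    = (\<Sum>l<m-1. matrix_one m i l * matrix_one m l j) - (if i = m - 1 then (\<Sum>l<m-1. r l * matrix_one m l j) else 0)"
    by (auto simp: clear_row_def left_diff_distrib sum_subtractf)
  ultimately show "matrix_mult m (clear_row m r) (clear_row m s) i j = clear_row m (\<lambda>j. r j + s j) i j"
    unfolding matrix_mult_def sum_split_last[OF assms] *
    using assms by (auto simp: clear_row_def matrix_one_def)
qed

lemma clear_row_GL:
  assumes "m \<ge> 1"
  shows "clear_row m r \<in> GL m"
proof (rule GL_I[of _ _ "clear_row m (\<lambda>j. - r j)"])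
  have "clear_row m (\<lambda>_. 0) = matrix_one m"
    by (auto simp: fun_eq_iff clear_row_def)
  then show "matrix_mult m (clear_row m r) (clear_row m (\<lambda>j. - r j)) = matrix_one m"
    "matrix_mult m (clear_row m (\<lambda>j. - r j)) (clear_row m r) = matrix_one m"
    using assms by (simp_all add: clear_row_mult)
qed (use assms in \<open>auto simp: matrices_def clear_row_def matrix_one_def\<close>)

lemma clear_row_last: "m \<ge> 1 \<Longrightarrow> matrix_act m (clear_row m r) (last_vector m) = last_vector m"
  by (auto simp: fun_eq_iff matrix_act_last) (auto simp: clear_row_def last_vector_def matrix_one_def)

lemma mult_clear_row_last:
  assumes "m \<ge> 1" "matrix_act m g (last_vector m) = last_vector m" "j < m - 1"
  shows "matrix_mult m g (clear_row m (g (m - 1))) (m - 1) j = 0"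
proof -
  \<comment> \<open>With corner entry 1 the last row is subtracted exactly once.\<close>
  have last: "g (m - 1) (m - 1) = 1"
    using matrix_act_last[OF assms(1), of g "m - 1"] assms(1,2) by (simp add: last_vector_def)
  have "(\<Sum>l<m-1. g (m - 1) l * clear_row m (g (m - 1)) l j)
      = (\<Sum>l<m-1. g (m - 1) l * (if l = j then 1 else 0))"
    by (rule sum.cong) (auto simp: clear_row_def matrix_one_def)
  also have "\<dots> = g (m - 1) j"
    by (rule sum_indicator_mult(2)[OF assms(3)])
  finally show ?thesis
    unfolding matrix_mult_def sum_split_last[OF assms(1)] last
    using assms by (simp add: clear_row_def matrix_one_def)
qed

section \<open>Continuity of inversion\<close>

lemma neumann_inverse:
  fixes w :: "'a::unital_cstar_algebra"
  assumes "norm (1 - w) < 1"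
  obtains y where "y * w = 1" "w * y = 1"
proof
  define x where "x = 1 - w"
  \<comment> \<open>The factor \<open>norm 1\<close> avoids distinguishing the zero algebra, where
    it is 0, from all others, where it is 1.\<close>
  have "norm (x ^ k) \<le> norm (1::'a) * norm x ^ k" for k
  proof (induction k)
    case (Suc k)
    have "norm (x ^ Suc k) \<le> norm x * norm (x ^ k)"
      by (simp add: norm_mult_ineq)
    also have "\<dots> \<le> norm x * (norm (1::'a) * norm x ^ k)"
      by (rule mult_left_mono[OF Suc.IH]) simp
    finally show ?case
      unfolding power_Suc mult.left_commute[of "norm x"] .
  qed simp
  moreover have "summable (\<lambda>k. norm (1::'a) * norm x ^ k)"
    using assms by (intro summable_mult summable_geometric) (simp add: x_def)
  ultimately have sm: "summable (\<lambda>k. x ^ k)"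
    by (metis summable_comparison_test')
  let ?S = "\<Sum>k. x ^ k"
  have head: "(\<Sum>k. x ^ Suc k) = ?S - 1"
    using suminf_split_head[OF sm] by simp
  have "x * ?S = ?S - 1"
    using suminf_mult[OF sm, of x] head by simp
  moreover have "?S * x = ?S - 1"
    using suminf_mult2[OF sm, of x] head by (simp add: power_Suc2 del: power_Suc)
  moreover have "w = 1 - x"
    by (simp add: x_def)
  ultimately show "?S * w = 1" "w * ?S = 1"
    by (simp_all add: left_diff_distrib right_diff_distrib)
qed

lemma continuous_on_apply:
  "continuous_on S f \<Longrightarrow> continuous_on S (\<lambda>x. f x i)"
  by (rule continuous_on_product_then_coordinatewise)

lemma continuous_on_apply2:
  "continuous_on S f \<Longrightarrow> continuous_on S (\<lambda>x. f x i j)"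
  by (rule continuous_on_apply[OF continuous_on_apply])

lemma continuous_on_matrix_mult:
  fixes f g :: "'b::topological_space \<Rightarrow> nat \<Rightarrow> nat \<Rightarrow> 'a::unital_cstar_algebra"
  assumes "continuous_on S f" "continuous_on S g"
  shows "continuous_on S (\<lambda>x. matrix_mult m (f x) (g x))"
  unfolding matrix_mult_def
  by (intro continuous_on_coordinatewise_then_product continuous_on_sum continuous_on_mult
      continuous_on_apply2[OF assms(1)] continuous_on_apply2[OF assms(2)])

lemma continuous_on_matrix_act:
  fixes f :: "'b::topological_space \<Rightarrow> nat \<Rightarrow> nat \<Rightarrow> 'a::unital_cstar_algebra"
  assumes "continuous_on S f" "continuous_on S g"
  shows "continuous_on S (\<lambda>x. matrix_act m (f x) (g x))"
  unfolding matrix_act_def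
  by (intro continuous_on_coordinatewise_then_product continuous_on_sum continuous_on_mult
      continuous_on_apply2[OF assms(1)] continuous_on_apply[OF assms(2)])

section \<open>Norm estimates for inverse matrices\<close>

text \<open>The entrywise sum norm: it is submultiplicative and visibly continuous for the product
  topology.\<close>

definition matrix_norm :: "nat \<Rightarrow> (nat \<Rightarrow> nat \<Rightarrow> 'a::unital_cstar_algebra) \<Rightarrow> real" where
  "matrix_norm m a = (\<Sum>i<m. \<Sum>j<m. norm (a i j))"

lemma matrix_norm_nonneg: "0 \<le> matrix_norm m a"
  by (simp add: matrix_norm_def sum_nonneg)

lemma matrix_norm_triangle:
  "matrix_norm m (\<lambda>i j. a i j + b i j) \<le> matrix_norm m a + matrix_norm m b"
  by (simp add: matrix_norm_def norm_triangle_ineq sum_mono flip: sum.distrib)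

lemma matrix_norm_entry:
  assumes "i < m" "j < m"
  shows "norm (a i j) \<le> matrix_norm m a"
proof -
  have "norm (a i j) \<le> (\<Sum>j<m. norm (a i j))"
    using assms by (intro member_le_sum) auto
  also have "\<dots> \<le> matrix_norm m a"
    unfolding matrix_norm_def
    using assms by (intro member_le_sum[where f = "\<lambda>i. \<Sum>j<m. norm (a i j)"]) (auto intro: sum_nonneg)
  finally show ?thesis .
qed

lemma matrix_norm_mult: "matrix_norm m (matrix_mult m a b) \<le> matrix_norm m a * matrix_norm m b"
proof -
  have "norm (matrix_mult m a b i j) \<le> (\<Sum>l<m. norm (a i l) * norm (b l j))" for i j
    unfolding matrix_mult_def by (intro sum_norm_le norm_mult_ineq)
  then have "matrix_norm m (matrix_mult m a b) \<le> (\<Sum>i<m. \<Sum>j<m. \<Sum>l<m. norm (a i l) * norm (b l j))"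
    unfolding matrix_norm_def by (intro sum_mono)
  also have "\<dots> = (\<Sum>i<m. \<Sum>l<m. norm (a i l) * (\<Sum>j<m. norm (b l j)))"
    unfolding sum_distrib_left by (subst (2) sum.swap) (rule refl)
  also have "\<dots> \<le> (\<Sum>i<m. \<Sum>l<m. norm (a i l) * matrix_norm m b)"
    unfolding matrix_norm_def
    by (intro sum_mono mult_left_mono member_le_sum[where f = "\<lambda>l. \<Sum>j<m. norm (b l j)"])
      (auto intro: sum_nonneg)
  also have "\<dots> = matrix_norm m a * matrix_norm m b"
    by (simp add: matrix_norm_def sum_distrib_right)
  finally show ?thesis .
qed

lemma continuous_on_matrix_norm:
  fixes f :: "'b::topological_space \<Rightarrow> nat \<Rightarrow> nat \<Rightarrow> 'a::unital_cstar_algebra"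
  assumes "continuous_on S f"
  shows "continuous_on S (\<lambda>x. matrix_norm m (f x))"
  unfolding matrix_norm_def
  by (intro continuous_on_sum continuous_on_norm continuous_on_apply2[OF assms])

text \<open>The resolvent identity. It reduces continuity of inversion to a local bound on the
  inverses.\<close>

lemma GL_inv_diff:
  assumes "a \<in> GL m" "b \<in> GL m"
  shows "(\<lambda>i j. GL_inv m a i j - GL_inv m b i j)
    = matrix_mult m (matrix_mult m (GL_inv m a) (\<lambda>i j. b i j - a i j)) (GL_inv m b)"
proof -
  have 1: "matrix_mult m c (\<lambda>i j. b i j - a i j) = (\<lambda>i j. matrix_mult m c b i j - matrix_mult m c a i j)"
    for c by (simp add: matrix_mult_def right_diff_distrib sum_subtractf)
  have 2: "matrix_mult m (\<lambda>i j. p i j - q i j) c = (\<lambda>i j. matrix_mult m p c i j - matrix_mult m q c i j)"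
    for p q c :: "nat \<Rightarrow> nat \<Rightarrow> 'a" by (simp add: matrix_mult_def left_diff_distrib sum_subtractf)
  show ?thesis
    unfolding 1 2 using assms
    by (simp add: GL_inv_mult_cancel GL_inv_left GL_inv_matrices matrix_mult_one_left)
qed

text \<open>By the resolvent identity the two inverses differ by at most half the norm of the
  inverse of \<open>a\<close>, and this half is absorbed on the left.\<close>

lemma matrix_norm_GL_inv:
  assumes "a \<in> GL m" "b \<in> GL m"
    and small: "matrix_norm m (\<lambda>i j. b i j - a i j) * matrix_norm m (GL_inv m b) \<le> 1/2"
  shows "matrix_norm m (GL_inv m a) \<le> 2 * matrix_norm m (GL_inv m b)"
proof -
  let ?N = "matrix_norm m" and ?d = "\<lambda>i j. b i j - a i j"
  let ?e = "\<lambda>i j. GL_inv m a i j - GL_inv m b i j"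
  have "?N ?e \<le> ?N (matrix_mult m (GL_inv m a) ?d) * ?N (GL_inv m b)"
    unfolding GL_inv_diff[OF assms(1,2)] by (rule matrix_norm_mult)
  also have "\<dots> \<le> ?N (GL_inv m a) * ?N ?d * ?N (GL_inv m b)"
    by (intro mult_right_mono matrix_norm_mult matrix_norm_nonneg)
  also have "\<dots> \<le> ?N (GL_inv m a) * (1/2)"
    using mult_left_mono[OF small matrix_norm_nonneg[of m "GL_inv m a"]] by (simp add: mult.assoc)
  finally have "?N ?e \<le> ?N (GL_inv m a) / 2"
    by simp
  moreover have "?N (GL_inv m a) \<le> ?N (GL_inv m b) + ?N ?e"
    using matrix_norm_triangle[of m "GL_inv m b" ?e] by simp
  ultimately show ?thesis
    by linarith
qed

lemma continuous_on_GL_inv': "continuous_on (GL m) (GL_inv m)"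
proof (intro continuous_on_coordinatewise_then_product)
  fix i j
  show "continuous_on (GL m) (\<lambda>a :: nat \<Rightarrow> nat \<Rightarrow> 'a. GL_inv m a i j)"
  proof (cases "i < m \<and> j < m")
    case False
    then have zero: "GL_inv m a i j = 0" if "a \<in> GL m" for a :: "nat \<Rightarrow> nat \<Rightarrow> 'a"
      using GL_inv_matrices[OF that] by (auto simp: matrices_def)
    show ?thesis
      by (rule continuous_on_eq[OF continuous_on_const[where c = 0]]) (simp add: zero)
  next
    case True
    show ?thesis
      unfolding continuous_on_def
    proof
      fix b :: "nat \<Rightarrow> nat \<Rightarrow> 'a"
      assume b: "b \<in> GL m"
      let ?N = "matrix_norm m" and ?d = "\<lambda>a i j. b i j - a i j"
      have "continuous_on (GL m) (\<lambda>a. ?N (?d a))"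
        by (intro continuous_on_matrix_norm continuous_on_coordinatewise_then_product continuous_on_diff
            continuous_on_const continuous_on_apply2[OF continuous_on_id])
      then have d: "((\<lambda>a. ?N (?d a)) \<longlongrightarrow> 0) (at b within GL m)"
        using b unfolding continuous_on_def by (auto simp: matrix_norm_def)
      have "((\<lambda>a. ?N (?d a) * ?N (GL_inv m b)) \<longlongrightarrow> 0 * ?N (GL_inv m b)) (at b within GL m)"
        by (intro tendsto_intros d)
      then have "\<forall>\<^sub>F a in at b within GL m. ?N (?d a) * ?N (GL_inv m b) < 1/2"
        by (rule order_tendstoD(2)) simp
      moreover have "\<forall>\<^sub>F a in at b within GL m. a \<in> GL m"
        by (simp add: eventually_at_filter)
      ultimately have "\<forall>\<^sub>F a in at b within GL m. norm (GL_inv m a i j - GL_inv m b i j)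
          \<le> 2 * ?N (GL_inv m b) * ?N (?d a) * ?N (GL_inv m b)"
      proof eventually_elim
        case (elim a)
        have "norm (GL_inv m a i j - GL_inv m b i j)
            \<le> ?N (\<lambda>i j. GL_inv m a i j - GL_inv m b i j)"
          using True by (intro matrix_norm_entry[where a = "\<lambda>i j. GL_inv m a i j - GL_inv m b i j"]) auto
        also have "\<dots> \<le> ?N (matrix_mult m (GL_inv m a) (?d a)) * ?N (GL_inv m b)"
          unfolding GL_inv_diff[OF elim(2) b] by (rule matrix_norm_mult)
        also have "\<dots> \<le> ?N (GL_inv m a) * ?N (?d a) * ?N (GL_inv m b)"
          by (intro mult_right_mono matrix_norm_mult matrix_norm_nonneg)
        also have "\<dots> \<le> 2 * ?N (GL_inv m b) * ?N (?d a) * ?N (GL_inv m b)"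
          using elim b by (intro mult_right_mono matrix_norm_GL_inv matrix_norm_nonneg) auto
        finally show ?case .
      qed
      moreover have "((\<lambda>a. 2 * ?N (GL_inv m b) * ?N (?d a) * ?N (GL_inv m b))
          \<longlongrightarrow> 2 * ?N (GL_inv m b) * 0 * ?N (GL_inv m b)) (at b within GL m)"
        by (intro tendsto_intros d)
      ultimately have "((\<lambda>a. GL_inv m a i j - GL_inv m b i j) \<longlongrightarrow> 0) (at b within GL m)"
        by (simp add: Lim_null_comparison)
      then show "((\<lambda>a. GL_inv m a i j) \<longlongrightarrow> GL_inv m b i j) (at b within GL m)"
        by (simp add: LIM_zero_iff)
    qed
  qed
qed

lemma continuous_on_GL_inv:
  assumes "continuous_on S f" "f ` S \<subseteq> GL m"
  shows "continuous_on S (\<lambda>x. GL_inv m (f x))"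
  using continuous_on_compose2[OF continuous_on_GL_inv' assms] .

lemma continuous_on_stabilise:
  fixes f :: "'b::topological_space \<Rightarrow> nat \<Rightarrow> nat \<Rightarrow> 'a::unital_cstar_algebra"
  assumes "continuous_on S f"
  shows "continuous_on S (\<lambda>x. stabilise m (f x))"
proof (intro continuous_on_coordinatewise_then_product)
  fix i j
  show "continuous_on S (\<lambda>x. stabilise m (f x) i j)"
    using continuous_on_apply2[OF assms]
    by (cases "i < m - 1 \<and> j < m - 1"; cases "i = m - 1 \<and> j = m - 1") (auto simp: stabilise_def)
qed

lemma continuous_on_corner:
  fixes f :: "'b::topological_space \<Rightarrow> nat \<Rightarrow> nat \<Rightarrow> 'a::unital_cstar_algebra"
  assumes "continuous_on S f"
  shows "continuous_on S (\<lambda>x. corner m (f x))"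
proof (intro continuous_on_coordinatewise_then_product)
  fix i j
  show "continuous_on S (\<lambda>x. corner m (f x) i j)"
    using continuous_on_apply2[OF assms] by (cases "i < m - 1 \<and> j < m - 1") (auto simp: corner_def)
qed

lemma continuous_on_clear_row:
  fixes f :: "'b::topological_space \<Rightarrow> nat \<Rightarrow> 'a::unital_cstar_algebra"
  assumes "continuous_on S f"
  shows "continuous_on S (\<lambda>x. clear_row m (f x))"
proof (intro continuous_on_coordinatewise_then_product)
  fix i j
  show "continuous_on S (\<lambda>x. clear_row m (f x) i j)"
    using continuous_on_apply[OF assms]
    by (cases "i = m - 1 \<and> j < m - 1") (auto simp: clear_row_def intro!: continuous_on_diff continuous_on_const)
qed

lemma continuous_on_transvection:
  fixes c u v :: "'b::topological_space \<Rightarrow> nat \<Rightarrow> 'a::unital_cstar_algebra"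
  assumes "\<And>i. i < m \<Longrightarrow> continuous_on S (\<lambda>x. c x i)" "continuous_on S u" "continuous_on S v"
  shows "continuous_on S (\<lambda>x. transvection m (c x) (u x) (v x))"
proof (intro continuous_on_coordinatewise_then_product)
  fix i j
  show "continuous_on S (\<lambda>x. transvection m (c x) (u x) (v x) i j)"
    using assms by (cases "i < m \<and> j < m")
      (auto simp: transvection_def intro!: continuous_on_add continuous_on_mult continuous_on_diff
        continuous_on_const continuous_on_apply[OF assms(2)] continuous_on_apply[OF assms(3)])
qed

text \<open>Elements are treated as 1 by 1 matrices, so continuity of inversion is inherited from
  \<open>GL 1\<close>; invertibility is the Neumann series.\<close>

lemma continuous_inverse_near_one:
  fixes w :: "'b::topological_space \<Rightarrow> 'a::unital_cstar_algebra"
  assumes "continuous_on S w" "\<And>x. x \<in> S \<Longrightarrow> norm (1 - w x) < 1"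
  obtains y where "continuous_on S y" "\<And>x. x \<in> S \<Longrightarrow> y x * w x = 1"
proof
  define e :: "'a \<Rightarrow> nat \<Rightarrow> nat \<Rightarrow> 'a" where "e z = (\<lambda>i j. if i = 0 \<and> j = 0 then z else 0)" for z
  have GL: "e (w x) \<in> GL 1" if x: "x \<in> S" for x
  proof -
    obtain y where "y * w x = 1" "w x * y = 1"
      using neumann_inverse[OF assms(2)[OF x]] by blast
    then show ?thesis
      by (intro GL_I[of _ _ "e y"]) (auto simp: e_def matrices_def matrix_mult_def matrix_one_def fun_eq_iff)
  qed
  have "continuous_on S (\<lambda>x. e (w x))"
  proof (intro continuous_on_coordinatewise_then_product)
    fix i j
    show "continuous_on S (\<lambda>x. e (w x) i j)"
      using assms(1) by (cases "i = 0 \<and> j = 0") (auto simp: e_def)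
  qed
  then show "continuous_on S (\<lambda>x. GL_inv 1 (e (w x)) 0 0)"
    using GL by (intro continuous_on_apply2[where f = "\<lambda>x. GL_inv 1 (e (w x))"] continuous_on_GL_inv) auto
  show "GL_inv 1 (e (w x)) 0 0 * w x = 1" if x: "x \<in> S" for x
    using fun_cong[OF fun_cong[OF GL_inv_left[OF GL[OF x]]], of 0 0]
    by (simp add: matrix_mult_def e_def matrix_one_def)
qed

section \<open>Partitions of unity and homotopy lifting\<close>

text \<open>Urysohn functions at finitely many points are grouped by a member of the cover
  containing the point. It is the maximum that is normalised, not the sum: some function equals 1 at
  every point, which later places the coordinates on the base of the cubical cone.\<close>

lemma bump_functions:
  fixes S :: "'x::t2_space set" and V :: "'i \<Rightarrow> 'x set"
  assumes S: "compact S" and V: "\<And>i. i \<in> I \<Longrightarrow> open (V i)" and cover: "S \<subseteq> (\<Union>i\<in>I. V i)"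
  obtains \<phi> :: "'i \<Rightarrow> 'x \<Rightarrow> real" where "\<And>i. continuous_on S (\<phi> i)"
    "\<And>i x. x \<in> S \<Longrightarrow> 0 \<le> \<phi> i x \<and> \<phi> i x \<le> 1"
    "\<And>i x. x \<in> S \<Longrightarrow> \<phi> i x \<noteq> 0 \<Longrightarrow> x \<in> V i"
    "\<And>x. x \<in> S \<Longrightarrow> \<exists>i\<in>I. \<phi> i x = 1"
proof -
  have haus: "Hausdorff_space (top_of_set S)"
    by (intro Hausdorff_space_subtopology) (auto simp: Hausdorff_space_def disjnt_def dest!: hausdorff)
  have "completely_regular_space (top_of_set S)"
    using S haus by (intro normal_imp_completely_regular_space compact_Hausdorff_or_regular_imp_normal_space)
      (auto simp: compact_space_subtopology)
  moreover have "\<exists>i\<in>I. x \<in> V i" if "x \<in> S" for x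
    using cover that by blast
  then obtain k where k: "\<And>x. x \<in> S \<Longrightarrow> k x \<in> I \<and> x \<in> V (k x)"
    by metis
  moreover have "closedin (top_of_set S) (S - V (k x))" if "x \<in> S" for x
    using V k that by (simp add: Diff_eq closedin_closed_Int closed_Compl)
  ultimately have "\<exists>g. continuous_on S g \<and> g ` S \<subseteq> {0..1} \<and> g x = 0 \<and> g ` (S - V (k x)) \<subseteq> {1::real}"
    if "x \<in> S" for x
    using that unfolding completely_regular_space_def by (auto simp: image_subset_iff Pi_iff)
  then obtain g where g: "\<And>x. x \<in> S \<Longrightarrow> continuous_on S (g x)"
    "\<And>x. x \<in> S \<Longrightarrow> g x ` S \<subseteq> {0..1}" "\<And>x. x \<in> S \<Longrightarrow> g x x = 0"
    "\<And>x. x \<in> S \<Longrightarrow> g x ` (S - V (k x)) \<subseteq> {1::real}"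
    by metis
  have "\<exists>T. open T \<and> {y \<in> S. g x y < 1/2} = S \<inter> T" if "x \<in> S" for x
  proof -
    have "openin (top_of_set S) (S \<inter> g x -` {..<1/2})"
      using g(1)[OF that] by (intro continuous_openin_preimage_gen) auto
    then show ?thesis
      by (simp add: openin_open vimage_def Int_def)
  qed
  then obtain T where T: "\<And>x. x \<in> S \<Longrightarrow> open (T x) \<and> {y \<in> S. g x y < 1/2} = S \<inter> T x"
    by metis
  have "S \<subseteq> (\<Union>x\<in>S. T x)"
  proof
    fix x assume x: "x \<in> S"
    then have "x \<in> {y \<in> S. g x y < 1/2}"
      using g(3) by simp
    then show "x \<in> (\<Union>x\<in>S. T x)"
      using T x by blast
  qed
  then obtain D where D: "D \<subseteq> S" "finite D" "S \<subseteq> (\<Union>x\<in>D. T x)"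
    using compactE_image[OF S, of S T] T by metis
  \<comment> \<open>At every point one summand \<open>1 - g x y\<close> exceeds 1/2 and the others
    are nonnegative, so doubling and truncating produces the value 1.\<close>
  define \<phi> where "\<phi> i y = min 1 (2 * (\<Sum>x\<in>{x \<in> D. k x = i}. 1 - g x y))" for i y
  have nonneg: "0 \<le> 1 - g x y" if "x \<in> D" "y \<in> S" for x y
    using g(2)[of x] that D by (auto simp: image_subset_iff)
  show ?thesis
  proof
    show "continuous_on S (\<phi> i)" for i
      unfolding \<phi>_def using g(1) D(1) by (intro continuous_intros) auto
    show "0 \<le> \<phi> i y \<and> \<phi> i y \<le> 1" if "y \<in> S" for i y
      using nonneg that by (auto simp: \<phi>_def intro!: sum_nonneg)
    show "y \<in> V i" if y: "y \<in> S" and nz: "\<phi> i y \<noteq> 0" for i y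
    proof (rule ccontr)
      assume "y \<notin> V i"
      then have "1 - g x y = 0" if "x \<in> D" "k x = i" for x
        using g(4)[of x] that D y by auto
      then show False
        using nz by (simp add: \<phi>_def)
    qed
    show "\<exists>i\<in>I. \<phi> i y = 1" if y: "y \<in> S" for y
    proof -
      obtain x where x: "x \<in> D" "y \<in> T x"
        using D(3) y by blast
      then have "g x y < 1/2"
        using T[of x] D(1) y by blast
      moreover have "1 - g x y \<le> (\<Sum>z\<in>{z \<in> D. k z = k x}. 1 - g z y)"
        using x D(2) nonneg y by (intro member_le_sum) auto
      ultimately have "\<phi> (k x) y = 1"
        by (simp add: \<phi>_def)
      then show ?thesis
        using k x D(1) by blast
    qed
  qed
qed

text \<open>Some bump function is 1 at every point, so their sum is at least 1 and can be divided
  by.\<close>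

lemma partition_of_unity:
  fixes S :: "'x::t2_space set" and U :: "'x \<Rightarrow> 'x set"
  assumes S: "compact S" and U: "\<And>x. x \<in> S \<Longrightarrow> openin (top_of_set S) (U x) \<and> x \<in> U x"
  obtains D and \<phi> :: "'x \<Rightarrow> 'x \<Rightarrow> real" where "finite D" "D \<subseteq> S" "\<And>z. continuous_on S (\<phi> z)"
    "\<And>z x. x \<in> S \<Longrightarrow> 0 \<le> \<phi> z x" "\<And>z x. x \<in> S \<Longrightarrow> \<phi> z x \<noteq> 0 \<Longrightarrow> x \<in> U z"
    "\<And>x. x \<in> S \<Longrightarrow> (\<Sum>z\<in>D. \<phi> z x) = 1"
proof -
  obtain T where T: "\<And>x. x \<in> S \<Longrightarrow> open (T x) \<and> U x = S \<inter> T x"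
    using U unfolding openin_open by metis
  have "S \<subseteq> (\<Union>x\<in>S. T x)"
    using U T by blast
  then obtain D where D: "D \<subseteq> S" "finite D" "S \<subseteq> (\<Union>x\<in>D. T x)"
    using compactE_image[OF S, of S T] T by metis
  obtain \<psi> where \<psi>: "\<And>z. continuous_on S (\<psi> z)"
    "\<And>z x. x \<in> S \<Longrightarrow> 0 \<le> \<psi> z x \<and> \<psi> z x \<le> (1::real)"
    "\<And>z x. x \<in> S \<Longrightarrow> \<psi> z x \<noteq> 0 \<Longrightarrow> x \<in> T z"
    "\<And>x. x \<in> S \<Longrightarrow> \<exists>z\<in>D. \<psi> z x = 1"
    by (rule bump_functions[OF S, of D T]) (use D T in auto)
  define \<phi> where "\<phi> z x = (if z \<in> D then \<psi> z x / (\<Sum>z\<in>D. \<psi> z x) else 0)" for z x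
  have pos: "(\<Sum>z\<in>D. \<psi> z x) > 0" if x: "x \<in> S" for x
  proof -
    obtain z where "z \<in> D" "\<psi> z x = 1"
      using \<psi>(4)[OF x] by blast
    then have "1 \<le> (\<Sum>z\<in>D. \<psi> z x)"
      using D(2) \<psi>(2)[OF x] member_le_sum[of z D "\<lambda>z. \<psi> z x"] by auto
    then show ?thesis
      by simp
  qed
  show ?thesis
  proof
    show "continuous_on S (\<phi> z)" for z
    proof (cases "z \<in> D")
      case True
      have "continuous_on S (\<lambda>x. \<psi> z x / (\<Sum>z\<in>D. \<psi> z x))"
        using pos by (intro continuous_on_divide continuous_on_sum \<psi>) force
      then show ?thesis
        using True by (simp add: \<phi>_def)
    qed (simp add: \<phi>_def)
    show "0 \<le> \<phi> z x" if "x \<in> S" for z x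
      using pos[OF that] \<psi>(2)[OF that, of z] by (simp add: \<phi>_def)
    show "x \<in> U z" if "x \<in> S" "\<phi> z x \<noteq> 0" for z x
      using \<psi>(3)[of x z] T[of z] D(1) that by (auto simp: \<phi>_def split: if_splits)
    show "(\<Sum>z\<in>D. \<phi> z x) = 1" if "x \<in> S" for x
      using pos[OF that] by (simp add: \<phi>_def flip: sum_divide_distrib)
  qed (use D in auto)
qed

text \<open>\<open>S\<close> carries no uniform structure, so uniformity in \<open>x\<close> comes
  from a tube argument over the compact \<open>S\<close>, and uniformity in the parameter from a
  Lebesgue number of the interval.\<close>

lemma uniformly_continuous_in_parameter:
  fixes f :: "'x::topological_space \<times> real \<Rightarrow> 'b::metric_space"
  assumes S: "compact S" and f: "continuous_on (S \<times> {0..1}) f" and "e > 0"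
  obtains d where "d > 0"
    "\<And>x s s'. x \<in> S \<Longrightarrow> s \<in> {0..1} \<Longrightarrow> s' \<in> {0..1} \<Longrightarrow> \<bar>s - s'\<bar> < d \<Longrightarrow> dist (f (x, s)) (f (x, s')) < e"
proof -
  have swap: "continuous_on ({0..1} \<times> S) (\<lambda>(s, x). f (x, s))"
    unfolding case_prod_unfold
    by (rule continuous_on_compose2[OF f]) (auto intro!: continuous_intros)
  have "\<exists>U. s \<in> U \<and> open U \<and> (\<forall>t\<in>U \<inter> {0..1}. \<forall>x\<in>S. dist (f (x, t)) (f (x, s)) \<le> e/3)"
    if s: "s \<in> {0..1}" for s
  proof (rule continuous_on_prod_compactE[OF swap S s, of "e/3"])
    fix U
    assume "s \<in> U" "open U"
      "\<forall>t\<in>U \<inter> {0..1}. \<forall>x\<in>S. dist (case (t, x) of (s, x) \<Rightarrow> f (x, s)) (case (s, x) of (s, x) \<Rightarrow> f (x, s)) \<le> e/3"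
    then show ?thesis
      by auto
  qed (use \<open>e > 0\<close> in simp)
  then obtain U where U: "\<And>s. s \<in> {0..1} \<Longrightarrow> s \<in> U s" "\<And>s. s \<in> {0..1} \<Longrightarrow> open (U s)"
    "\<And>s t x. s \<in> {0..1} \<Longrightarrow> t \<in> U s \<Longrightarrow> t \<in> {0..1} \<Longrightarrow> x \<in> S \<Longrightarrow> dist (f (x, t)) (f (x, s)) \<le> e/3"
    by (metis IntI)
  obtain d where d: "0 < d" "\<And>s. s \<in> {0..1} \<Longrightarrow> \<exists>G\<in>U ` {0..1}. ball s d \<subseteq> G"
    by (rule Heine_Borel_lemma[of "{0..1::real}" "U ` {0..1}"]) (use U in auto)
  show ?thesis
  proof (rule that[OF d(1)])
    fix x s s'
    assume *: "x \<in> S" "s \<in> {0..1}" "s' \<in> {0..1::real}" "\<bar>s - s'\<bar> < d"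
    obtain r where "r \<in> {0..1}" "ball s d \<subseteq> U r"
      using d(2)[OF *(2)] by blast
    moreover have "s \<in> ball s d" "s' \<in> ball s d"
      using * by (auto simp: dist_real_def)
    ultimately have "dist (f (x, s)) (f (x, r)) \<le> e/3" "dist (f (x, s')) (f (x, r)) \<le> e/3"
      using U(3) * by blast+
    then show "dist (f (x, s)) (f (x, s')) < e"
      using dist_triangle2[of "f (x, s)" "f (x, s')" "f (x, r)"] \<open>e > 0\<close> by linarith
  qed
qed

text \<open>Left inverses of a fixed vector form a convex set, so they can be glued; inverting at the end
  makes it enough to glue approximate left inverses that are locally constant.\<close>

lemma continuous_left_inverse:
  fixes H :: "'x::t2_space \<Rightarrow> nat \<Rightarrow> 'a::unital_cstar_algebra"
  assumes S: "compact S" and H: "continuous_on S H" "H ` S \<subseteq> Lg m"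
  obtains c where "continuous_on S c" "\<And>x. x \<in> S \<Longrightarrow> (\<Sum>i<m. c x i * H x i) = 1"
proof -
  have "\<exists>b. (\<Sum>i<m. b i * H x i) = 1" if "x \<in> S" for x
    using H(2) that by (auto simp: Lg_iff)
  then obtain b where b: "\<And>x. x \<in> S \<Longrightarrow> (\<Sum>i<m. b x i * H x i) = 1"
    by metis
  define U where "U x = {y \<in> S. norm (1 - (\<Sum>i<m. b x i * H y i)) < 1/2}" for x
  have "openin (top_of_set S) (U x) \<and> x \<in> U x" if "x \<in> S" for x
  proof
    have "continuous_on S (\<lambda>y. norm (1 - (\<Sum>i<m. b x i * H y i)))"
      by (intro continuous_on_norm continuous_on_diff continuous_on_const continuous_on_sum
          continuous_on_mult continuous_on_apply[OF H(1)])
    then have "openin (top_of_set S) (S \<inter> (\<lambda>y. norm (1 - (\<Sum>i<m. b x i * H y i))) -` {..<1/2})"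
      by (intro continuous_openin_preimage_gen) auto
    then show "openin (top_of_set S) (U x)"
      by (simp add: U_def vimage_def Int_def)
    show "x \<in> U x"
      using that by (simp add: U_def b)
  qed
  then obtain D and \<phi> :: "'x \<Rightarrow> 'x \<Rightarrow> real" where D: "finite D" "D \<subseteq> S"
    and \<phi>: "\<And>z. continuous_on S (\<phi> z)" "\<And>z x. x \<in> S \<Longrightarrow> 0 \<le> \<phi> z x"
    "\<And>z x. x \<in> S \<Longrightarrow> \<phi> z x \<noteq> 0 \<Longrightarrow> x \<in> U z" "\<And>x. x \<in> S \<Longrightarrow> (\<Sum>z\<in>D. \<phi> z x) = 1"
    using partition_of_unity[OF S, of U] by blast
  define a where "a x i = (\<Sum>z\<in>D. \<phi> z x *\<^sub>R b z i)" for x i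
  define w where "w x = (\<Sum>i<m. a x i * H x i)" for x
  have a: "continuous_on S (\<lambda>x. a x i)" for i
    unfolding a_def by (intro continuous_on_sum continuous_on_scaleR \<phi> continuous_on_const)
  have w: "continuous_on S w"
    unfolding w_def by (intro continuous_on_sum continuous_on_mult a continuous_on_apply[OF H(1)])
  have near: "norm (1 - w x) < 1" if x: "x \<in> S" for x
  proof -
    have "w x = (\<Sum>z\<in>D. \<phi> z x *\<^sub>R (\<Sum>i<m. b z i * H x i))"
      unfolding w_def a_def sum_distrib_right scaleR_sum_right
      by (subst sum.swap) simp
    moreover have "1 = (\<Sum>z\<in>D. \<phi> z x *\<^sub>R (1 :: 'a))"
      using \<phi>(4)[OF x] by (simp flip: scaleR_sum_left)
    ultimately have "1 - w x = (\<Sum>z\<in>D. \<phi> z x *\<^sub>R (1 - (\<Sum>i<m. b z i * H x i)))"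
      by (simp add: scaleR_diff_right sum_subtractf)
    also have "norm \<dots> \<le> (\<Sum>z\<in>D. \<phi> z x * (1/2))"
    proof (rule sum_norm_le)
      fix z
      show "norm (\<phi> z x *\<^sub>R (1 - (\<Sum>i<m. b z i * H x i))) \<le> \<phi> z x * (1/2)"
        using \<phi>(2,3)[OF x, of z] by (cases "\<phi> z x = 0") (auto simp: U_def intro!: mult_left_mono)
    qed
    also have "\<dots> = 1/2"
      by (metis \<phi>(4)[OF x] mult_1 sum_distrib_right)
    finally show ?thesis
      by simp
  qed
  obtain y where y: "continuous_on S y" "\<And>x. x \<in> S \<Longrightarrow> y x * w x = 1"
    using continuous_inverse_near_one[OF w near] by blast
  show ?thesis
  proof
    show "continuous_on S (\<lambda>x i. y x * a x i)"
      by (intro continuous_on_coordinatewise_then_product continuous_on_mult y a)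
    show "(\<Sum>i<m. y x * a x i * H x i) = 1" if "x \<in> S" for x
      using y(2)[OF that] by (simp add: w_def sum_distrib_left mult.assoc)
  qed
qed

lemma transvection_same: "transvection m c u u = matrix_one m"
  by (auto simp: transvection_def matrix_one_def fun_eq_iff)

text \<open>Homotopy lifting for the action of \<open>GL m\<close>: over short parameter intervals the lift is a
  transvection, and these are multiplied together.\<close>

lemma lift_homotopy:
  fixes H :: "'x::t2_space \<times> real \<Rightarrow> nat \<Rightarrow> 'a::unital_cstar_algebra"
  assumes S: "compact S" and H: "continuous_on (S \<times> {0..1}) H" "H ` (S \<times> {0..1}) \<subseteq> Lg m"
  obtains G where "continuous_on (S \<times> {0..1}) G" "G ` (S \<times> {0..1}) \<subseteq> GL m"
    "\<And>x. x \<in> S \<Longrightarrow> G (x, 0) = matrix_one m"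
    "\<And>x s. x \<in> S \<Longrightarrow> s \<in> {0..1} \<Longrightarrow> matrix_act m (G (x, s)) (H (x, 0)) = H (x, s)"
proof -
  have SI: "compact (S \<times> {0..1::real})"
    by (intro compact_Times S compact_Icc)
  obtain c where c: "continuous_on (S \<times> {0..1}) c"
    "\<And>p. p \<in> S \<times> {0..1} \<Longrightarrow> (\<Sum>i<m. c p i * H p i) = 1"
    using continuous_left_inverse[OF SI H] by blast
  \<comment> \<open>The left inverse stays frozen at a point \<open>(x, s')\<close> while
    \<open>H\<close> moves to parameter \<open>s\<close>; hence the product has two parameters.
    Keeping it within distance 1 of the identity, the Neumann range, makes the transvection from
    \<open>s'\<close> to \<open>s\<close> invertible.\<close>
  have cH: "continuous_on ((S \<times> {0..1}) \<times> {0..1}) (\<lambda>q. \<Sum>i<m. c (fst q) i * H (fst (fst q), snd q) i)"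
    by (intro continuous_on_sum continuous_on_mult
        continuous_on_compose2[OF continuous_on_apply[OF c(1)]]
        continuous_on_compose2[OF continuous_on_apply[OF H(1)]]) (auto intro!: continuous_intros)
  obtain d where d: "d > 0" "\<And>p s s'. p \<in> S \<times> {0..1} \<Longrightarrow> s \<in> {0..1} \<Longrightarrow> s' \<in> {0..1} \<Longrightarrow>
      \<bar>s - s'\<bar> < d \<Longrightarrow> dist (\<Sum>i<m. c p i * H (fst p, s) i) (\<Sum>i<m. c p i * H (fst p, s') i) < 1"
    by (rule uniformly_continuous_in_parameter[OF SI cH, of 1]) auto
  define E where "E x s s' = transvection m (c (x, s')) (H (x, s')) (H (x, s))" for x s s'
  have E: "E x s s' \<in> GL m" "matrix_act m (E x s s') (H (x, s')) = H (x, s)"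
    if "x \<in> S" "s \<in> {0..1}" "s' \<in> {0..1}" "\<bar>s - s'\<bar> < d" for x s s'
  proof -
    have 1: "(\<Sum>i<m. c (x, s') i * H (x, s') i) = 1"
      using that c(2) by auto
    have "norm (1 - (\<Sum>i<m. c (x, s') i * H (x, s) i)) < 1"
      using d(2)[of "(x, s')" s s'] that 1 by (simp add: dist_norm norm_minus_commute)
    then show "E x s s' \<in> GL m"
      unfolding E_def by (rule neumann_inverse) (rule transvection_GL[OF 1])
    show "matrix_act m (E x s s') (H (x, s')) = H (x, s)"
      unfolding E_def using H(2) that 1 by (intro transvection_act Lg_vectors) auto
  qed
  obtain N :: nat where N: "N > 0" "1 / N < d"
    using ex_inverse_of_nat_less[OF d(1)] by (auto simp: inverse_eq_divide)
  \<comment> \<open>The homotopy is stopped at time \<open>k / N\<close>. Stopping instead of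
    restricting keeps the domain fixed during the induction, so nothing has to be glued along
    subintervals.\<close>
  have "\<exists>G. continuous_on (S \<times> {0..1}) G \<and> G ` (S \<times> {0..1}) \<subseteq> GL m \<and> (\<forall>x\<in>S. G (x, 0) = matrix_one m) \<and>
      (\<forall>x\<in>S. \<forall>s\<in>{0..1}. matrix_act m (G (x, s)) (H (x, 0)) = H (x, min s (k / N)))" for k :: nat
  proof (induction k)
    case 0
    have "matrix_act m (matrix_one m) (H (x, 0)) = H (x, min s 0)" if "x \<in> S" "s \<in> {0..1}" for x s
      using H(2) that by (auto simp: image_subset_iff min_def intro!: matrix_act_one Lg_vectors)
    then show ?case
      by (intro exI[of _ "\<lambda>_. matrix_one m"]) (auto simp: GL_one)
  next
    case (Suc k)
    then obtain G where G: "continuous_on (S \<times> {0..1}) G" "G ` (S \<times> {0..1}) \<subseteq> GL m"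
      "\<And>x. x \<in> S \<Longrightarrow> G (x, 0) = matrix_one m"
      "\<And>x s. x \<in> S \<Longrightarrow> s \<in> {0..1} \<Longrightarrow> matrix_act m (G (x, s)) (H (x, 0)) = H (x, min s (k / N))"
      by blast
    let ?E = "\<lambda>x s. E x (min s (Suc k / N)) (min s (k / N))"
    have close: "\<bar>min s (Suc k / N) - min s (k / N)\<bar> < d" if "s \<in> {0..1}" for s :: real
    proof -
      have *: "\<bar>min s (a + b) - min s a\<bar> \<le> b" if "b \<ge> 0" for a b :: real
        using that by (auto simp: min_def)
      have "Suc k / N = k / N + 1 / N"
        by (simp add: add_divide_distrib)
      then show ?thesis
        using *[of "1 / N" "k / N"] N(2) by simp
    qed
    have rng: "min s (k / N) \<in> {0..1}" "min s (Suc k / N) \<in> {0..1}" if "s \<in> {0..1}" for s :: real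
      using that by (auto simp: min_def)
    have *: "?E x s \<in> GL m" "matrix_act m (?E x s) (H (x, min s (k / N))) = H (x, min s (Suc k / N))"
      if "x \<in> S" "s \<in> {0..1}" for x s
      using E[OF that(1) rng(2)[OF that(2)] rng(1)[OF that(2)] close[OF that(2)]] by auto
    have mp: "continuous_on (S \<times> {0..1}) (\<lambda>p. (fst p, min (snd p) r))"
      "(\<lambda>p. (fst p, min (snd p) r)) ` (S \<times> {0..1}) \<subseteq> S \<times> {0..1}" if "r \<ge> 0" for r :: real
      using that by (auto intro!: continuous_intros)
    have "continuous_on (S \<times> {0..1}) (\<lambda>p. ?E (fst p) (snd p))"
      unfolding E_def
      by (intro continuous_on_transvection continuous_on_compose2[OF continuous_on_apply[OF c(1)] mp]
          continuous_on_compose2[OF H(1) mp]) auto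
    then have "continuous_on (S \<times> {0..1}) (\<lambda>p. matrix_mult m (?E (fst p) (snd p)) (G p))"
      by (intro continuous_on_matrix_mult G)
    moreover have "matrix_mult m (?E x 0) (G (x, 0)) = matrix_one m" if "x \<in> S" for x
      using that by (simp add: G(3) E_def transvection_same matrix_mult_one_left matrix_one_matrices)
    ultimately show ?case
      using G *
      by (intro exI[of _ "\<lambda>p. matrix_mult m (?E (fst p) (snd p)) (G p)"])
        (auto simp: matrix_act_mult intro!: GL_mult)
  qed
  from this[of N] N(1) that show ?thesis
    by (auto simp: min_absorb1)
qed

section \<open>Maps on cubes and their homotopy classes\<close>

text \<open>Tychonoff: the cube is a product of \<open>k\<close> intervals and infinitely many
  points.\<close>

lemma compact_unit_cube: "compact (unit_cube k)"
proof -
  let ?J = "\<lambda>i. if i < k then {0..1} else {0::real}"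
  have "t \<in> unit_cube k \<longleftrightarrow> (\<forall>i. t i \<in> ?J i)" for t
  proof
    show "\<forall>i. t i \<in> ?J i" if "t \<in> unit_cube k"
      using that by (simp add: unit_cube_def)
    assume J: "\<forall>i. t i \<in> ?J i"
    have "0 \<le> t i \<and> t i \<le> 1" if "i < k" for i
      using J[rule_format, of i] that by simp
    moreover have "t i = 0" if "k \<le> i" for i
      using J[rule_format, of i] that by simp
    ultimately show "t \<in> unit_cube k"
      by (simp add: unit_cube_def)
  qed
  then have "unit_cube k = PiE UNIV ?J"
    by (intro set_eqI) (simp add: PiE_iff extensional_def)
  moreover have "compactin (product_topology (\<lambda>i. euclidean) UNIV) (PiE UNIV ?J)"
    unfolding compactin_PiE by (intro disjI2 ballI) simp
  ultimately show ?thesis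
    by (simp add: euclidean_product_topology)
qed

lemma cube_boundary_subset: "cube_boundary k \<subseteq> unit_cube k"
  by (auto simp: cube_boundary_def)

lemma cube_homotopyI:
  fixes H :: "real \<times> (nat \<Rightarrow> real) \<Rightarrow> 'b::topological_space"
  assumes "continuous_on ({0..1} \<times> unit_cube k) H" "H ` ({0..1} \<times> unit_cube k) \<subseteq> Y"
    and "\<And>t. t \<in> unit_cube k \<Longrightarrow> H (0, t) = f t" "\<And>t. t \<in> unit_cube k \<Longrightarrow> H (1, t) = g t"
    and "\<And>s t. s \<in> {0..1} \<Longrightarrow> t \<in> cube_boundary k \<Longrightarrow> H (s, t) = y"
  shows "(f, g) \<in> cube_homotopy k Y y"
proof -
  have "homotopic_with_canon (\<lambda>h. h ` cube_boundary k \<subseteq> {y}) (unit_cube k) Y f g"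
  proof (subst homotopic_with)
    show "(h ` cube_boundary k \<subseteq> {y}) = (h' ` cube_boundary k \<subseteq> {y})"
      if "\<And>x. x \<in> topspace (top_of_set (unit_cube k)) \<Longrightarrow> h x = h' x" for h h' :: "(nat \<Rightarrow> real) \<Rightarrow> 'b"
    proof -
      have "h x = h' x" if "x \<in> cube_boundary k" for x
        using \<open>\<And>x. x \<in> topspace (top_of_set (unit_cube k)) \<Longrightarrow> h x = h' x\<close> cube_boundary_subset that by fastforce
      then have "h ` cube_boundary k = h' ` cube_boundary k"
        by (rule image_cong[OF refl])
      then show ?thesis
        by simp
    qed
    have "continuous_map (prod_topology (top_of_set {0..1}) (top_of_set (unit_cube k))) (top_of_set Y) H"
      using assms(1,2) by (simp add: image_subset_iff_funcset)
    then show "\<exists>h. continuous_map (prod_topology (top_of_set {0..1::real}) (top_of_set (unit_cube k))) (top_of_set Y) h \<and>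
        (\<forall>x\<in>topspace (top_of_set (unit_cube k)). h (0, x) = f x) \<and>
        (\<forall>x\<in>topspace (top_of_set (unit_cube k)). h (1, x) = g x) \<and>
        (\<forall>t\<in>{0..1}. (\<lambda>x. h (t, x)) ` cube_boundary k \<subseteq> {y})"
      by (intro exI[of _ H] conjI) (simp_all add: assms(3-5) image_subset_iff)
  qed
  then show ?thesis
    by (simp add: cube_homotopy_def)
qed

lemma cube_homotopyE:
  assumes "(f, g) \<in> cube_homotopy k Y y"
  obtains H where "continuous_on ({0..1::real} \<times> unit_cube k) H" "H ` ({0..1} \<times> unit_cube k) \<subseteq> Y"
    "\<And>t. H (0, t) = f t" "\<And>t. H (1, t) = g t"
    "\<And>s t. s \<in> {0..1} \<Longrightarrow> t \<in> cube_boundary k \<Longrightarrow> H (s, t) = y"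
proof -
  from assms obtain H where
    "continuous_map (prod_topology (top_of_set {0..1::real}) (top_of_set (unit_cube k))) (top_of_set Y) H"
    "\<forall>t. H (0, t) = f t" "\<forall>t. H (1, t) = g t" "\<forall>s\<in>{0..1}. (\<lambda>t. H (s, t)) ` cube_boundary k \<subseteq> {y}"
    unfolding cube_homotopy_def homotopic_with_def mem_Collect_eq case_prod_conv by (elim exE conjE)
  then show ?thesis
    by (intro that[of H]) (auto simp: image_subset_iff Pi_iff)
qed

text \<open>Cube maps are total functions, but only their values on the cube matter.\<close>

lemma cube_homotopy_cong:
  assumes "(f, g) \<in> cube_homotopy k Y y"
    and "\<And>t. t \<in> unit_cube k \<Longrightarrow> f t = f' t" "\<And>t. t \<in> unit_cube k \<Longrightarrow> g t = g' t"
  shows "(f', g') \<in> cube_homotopy k Y y"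
proof -
  obtain H where "continuous_on ({0..1::real} \<times> unit_cube k) H" "H ` ({0..1} \<times> unit_cube k) \<subseteq> Y"
    "\<And>t. H (0, t) = f t" "\<And>t. H (1, t) = g t"
    "\<And>s t. s \<in> {0..1} \<Longrightarrow> t \<in> cube_boundary k \<Longrightarrow> H (s, t) = y"
    using cube_homotopyE[OF assms(1)] by blast
  then show ?thesis
    using assms(2,3) by (intro cube_homotopyI[of k H]) auto
qed

lemma cube_homotopy_refl:
  assumes "f \<in> cube_maps k Y y"
  shows "(f, f) \<in> cube_homotopy k Y y"
  using assms by (auto simp: cube_homotopy_def cube_maps_def)

lemma cube_homotopy_sym: "(f, g) \<in> cube_homotopy k Y y \<Longrightarrow> (g, f) \<in> cube_homotopy k Y y"
  by (simp add: cube_homotopy_def homotopic_with_sym)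

lemma cube_homotopy_trans:
  "(f, g) \<in> cube_homotopy k Y y \<Longrightarrow> (g, h) \<in> cube_homotopy k Y y \<Longrightarrow> (f, h) \<in> cube_homotopy k Y y"
  unfolding cube_homotopy_def mem_Collect_eq case_prod_conv by (rule homotopic_with_trans)

lemma cube_homotopy_class_eq:
  "(f, g) \<in> cube_homotopy k Y y \<Longrightarrow> cube_homotopy k Y y `` {f} = cube_homotopy k Y y `` {g}"
  by (rule set_eqI, unfold Image_singleton_iff) (blast intro: cube_homotopy_trans cube_homotopy_sym)

lemma cube_homotopy_class_eqD:
  assumes "cube_homotopy k Y y `` {f} = cube_homotopy k Y y `` {g}" "g \<in> cube_maps k Y y"
  shows "(f, g) \<in> cube_homotopy k Y y"
  using cube_homotopy_refl[OF assms(2)] assms(1) by (simp add: set_eq_iff)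

lemma cube_homotopy_compose:
  assumes "(f, g) \<in> cube_homotopy k Y y"
    and \<phi>: "continuous_on Y \<phi>" "\<phi> ` Y \<subseteq> Z" "\<phi> y = z"
  shows "(\<phi> \<circ> f, \<phi> \<circ> g) \<in> cube_homotopy k Z z"
proof -
  obtain H where H: "continuous_on ({0..1::real} \<times> unit_cube k) H" "H ` ({0..1} \<times> unit_cube k) \<subseteq> Y"
    "\<And>t. H (0, t) = f t" "\<And>t. H (1, t) = g t"
    "\<And>s t. s \<in> {0..1} \<Longrightarrow> t \<in> cube_boundary k \<Longrightarrow> H (s, t) = y"
    using cube_homotopyE[OF assms(1)] by blast
  show ?thesis
  proof (rule cube_homotopyI)
    show "continuous_on ({0..1} \<times> unit_cube k) (\<lambda>p. \<phi> (H p))"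
      by (rule continuous_on_compose2[OF \<phi>(1) H(1) H(2)])
    show "(\<lambda>p. \<phi> (H p)) ` ({0..1} \<times> unit_cube k) \<subseteq> Z"
      using H(2) \<phi>(2) by blast
  qed (simp_all add: H(3-5) \<phi>(3))
qed

text \<open>All representatives have homotopic images and the class is nonempty, so the union
  defining \<open>induced_map\<close> is a single class.\<close>

lemma induced_map_class:
  assumes "f \<in> cube_maps k Y y" and \<phi>: "continuous_on Y \<phi>" "\<phi> ` Y \<subseteq> Z" "\<phi> y = z"
  shows "induced_map k Z z \<phi> (cube_homotopy k Y y `` {f}) = cube_homotopy k Z z `` {\<phi> \<circ> f}"
proof -
  have "cube_homotopy k Z z `` {\<phi> \<circ> g} = cube_homotopy k Z z `` {\<phi> \<circ> f}"
    if "(f, g) \<in> cube_homotopy k Y y" for g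
    using cube_homotopy_class_eq[OF cube_homotopy_compose[OF that \<phi>]] by simp
  moreover have "cube_homotopy k Y y `` {f} \<noteq> {}"
    using cube_homotopy_refl[OF assms(1)] by blast
  ultimately show ?thesis
    unfolding induced_map_def by (subst SUP_eq_const) simp_all
qed

section \<open>Stabilisation in terms of representatives\<close>

lemma stabilise_pointed_map:
  assumes "m \<ge> 1"
  shows "continuous_on (GL (m - 1)) (stabilise m :: _ \<Rightarrow> nat \<Rightarrow> nat \<Rightarrow> 'a::unital_cstar_algebra)"
    and "stabilise m ` GL (m - 1) \<subseteq> (GL m :: (nat \<Rightarrow> nat \<Rightarrow> 'a) set)"
    and "stabilise m (matrix_one (m - 1)) = (matrix_one m :: nat \<Rightarrow> nat \<Rightarrow> 'a)"
proof -
  show "continuous_on (GL (m - 1)) (stabilise m :: _ \<Rightarrow> nat \<Rightarrow> nat \<Rightarrow> 'a)"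
    by (rule continuous_on_stabilise[OF continuous_on_id])
  show "stabilise m ` GL (m - 1) \<subseteq> (GL m :: (nat \<Rightarrow> nat \<Rightarrow> 'a) set)"
    using stabilise_GL[OF assms] by blast
qed (rule stabilise_one[OF assms])

lemma GL_stabilisation_injD:
  fixes f g :: "(nat \<Rightarrow> real) \<Rightarrow> nat \<Rightarrow> nat \<Rightarrow> 'a::unital_cstar_algebra"
  assumes "m \<ge> 1" and inj: "inj_on (GL_stabilisation TYPE('a) k m) (GL_homotopy_group TYPE('a) k (m - 1))"
    and fg: "f \<in> cube_maps k (GL (m - 1)) (matrix_one (m - 1))" "g \<in> cube_maps k (GL (m - 1)) (matrix_one (m - 1))"
    and "(stabilise m \<circ> f, stabilise m \<circ> g) \<in> cube_homotopy k (GL m) (matrix_one m)"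
  shows "(f, g) \<in> cube_homotopy k (GL (m - 1)) (matrix_one (m - 1))"
proof (rule cube_homotopy_class_eqD[OF inj_onD[OF inj] fg(2)])
  show "cube_homotopy k (GL (m - 1)) (matrix_one (m - 1)) `` {f} \<in> GL_homotopy_group TYPE('a) k (m - 1)"
    "cube_homotopy k (GL (m - 1)) (matrix_one (m - 1)) `` {g} \<in> GL_homotopy_group TYPE('a) k (m - 1)"
    unfolding GL_homotopy_group_def homotopy_group_def by (rule quotientI[OF fg(1)], rule quotientI[OF fg(2)])
  show "GL_stabilisation TYPE('a) k m (cube_homotopy k (GL (m - 1)) (matrix_one (m - 1)) `` {f}) =
    GL_stabilisation TYPE('a) k m (cube_homotopy k (GL (m - 1)) (matrix_one (m - 1)) `` {g})"
    unfolding GL_stabilisation_def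
      induced_map_class[where \<phi> = "stabilise m", OF fg(1) stabilise_pointed_map[OF assms(1)]]
      induced_map_class[where \<phi> = "stabilise m", OF fg(2) stabilise_pointed_map[OF assms(1)]]
    by (rule cube_homotopy_class_eq[OF assms(5)])
qed

lemma GL_stabilisation_surjD:
  fixes f :: "(nat \<Rightarrow> real) \<Rightarrow> nat \<Rightarrow> nat \<Rightarrow> 'a::unital_cstar_algebra"
  assumes "m \<ge> 1" and surj: "GL_stabilisation TYPE('a) k m ` GL_homotopy_group TYPE('a) k (m - 1) = GL_homotopy_group TYPE('a) k m"
    and f: "f \<in> cube_maps k (GL m) (matrix_one m)"
  obtains g where "g \<in> cube_maps k (GL (m - 1)) (matrix_one (m - 1))"
    "(stabilise m \<circ> g, f) \<in> cube_homotopy k (GL m) (matrix_one m)"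
proof -
  have "cube_homotopy k (GL m) (matrix_one m) `` {f} \<in> GL_homotopy_group TYPE('a) k m"
    unfolding GL_homotopy_group_def homotopy_group_def by (rule quotientI[OF f])
  then obtain c where c: "c \<in> GL_homotopy_group TYPE('a) k (m - 1)"
    "cube_homotopy k (GL m) (matrix_one m) `` {f} = GL_stabilisation TYPE('a) k m c"
    unfolding surj[symmetric] by blast
  then obtain g where g: "g \<in> cube_maps k (GL (m - 1)) (matrix_one (m - 1))"
    "c = cube_homotopy k (GL (m - 1)) (matrix_one (m - 1)) `` {g}"
    unfolding GL_homotopy_group_def homotopy_group_def by (elim quotientE)
  have "cube_homotopy k (GL m) (matrix_one m) `` {stabilise m \<circ> g} = cube_homotopy k (GL m) (matrix_one m) `` {f}"
    unfolding c(2) g(2) GL_stabilisation_def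
    by (rule induced_map_class[where \<phi> = "stabilise m", OF g(1) stabilise_pointed_map[OF assms(1)], symmetric])
  from cube_homotopy_class_eqD[OF this f] g(1) that show ?thesis
    by blast
qed

section \<open>The open box and the top face\<close>

text \<open>The boundary of the cube without the interior of the top face \<open>t k = 1\<close>. It
  is a retract of the cube, so a map can be normalised there, leaving a based map on the top
  face.\<close>

definition open_box :: "nat \<Rightarrow> (nat \<Rightarrow> real) set" where
  "open_box k = {t \<in> unit_cube (Suc k). t k = 0 \<or> (\<exists>i<k. t i = 0 \<or> t i = 1)}"

lemma open_box_subset: "open_box k \<subseteq> cube_boundary (Suc k)"
  by (auto simp: open_box_def cube_boundary_def less_Suc_eq)

text \<open>The sup-norm distance of the first \<open>k\<close> coordinates from the centre, scaled
  to be 1 on the side faces, with value 0 when there are no sides.\<close>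

primrec box_gauge :: "nat \<Rightarrow> (nat \<Rightarrow> real) \<Rightarrow> real" where
  "box_gauge 0 t = 0"
| "box_gauge (Suc k) t = max (box_gauge k t) (2 * \<bar>t k - 1/2\<bar>)"

lemma box_gauge_ge: "i < k \<Longrightarrow> 2 * \<bar>t i - 1/2\<bar> \<le> box_gauge k t"
  by (induction k) (auto simp: less_Suc_eq le_max_iff_disj)

lemma box_gauge_cases: "box_gauge k t = 0 \<or> (\<exists>i<k. box_gauge k t = 2 * \<bar>t i - 1/2\<bar>)"
  by (induction k) (auto simp: max_def less_Suc_eq)

lemma box_gauge_le_one:
  assumes "t \<in> unit_cube (Suc k)"
  shows "box_gauge k t \<le> 1"
  using box_gauge_cases[of k t]
proof (elim disjE exE conjE)
  fix i assume "i < k" "box_gauge k t = 2 * \<bar>t i - 1/2\<bar>"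
  moreover have "0 \<le> t i" "t i \<le> 1"
    using assms \<open>i < k\<close> by (auto simp: unit_cube_def)
  ultimately show ?thesis
    by (simp add: abs_if)
qed simp

lemma continuous_on_box_gauge:
  "continuous_on S (\<lambda>t. box_gauge k t)"
proof (induction k)
  case (Suc k)
  have "continuous_on S (\<lambda>t :: nat \<Rightarrow> real. t k)"
    by (rule continuous_on_apply[OF continuous_on_id])
  then show ?case
    unfolding box_gauge.simps
    by (intro continuous_on_max Suc continuous_on_mult continuous_on_rabs continuous_on_diff continuous_on_const)
qed simp

text \<open>Radial projection onto the open box from the point \<open>(1/2, \<dots>, 1/2, 2)\<close>.\<close>

lemma open_box_retraction:
  obtains r where "continuous_on (unit_cube (Suc k)) r" "r ` unit_cube (Suc k) \<subseteq> open_box k"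
    "\<And>t. t \<in> open_box k \<Longrightarrow> r t = t"
proof
  \<comment> \<open>The gauge of the displacement of \<open>t\<close> from the projection point: the
    bottom face lies 2 below that point and the side faces at distance 1/2 from it. Dividing the
    displacement by \<open>D\<close> therefore lands on one of them, and \<open>D = 1\<close> on the
    open box.\<close>
  define D where "D t = max ((2 - t k) / 2) (box_gauge k t)" for t
  define r where "r t = (\<lambda>i. if i < k then 1/2 + (t i - 1/2) / D t
    else if i = k then 2 - (2 - t k) / D t else 0)" for t
  have cc: "continuous_on S (\<lambda>t :: nat \<Rightarrow> real. t i)" for S i
    by (rule continuous_on_apply[OF continuous_on_id])
  have Dpos: "D t > 0" if "t \<in> unit_cube (Suc k)" for t
    using that by (auto simp: D_def unit_cube_def less_max_iff_disj)
  have D: "continuous_on (unit_cube (Suc k)) D"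
    unfolding D_def[abs_def]
    by (intro continuous_on_max continuous_on_box_gauge continuous_on_divide continuous_on_diff
        continuous_on_const cc) auto
  show "continuous_on (unit_cube (Suc k)) r"
  proof (rule continuous_on_coordinatewise_then_product)
    fix i
    consider "i < k" | "i = k" | "i > k"
      by linarith
    then show "continuous_on (unit_cube (Suc k)) (\<lambda>t. r t i)"
    proof cases
      case 1
      have "continuous_on (unit_cube (Suc k)) (\<lambda>t. 1/2 + (t i - 1/2) / D t)"
        using Dpos by (intro continuous_on_add continuous_on_divide continuous_on_diff
          continuous_on_const cc D) force
      then show ?thesis
        using 1 by (simp add: r_def)
    next
      case 2
      have "continuous_on (unit_cube (Suc k)) (\<lambda>t. 2 - (2 - t k) / D t)"
        using Dpos by (intro continuous_on_add continuous_on_divide continuous_on_diff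
          continuous_on_const cc D) force
      then show ?thesis
        using 2 by (simp add: r_def)
    qed (simp add: r_def)
  qed
  show "r ` unit_cube (Suc k) \<subseteq> open_box k"
  proof safe
    fix t assume t: "t \<in> unit_cube (Suc k)"
    note Dt = Dpos[OF t]
    note g1 = box_gauge_le_one[OF t]
    have tk: "0 \<le> t k" "t k \<le> 1"
      using t by (auto simp: unit_cube_def)
    have D1: "D t \<le> 1"
      using g1 tk by (simp add: D_def)
    have low: "0 \<le> r t i" "r t i \<le> 1" if "i < k" for i
    proof -
      have "2 * \<bar>t i - 1/2\<bar> \<le> D t"
        using box_gauge_ge[OF that, of t] by (simp add: D_def)
      then have "\<bar>(t i - 1/2) / D t\<bar> \<le> 1/2"
        using Dt by (simp add: abs_divide field_simps)
      moreover have "r t i = 1/2 + (t i - 1/2) / D t"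
        using that by (simp add: r_def)
      ultimately show "0 \<le> r t i" "r t i \<le> 1"
        by linarith+
    qed
    have top: "0 \<le> r t k" "r t k \<le> 1"
    proof -
      have "(2 - t k) / D t \<le> 2"
        using Dt max.cobounded1[of "(2 - t k) / 2" "box_gauge k t"]
        by (simp add: pos_divide_le_eq flip: D_def)
      moreover have "(2 - t k) * D t \<le> (2 - t k) * 1"
        using D1 tk by (intro mult_left_mono) auto
      then have "(2 - t k) / D t \<ge> 2 - t k"
        using Dt by (simp add: field_simps)
      ultimately show "0 \<le> r t k" "r t k \<le> 1"
        using tk by (auto simp: r_def)
    qed
    have "r t \<in> unit_cube (Suc k)"
      using low top by (auto simp: unit_cube_def less_Suc_eq) (simp add: r_def)
    moreover have "r t k = 0 \<or> (\<exists>i<k. r t i = 0 \<or> r t i = 1)"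
    proof (cases "D t = (2 - t k) / 2")
      case True
      then have "2 - t k = 2 * D t"
        by simp
      then have "r t k = 0"
        using Dt by (simp add: r_def)
      then show ?thesis ..
    next
      case False
      then have "D t = box_gauge k t"
        by (auto simp: D_def max_def split: if_splits)
      then obtain i where i: "i < k" "D t = 2 * \<bar>t i - 1/2\<bar>"
        using box_gauge_cases[of k t] Dt by auto
      have "(t i - 1/2) / D t = 1/2 \<or> (t i - 1/2) / D t = -1/2"
        using Dt unfolding i(2) by (auto simp: abs_if field_simps)
      moreover have "r t i = 1/2 + (t i - 1/2) / D t"
        using i(1) by (simp add: r_def)
      ultimately have "r t i = 1 \<or> r t i = 0"
        by (elim disjE) simp_all
      then show ?thesis
        using i(1) by blast
    qed
    ultimately show "r t \<in> open_box k"
      by (simp add: open_box_def)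
  qed
  show "r t = t" if "t \<in> open_box k" for t
  proof -
    have t: "t \<in> unit_cube (Suc k)"
      using that by (simp add: open_box_def)
    have "box_gauge k t \<le> 1"
      by (rule box_gauge_le_one[OF t])
    moreover have "0 \<le> t k"
      using t by (simp add: unit_cube_def)
    moreover have "t k = 0 \<or> box_gauge k t \<ge> 1"
      using that box_gauge_ge[of _ k t] unfolding open_box_def by force
    ultimately have "D t = 1"
      by (auto simp: D_def max_def)
    moreover have "t i = 0" if "i > k" for i
      using t that by (simp add: unit_cube_def)
    ultimately show ?thesis
      by (auto simp: r_def fun_eq_iff not_less_iff_gr_or_eq)
  qed
qed

lemma continuous_on_fun_upd:
  fixes f :: "'b::topological_space \<Rightarrow> nat \<Rightarrow> real"
  assumes "continuous_on S f" "continuous_on S g"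
  shows "continuous_on S (\<lambda>x. (f x)(k := g x))"
proof (rule continuous_on_coordinatewise_then_product)
  fix i
  show "continuous_on S (\<lambda>x. ((f x)(k := g x)) i)"
    using continuous_on_apply[OF assms(1)] assms(2) by (cases "i = k") auto
qed

lemma upd_mem_cube:
  assumes "t \<in> unit_cube k" "0 \<le> s" "s \<le> 1"
  shows "t(k := s) \<in> unit_cube (Suc k)"
  using assms by (auto simp: unit_cube_def less_Suc_eq)

lemma upd_mem_open_box:
  assumes "t \<in> cube_boundary k" "0 \<le> s" "s \<le> 1"
  shows "t(k := s) \<in> open_box k"
  using assms upd_mem_cube[of t k s] by (auto simp: cube_boundary_def open_box_def)

lemma top_mem_boundary: "t \<in> unit_cube k \<Longrightarrow> t(k := 1) \<in> cube_boundary (Suc k)"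
  using upd_mem_cube[of t k 1] by (auto simp: cube_boundary_def)

text \<open>The top face slides down through the cube to the bottom, where \<open>h\<close> is
  constant; its boundary moves inside the sides, where \<open>h\<close> is constant too.\<close>

lemma top_face_nullhomotopic:
  assumes h: "continuous_on (unit_cube (Suc k)) h" "h ` unit_cube (Suc k) \<subseteq> Y"
    and box: "\<And>t. t \<in> open_box k \<Longrightarrow> h t = y"
  shows "(\<lambda>t. h (t(k := 1)), \<lambda>_. y) \<in> cube_homotopy k Y y"
proof (rule cube_homotopyI)
  have m: "(snd p)(k := 1 - fst p) \<in> unit_cube (Suc k)" if "p \<in> {0..1} \<times> unit_cube k" for p
    using that by (intro upd_mem_cube) auto
  show "continuous_on ({0..1} \<times> unit_cube k) (\<lambda>p. h ((snd p)(k := 1 - fst p)))"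
    by (rule continuous_on_compose2[OF h(1)])
      (use m in \<open>auto intro!: continuous_on_fun_upd continuous_on_diff continuous_on_const
            continuous_on_fst continuous_on_snd continuous_on_id simp del: fun_upd_apply\<close>)
  show "(\<lambda>p. h ((snd p)(k := 1 - fst p))) ` ({0..1} \<times> unit_cube k) \<subseteq> Y"
    using m h(2) by blast
  show "h ((snd (1, t))(k := 1 - fst (1, t))) = y" if "t \<in> unit_cube k" for t
    using upd_mem_cube[OF that, of 0] by (intro box) (auto simp: open_box_def)
  show "h ((snd (s, t))(k := 1 - fst (s, t))) = y" if "s \<in> {0..1}" "t \<in> cube_boundary k" for s t
    using upd_mem_open_box[OF that(2), of "1 - s"] that(1) by (intro box) auto
qed simp

text \<open>The converse of sliding: the null-homotopy, with the depth \<open>1 - t k\<close> as its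
  time, is itself a map on the cube, equal to \<open>y\<close> on the bottom and the sides.\<close>

lemma extend_from_top_face:
  assumes box: "\<And>t. t \<in> open_box k \<Longrightarrow> f t = y"
    and null: "(\<lambda>t. f (t(k := 1)), \<lambda>_. y) \<in> cube_homotopy k Y y"
  obtains h where "continuous_on (unit_cube (Suc k)) h" "h ` unit_cube (Suc k) \<subseteq> Y"
    "\<And>t. t \<in> cube_boundary (Suc k) \<Longrightarrow> h t = f t"
proof -
  obtain H where H: "continuous_on ({0..1::real} \<times> unit_cube k) H" "H ` ({0..1} \<times> unit_cube k) \<subseteq> Y"
    "\<And>t. H (0, t) = f (t(k := 1))" "\<And>t. H (1, t) = y"
    "\<And>s t. s \<in> {0..1} \<Longrightarrow> t \<in> cube_boundary k \<Longrightarrow> H (s, t) = y"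
    using cube_homotopyE[OF null] by blast
  have m: "(1 - t k, t(k := 0)) \<in> {0..1} \<times> unit_cube k" if "t \<in> unit_cube (Suc k)" for t
    using that by (auto simp: unit_cube_def)
  show ?thesis
  proof
    show "continuous_on (unit_cube (Suc k)) (\<lambda>t. H (1 - t k, t(k := 0)))"
      by (rule continuous_on_compose2[OF H(1)])
        (use m in \<open>auto intro!: continuous_on_fun_upd continuous_on_Pair continuous_on_diff continuous_on_const
            continuous_on_id continuous_on_apply[OF continuous_on_id] simp del: fun_upd_apply\<close>)
    show "(\<lambda>t. H (1 - t k, t(k := 0))) ` unit_cube (Suc k) \<subseteq> Y"
      using m H(2) by blast
    show "H (1 - t k, t(k := 0)) = f t" if t: "t \<in> cube_boundary (Suc k)" for t
    proof (cases "t \<in> open_box k")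
      case True
      then have tc: "t \<in> unit_cube (Suc k)"
        by (simp add: open_box_def)
      have "H (1 - t k, t(k := 0)) = y"
      proof (cases "t k = 0")
        case False
        then have "t(k := 0) \<in> cube_boundary k"
          using True m[OF tc] by (auto simp: open_box_def cube_boundary_def)
        then show ?thesis
          using m[OF tc] by (intro H(5)) auto
      qed (simp add: H(4))
      then show ?thesis
        using box True by simp
    next
      case False
      then have "t k = 1"
        using t by (auto simp: open_box_def cube_boundary_def less_Suc_eq)
      then show ?thesis
        by (simp add: H(3)) (metis fun_upd_triv)
    qed
  qed
qed

section \<open>Vanishing homotopy groups of the unimodular vectors\<close>

text \<open>The boundary of the \<open>k\<close>-cube is a sphere of dimension \<open>k - 1\<close>,
  so for \<open>k\<close> \<ge> 1 this says that the homotopy in degree \<open>k - 1\<close>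
  vanishes at every base point.\<close>

definition fillable :: "nat \<Rightarrow> 'b::topological_space set \<Rightarrow> bool" where
  "fillable k Y \<longleftrightarrow> (\<forall>f. continuous_on (cube_boundary k) f \<and> f ` cube_boundary k \<subseteq> Y \<longrightarrow>
     (\<exists>h. continuous_on (unit_cube k) h \<and> h ` unit_cube k \<subseteq> Y \<and> (\<forall>t\<in>cube_boundary k. h t = f t)))"

lemma GL0_subset: "GL0 m \<subseteq> GL m"
  unfolding GL0_def by (rule connected_component_subset)

lemma zero_mem_cube: "(\<lambda>_. 0) \<in> unit_cube k"
  by (simp add: unit_cube_def)

lemma scale_mem_cube: "t \<in> unit_cube k \<Longrightarrow> 0 \<le> s \<Longrightarrow> s \<le> 1 \<Longrightarrow> (\<lambda>i. s * t i) \<in> unit_cube k"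
  by (auto simp: unit_cube_def mult_le_one)

text \<open>A cube contracts to a point, so maps from a cube lift along \<open>GL m \<rightarrow> Lg m\<close>.\<close>

lemma lift_cube:
  fixes f :: "(nat \<Rightarrow> real) \<Rightarrow> nat \<Rightarrow> 'a::unital_cstar_algebra"
  assumes f: "continuous_on (unit_cube k) f" "f ` unit_cube k \<subseteq> Lg m"
    and trans: "\<And>v. v \<in> Lg m \<Longrightarrow> \<exists>g\<in>GL0 m. matrix_act m g u = v"
  obtains F where "continuous_on (unit_cube k) F" "F ` unit_cube k \<subseteq> GL m"
    "\<And>t. t \<in> unit_cube k \<Longrightarrow> matrix_act m (F t) u = f t"
proof -
  have scale: "(\<lambda>i. snd p * fst p i) \<in> unit_cube k" if "p \<in> unit_cube k \<times> {0..1}" for p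
    using that by (auto intro: scale_mem_cube)
  have scale_cont: "continuous_on (unit_cube k \<times> {0..1}) (\<lambda>p i. snd p * fst p i :: real)"
    by (intro continuous_on_coordinatewise_then_product continuous_on_mult continuous_on_snd
        continuous_on_apply[OF continuous_on_fst] continuous_on_id)
  have "continuous_on (unit_cube k \<times> {0..1}) (\<lambda>p. f (\<lambda>i. snd p * fst p i))"
    by (rule continuous_on_compose2[OF f(1) scale_cont]) (use scale in auto)
  moreover have "(\<lambda>p. f (\<lambda>i. snd p * fst p i)) ` (unit_cube k \<times> {0..1}) \<subseteq> Lg m"
    using scale f(2) by blast
  ultimately obtain G where G: "continuous_on (unit_cube k \<times> {0..1}) G"
    "G ` (unit_cube k \<times> {0..1}) \<subseteq> GL m"
    "\<And>t s. t \<in> unit_cube k \<Longrightarrow> s \<in> {0..1} \<Longrightarrow> matrix_act m (G (t, s)) (f (\<lambda>i. 0)) = f (\<lambda>i. s * t i)"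
    by (rule lift_homotopy[OF compact_unit_cube]) auto
  have "f (\<lambda>_. 0) \<in> Lg m"
    using f(2) zero_mem_cube by blast
  \<comment> \<open>The lifted contraction carries the value at the vertex 0 to all other values;
    transitivity supplies the first step from \<open>u\<close> to that value.\<close>
  then obtain g where g: "g \<in> GL m" "matrix_act m g u = f (\<lambda>_. 0)"
    using trans GL0_subset by blast
  show ?thesis
  proof
    have "continuous_on (unit_cube k) (\<lambda>t. G (t, 1))"
      by (rule continuous_on_compose2[OF G(1)]) (auto intro!: continuous_on_Pair continuous_on_id continuous_on_const)
    then show "continuous_on (unit_cube k) (\<lambda>t. matrix_mult m (G (t, 1)) g)"
      by (intro continuous_on_matrix_mult continuous_on_const)
    show "(\<lambda>t. matrix_mult m (G (t, 1)) g) ` unit_cube k \<subseteq> GL m"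
      using G(2) g(1) by (auto intro!: GL_mult)
    show "matrix_act m (matrix_mult m (G (t, 1)) g) u = f t" if "t \<in> unit_cube k" for t
      using G(3)[OF that, of 1] g(2) by (simp add: matrix_act_mult)
  qed
qed

lemma const_cube_map: "y \<in> Y \<Longrightarrow> (\<lambda>_. y) \<in> cube_maps k Y y"
  by (auto simp: cube_maps_def)

text \<open>Multiplying by the inverse of an extension over the cube of its restriction to the open box
  turns a map on the boundary into an element of a homotopy group.\<close>

lemma extend_from_stabilised_extension:
  fixes a :: "(nat \<Rightarrow> real) \<Rightarrow> nat \<Rightarrow> nat \<Rightarrow> 'a::unital_cstar_algebra"
  assumes m: "m \<ge> 1"
    and inj: "inj_on (GL_stabilisation TYPE('a) k m) (GL_homotopy_group TYPE('a) k (m - 1))"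
    and a: "continuous_on (cube_boundary (Suc k)) a" "a ` cube_boundary (Suc k) \<subseteq> GL (m - 1)"
    and F: "continuous_on (unit_cube (Suc k)) F" "F ` unit_cube (Suc k) \<subseteq> GL m"
    "\<And>t. t \<in> cube_boundary (Suc k) \<Longrightarrow> F t = stabilise m (a t)"
  obtains G where "continuous_on (unit_cube (Suc k)) G" "G ` unit_cube (Suc k) \<subseteq> GL (m - 1)"
    "\<And>t. t \<in> cube_boundary (Suc k) \<Longrightarrow> G t = a t"
proof -
  define n where "n = m - 1"
  have a2: "a ` cube_boundary (Suc k) \<subseteq> GL n"
    using a(2) unfolding n_def .
  have stab: "stabilise m (matrix_mult n x y) = matrix_mult m (stabilise m x) (stabilise m y)"
    "stabilise m (matrix_one n) = (matrix_one m :: nat \<Rightarrow> nat \<Rightarrow> 'a)"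
    "z \<in> GL n \<Longrightarrow> stabilise m z \<in> GL m" for x y z :: "nat \<Rightarrow> nat \<Rightarrow> 'a"
    unfolding n_def by (rule stabilise_mult[OF m] stabilise_one[OF m] stabilise_GL[OF m]; assumption?)+
  obtain r where r: "continuous_on (unit_cube (Suc k)) r" "r ` unit_cube (Suc k) \<subseteq> open_box k"
    "\<And>t. t \<in> open_box k \<Longrightarrow> r t = t"
    using open_box_retraction by blast
  let ?C = "unit_cube (Suc k)" and ?B = "cube_boundary (Suc k)"
  have BC: "?B \<subseteq> ?C"
    by (rule cube_boundary_subset)
  \<comment> \<open>The retraction extends the values of \<open>a\<close> on the open box over the
    whole cube, still inside \<open>GL (m - 1)\<close>.\<close>
  define \<alpha> where "\<alpha> t = a (r t)" for t
  have rB: "r ` ?C \<subseteq> ?B"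
    using r(2) open_box_subset by blast
  have \<alpha>: "continuous_on ?C \<alpha>" "\<alpha> ` ?C \<subseteq> GL n"
    using continuous_on_compose2[OF a(1) r(1) rB] a2 rB by (auto simp: \<alpha>_def[abs_def])
  define a' where "a' t = matrix_mult n (GL_inv n (\<alpha> t)) (a t)" for t
  have a': "continuous_on ?B a'" "a' ` ?B \<subseteq> GL n"
  proof -
    show "continuous_on ?B a'"
      unfolding a'_def[abs_def] using \<alpha> BC a(1)
      by (intro continuous_on_matrix_mult continuous_on_GL_inv) (auto intro: continuous_on_subset)
    show "a' ` ?B \<subseteq> GL n"
      using \<alpha>(2) BC a2 unfolding a'_def by (blast intro: GL_mult GL_GL_inv)
  qed
  have a'_box: "a' t = matrix_one n" if "t \<in> open_box k" for t
    using that a2 open_box_subset[of k] unfolding a'_def \<alpha>_def r(3)[OF that] by (blast intro: GL_inv_left)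
  define b where "b t = a' (t(k := 1))" for t
  have b: "b \<in> cube_maps k (GL n) (matrix_one n)"
    unfolding cube_maps_def
  proof safe
    show "continuous_on (unit_cube k) b"
      unfolding b_def[abs_def]
      by (rule continuous_on_compose2[OF a'(1)])
        (auto intro!: continuous_on_fun_upd continuous_on_id continuous_on_const top_mem_boundary simp del: fun_upd_apply)
    show "b t \<in> GL n" if "t \<in> unit_cube k" for t
      using a'(2) top_mem_boundary[OF that] by (auto simp: b_def)
    show "b t = matrix_one n" if "t \<in> cube_boundary k" for t
      using upd_mem_open_box[OF that, of 1] by (simp add: b_def a'_box)
  qed
  \<comment> \<open>The same correction applied to \<open>F\<close> extends the stabilisation of
    \<open>a'\<close> over the cube with value 1 on the open box, so the stabilised top face is
    null-homotopic and injectivity applies.\<close>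
  define F' where "F' t = matrix_mult m (GL_inv m (stabilise m (\<alpha> t))) (F t)" for t
  have s\<alpha>: "stabilise m (\<alpha> t) \<in> GL m" if "t \<in> ?C" for t
    using \<alpha>(2) that stab(3) by blast
  have F'_B: "F' t = stabilise m (a' t)" if t: "t \<in> ?B" for t
  proof -
    have \<alpha>t: "\<alpha> t \<in> GL n" and at: "a t \<in> GL n"
      using \<alpha>(2) a2 t BC by blast+
    have "a t = matrix_mult n (\<alpha> t) (a' t)"
      using GL_inv_mult_cancel(2)[OF \<alpha>t GL_matrices[OF at]] by (simp add: a'_def)
    then have "F t = matrix_mult m (stabilise m (\<alpha> t)) (stabilise m (a' t))"
      using F(3)[OF t] stab(1)[of "\<alpha> t" "a' t"] by simp
    then show ?thesis
      using GL_inv_mult_cancel(1)[OF s\<alpha> stabilise_matrices[OF m]] t BC unfolding F'_def by auto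
  qed
  have "(\<lambda>t. F' (t(k := 1)), \<lambda>_. matrix_one m) \<in> cube_homotopy k (GL m) (matrix_one m)"
  proof (rule top_face_nullhomotopic)
    show "continuous_on ?C F'"
      unfolding F'_def[abs_def] using s\<alpha>
      by (intro continuous_on_matrix_mult continuous_on_GL_inv continuous_on_stabilise \<alpha> F) auto
    show "F' ` ?C \<subseteq> GL m"
      using s\<alpha> F(2) unfolding F'_def by (blast intro: GL_mult GL_GL_inv)
    show "F' t = matrix_one m" if "t \<in> open_box k" for t
      using that open_box_subset[of k] F'_B[of t] a'_box[of t] stab(2) by auto
  qed
  then have "(stabilise m \<circ> b, stabilise m \<circ> (\<lambda>_. matrix_one n)) \<in> cube_homotopy k (GL m) (matrix_one m)"
    by (rule cube_homotopy_cong)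
      (simp_all add: b_def F'_B top_mem_boundary stab(2) del: fun_upd_apply)
  then have "(b, \<lambda>_. matrix_one n) \<in> cube_homotopy k (GL n) (matrix_one n)"
    using GL_stabilisation_injD[OF m inj, of b "\<lambda>_. matrix_one n"] b const_cube_map[OF GL_one]
    unfolding n_def by blast
  then obtain h where h: "continuous_on ?C h" "h ` ?C \<subseteq> GL n" "\<And>t. t \<in> ?B \<Longrightarrow> h t = a' t"
    using extend_from_top_face[of k a' "matrix_one n" "GL n", OF a'_box] unfolding b_def[abs_def] by blast
  show ?thesis
  proof
    show "continuous_on ?C (\<lambda>t. matrix_mult n (\<alpha> t) (h t))"
      by (intro continuous_on_matrix_mult \<alpha> h)
    show "(\<lambda>t. matrix_mult n (\<alpha> t) (h t)) ` ?C \<subseteq> GL (m - 1)"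
      using \<alpha>(2) h(2) unfolding n_def[symmetric] by (blast intro: GL_mult)
    show "matrix_mult n (\<alpha> t) (h t) = a t" if t: "t \<in> ?B" for t
    proof -
      have "\<alpha> t \<in> GL n" "a t \<in> GL n"
        using \<alpha>(2) a2 t BC by blast+
      then show ?thesis
        by (simp add: h(3)[OF t] a'_def GL_inv_mult_cancel GL_matrices)
    qed
  qed
qed

text \<open>Exactness of the homotopy sequence of \<open>GL (m - 1) \<rightarrow> GL m \<rightarrow> Lg m\<close>: injectivity makes the lift \<open>F\<close>
  of \<open>f\<close>, corrected to be in block form on the boundary, agree there with a cube \<open>G\<close> in \<open>GL (m - 1)\<close>;
  by surjectivity the quotient of the two cubes comes from \<open>GL (m - 1)\<close>, which fixes the last
  basis vector.\<close>

lemma Lg_cube_map_null: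
  fixes f :: "(nat \<Rightarrow> real) \<Rightarrow> nat \<Rightarrow> 'a::unital_cstar_algebra"
  assumes m: "m \<ge> 1"
    and trans: "\<And>u v :: nat \<Rightarrow> 'a. u \<in> Lg m \<Longrightarrow> v \<in> Lg m \<Longrightarrow> \<exists>g\<in>GL0 m. matrix_act m g u = v"
    and inj: "inj_on (GL_stabilisation TYPE('a) k m) (GL_homotopy_group TYPE('a) k (m - 1))"
    and surj: "GL_stabilisation TYPE('a) (Suc k) m ` GL_homotopy_group TYPE('a) (Suc k) (m - 1)
      = GL_homotopy_group TYPE('a) (Suc k) m"
    and f: "f \<in> cube_maps (Suc k) (Lg m) (last_vector m)"
  shows "(f, \<lambda>_. last_vector m) \<in> cube_homotopy (Suc k) (Lg m) (last_vector m)"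
proof -
  let ?C = "unit_cube (Suc k)" and ?B = "cube_boundary (Suc k)" and ?e = "last_vector m :: nat \<Rightarrow> 'a"
  have BC: "?B \<subseteq> ?C"
    by (rule cube_boundary_subset)
  have eL: "?e \<in> Lg m"
    by (rule last_vector_Lg[OF m])
  have fC: "continuous_on ?C f" "f ` ?C \<subseteq> Lg m" "\<And>t. t \<in> ?B \<Longrightarrow> f t = ?e"
    using f by (auto simp: cube_maps_def)
  obtain F where F: "continuous_on ?C F" "F ` ?C \<subseteq> GL m" "\<And>t. t \<in> ?C \<Longrightarrow> matrix_act m (F t) ?e = f t"
    using lift_cube[OF fC(1,2) trans[OF eL]] by blast
  \<comment> \<open>On the boundary \<open>F\<close> fixes the last vector but may have a nonzero
    last row. Clearing that row everywhere leaves the action on the last vector unchanged, so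
    \<open>F1\<close> still lifts \<open>f\<close>.\<close>
  define F1 where "F1 t = matrix_mult m (F t) (clear_row m (F t (m - 1)))" for t
  have F1: "continuous_on ?C F1" "F1 ` ?C \<subseteq> GL m" "\<And>t. t \<in> ?C \<Longrightarrow> matrix_act m (F1 t) ?e = f t"
  proof -
    show "continuous_on ?C F1"
      unfolding F1_def[abs_def]
      by (intro continuous_on_matrix_mult continuous_on_clear_row continuous_on_apply[OF F(1)] F(1))
    show "F1 ` ?C \<subseteq> GL m"
      using F(2) m by (auto simp: F1_def intro!: GL_mult clear_row_GL)
    show "matrix_act m (F1 t) ?e = f t" if "t \<in> ?C" for t
      using F(3)[OF that] m by (simp add: F1_def matrix_act_mult clear_row_last)
  qed
  have F1B: "stabilise m (corner m (F1 t)) = F1 t" "corner m (F1 t) \<in> GL (m - 1)" if t: "t \<in> ?B" for t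
  proof -
    have 1: "F1 t \<in> GL m" "matrix_act m (F1 t) ?e = ?e" "matrix_act m (F t) ?e = ?e"
      using F1(2,3) fC(3)[OF t] F(3) t BC by (auto simp: image_subset_iff)
    show "stabilise m (corner m (F1 t)) = F1 t"
      using mult_clear_row_last[OF m 1(3)]
      by (intro stabilise_corner[OF m GL_matrices[OF 1(1)] 1(2)]) (simp add: F1_def)
    show "corner m (F1 t) \<in> GL (m - 1)"
      by (rule corner_GL[OF m 1(1,2)])
  qed
  obtain G where G: "continuous_on ?C G" "G ` ?C \<subseteq> GL (m - 1)" "\<And>t. t \<in> ?B \<Longrightarrow> G t = corner m (F1 t)"
  proof (rule extend_from_stabilised_extension[OF m inj, of "\<lambda>t. corner m (F1 t)" F1])
    show "continuous_on ?B (\<lambda>t. corner m (F1 t))"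
      by (rule continuous_on_subset[OF continuous_on_corner[OF F1(1)] BC])
  qed (use F1 F1B in auto)
  \<comment> \<open>\<open>Q\<close> is 1 on the boundary, hence represents a class for
    \<open>GL m\<close>; it still lifts \<open>f\<close> because stabilised matrices and their
    inverses fix the last vector.\<close>
  define Q where "Q t = matrix_mult m (F1 t) (GL_inv m (stabilise m (G t)))" for t
  have sG: "stabilise m (G t) \<in> GL m" if "t \<in> ?C" for t
    using G(2) that by (intro stabilise_GL[OF m]) auto
  have "Q \<in> cube_maps (Suc k) (GL m) (matrix_one m)"
    unfolding cube_maps_def
  proof safe
    show "continuous_on ?C Q"
      unfolding Q_def[abs_def] using sG
      by (intro continuous_on_matrix_mult continuous_on_GL_inv continuous_on_stabilise G F1) auto
    show "Q t \<in> GL m" if "t \<in> ?C" for t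
      using F1(2) sG[OF that] that by (auto simp: Q_def intro!: GL_mult GL_GL_inv)
    show "Q t = matrix_one m" if "t \<in> ?B" for t
      using sG[of t] that BC by (auto simp: Q_def G(3) F1B(1) intro!: GL_inv_right)
  qed
  then obtain R where R: "R \<in> cube_maps (Suc k) (GL (m - 1)) (matrix_one (m - 1))"
    "(stabilise m \<circ> R, Q) \<in> cube_homotopy (Suc k) (GL m) (matrix_one m)"
    using GL_stabilisation_surjD[OF m surj] by blast
  \<comment> \<open>Acting on the last vector turns the stabilised \<open>R\<close> into a constant
    map and \<open>Q\<close> into \<open>f\<close>.\<close>
  have "((\<lambda>g. matrix_act m g ?e) \<circ> (stabilise m \<circ> R), (\<lambda>g. matrix_act m g ?e) \<circ> Q)
      \<in> cube_homotopy (Suc k) (Lg m) ?e"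
  proof (rule cube_homotopy_compose[OF R(2)])
    show "continuous_on (GL m) (\<lambda>g. matrix_act m g ?e)"
      by (intro continuous_on_matrix_act continuous_on_id continuous_on_const)
    show "(\<lambda>g. matrix_act m g ?e) ` GL m \<subseteq> Lg m"
      using eL by (auto intro: matrix_act_Lg)
    show "matrix_act m (matrix_one m) ?e = ?e"
      by (rule matrix_act_one[OF Lg_vectors[OF eL]])
  qed
  then have "(\<lambda>_. ?e, f) \<in> cube_homotopy (Suc k) (Lg m) ?e"
  proof (rule cube_homotopy_cong)
    show "((\<lambda>g. matrix_act m g ?e) \<circ> (stabilise m \<circ> R)) t = ?e" for t
      using stabilise_last[OF m] by simp
    show "((\<lambda>g. matrix_act m g ?e) \<circ> Q) t = f t" if t: "t \<in> ?C" for t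
    proof -
      have "matrix_act m (GL_inv m (stabilise m (G t))) ?e = ?e"
        using matrix_act_inv_cancel(1)[OF sG[OF t] Lg_vectors[OF eL]] stabilise_last[OF m, of "G t"] by simp
      then show ?thesis
        using F1(3)[OF t] by (simp add: Q_def matrix_act_mult)
    qed
  qed
  then show ?thesis
    by (rule cube_homotopy_sym)
qed

text \<open>A lift \<open>g\<close> of \<open>f\<close> along the retraction to the open box moves
  \<open>f\<close> to the base point there, which leaves a based map on the top face. Its
  null-homotopy gives a filling, and \<open>g\<close> moves the filling back.\<close>

lemma Lg_fillable_Suc:
  assumes m: "m \<ge> 1"
    and trans: "\<And>u v :: nat \<Rightarrow> 'a::unital_cstar_algebra. u \<in> Lg m \<Longrightarrow> v \<in> Lg m \<Longrightarrow> \<exists>g\<in>GL0 m. matrix_act m g u = v"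
    and null: "\<And>f. f \<in> cube_maps k (Lg m) (last_vector m) \<Longrightarrow>
      (f, \<lambda>_. last_vector m :: nat \<Rightarrow> 'a) \<in> cube_homotopy k (Lg m) (last_vector m)"
  shows "fillable (Suc k) (Lg m :: (nat \<Rightarrow> 'a) set)"
  unfolding fillable_def
proof (intro allI impI, elim conjE)
  let ?C = "unit_cube (Suc k)" and ?B = "cube_boundary (Suc k)" and ?e = "last_vector m :: nat \<Rightarrow> 'a"
  fix f :: "(nat \<Rightarrow> real) \<Rightarrow> nat \<Rightarrow> 'a"
  assume f: "continuous_on ?B f" "f ` ?B \<subseteq> Lg m"
  have BC: "?B \<subseteq> ?C"
    by (rule cube_boundary_subset)
  have eL: "?e \<in> Lg m"
    by (rule last_vector_Lg[OF m])
  obtain r where r: "continuous_on ?C r" "r ` ?C \<subseteq> open_box k" "\<And>t. t \<in> open_box k \<Longrightarrow> r t = t"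
    using open_box_retraction by blast
  have rB: "r ` ?C \<subseteq> ?B"
    using r(2) open_box_subset by blast
  have "continuous_on ?C (\<lambda>t. f (r t))" "(\<lambda>t. f (r t)) ` ?C \<subseteq> Lg m"
    using continuous_on_compose2[OF f(1) r(1) rB] f(2) rB by auto
  then obtain g where g: "continuous_on ?C g" "g ` ?C \<subseteq> GL m"
    "\<And>t. t \<in> ?C \<Longrightarrow> matrix_act m (g t) ?e = f (r t)"
    using lift_cube[OF _ _ trans[OF eL]] by blast
  define f' where "f' t = matrix_act m (GL_inv m (g t)) (f t)" for t
  have f': "continuous_on ?B f'" "f' ` ?B \<subseteq> Lg m"
  proof -
    show "continuous_on ?B f'"
      unfolding f'_def[abs_def] using g BC
      by (intro continuous_on_matrix_act continuous_on_GL_inv f) (auto intro: continuous_on_subset)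
    show "f' ` ?B \<subseteq> Lg m"
      using g(2) BC f(2) by (auto simp: f'_def intro!: matrix_act_Lg GL_GL_inv)
  qed
  have box: "f' t = ?e" if t: "t \<in> open_box k" for t
  proof -
    have "t \<in> ?C"
      using t by (simp add: open_box_def)
    then have "f t = matrix_act m (g t) ?e" "g t \<in> GL m"
      using g(2,3) r(3)[OF t] by auto
    then show ?thesis
      by (simp add: f'_def matrix_act_inv_cancel Lg_vectors[OF eL])
  qed
  have "(\<lambda>t. f' (t(k := 1))) \<in> cube_maps k (Lg m) ?e"
    unfolding cube_maps_def
  proof safe
    show "continuous_on (unit_cube k) (\<lambda>t. f' (t(k := 1)))"
      by (rule continuous_on_compose2[OF f'(1)])
        (auto intro!: continuous_on_fun_upd continuous_on_id continuous_on_const top_mem_boundary simp del: fun_upd_apply)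
    show "f' (t(k := 1)) \<in> Lg m" if "t \<in> unit_cube k" for t
      using f'(2) top_mem_boundary[OF that] by auto
    show "f' (t(k := 1)) = ?e" if "t \<in> cube_boundary k" for t
      using upd_mem_open_box[OF that, of 1] by (simp add: box)
  qed
  from extend_from_top_face[OF box null[OF this]] obtain h where
    h: "continuous_on ?C h" "h ` ?C \<subseteq> Lg m" "\<And>t. t \<in> ?B \<Longrightarrow> h t = f' t"
    by blast
  show "\<exists>h. continuous_on ?C h \<and> h ` ?C \<subseteq> Lg m \<and> (\<forall>t\<in>?B. h t = f t)"
  proof (intro exI conjI ballI)
    show "continuous_on ?C (\<lambda>t. matrix_act m (g t) (h t))"
      by (intro continuous_on_matrix_act g h)
    show "(\<lambda>t. matrix_act m (g t) (h t)) ` ?C \<subseteq> Lg m"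
      using g(2) h(2) by (auto intro!: matrix_act_Lg)
    show "matrix_act m (g t) (h t) = f t" if t: "t \<in> ?B" for t
    proof -
      have "g t \<in> GL m" "f t \<in> Lg m"
        using g(2) f(2) BC t by auto
      then show ?thesis
        by (simp add: h(3)[OF t] f'_def matrix_act_inv_cancel Lg_vectors)
    qed
  qed
qed

text \<open>An approximate left inverse becomes exact after multiplication by a Neumann inverse; in
  particular \<open>Lg m\<close> is open.\<close>

lemma Lg_near:
  fixes v :: "nat \<Rightarrow> 'a::unital_cstar_algebra"
  assumes "v \<in> vectors m" "norm (1 - (\<Sum>i<m. c i * v i)) < 1"
  shows "v \<in> Lg m"
proof -
  obtain y where "y * (\<Sum>i<m. c i * v i) = 1"
    using neumann_inverse[OF assms(2)] by blast
  then show ?thesis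
    by (intro Lg_I[OF assms(1), where c = "\<lambda>i. y * c i"]) (simp add: sum_distrib_left mult.assoc)
qed

text \<open>\<open>GL0 m\<close> is a connected component, so its orbit \<open>Lg m\<close> is at
  first only connected. A left inverse of \<open>p\<close> remains an approximate one along segments
  to nearby points, and these local paths upgrade connectedness.\<close>

lemma path_connected_Lg:
  assumes trans: "\<And>u v :: nat \<Rightarrow> 'a::unital_cstar_algebra. u \<in> Lg m \<Longrightarrow> v \<in> Lg m \<Longrightarrow>
      \<exists>g\<in>GL0 m. matrix_act m g u = v"
  shows "path_connected (Lg m :: (nat \<Rightarrow> 'a) set)"
  unfolding path_connected_component
proof (intro ballI)
  fix u v :: "nat \<Rightarrow> 'a"
  assume uv: "u \<in> Lg m" "v \<in> Lg m"
  have "connected ((\<lambda>g. matrix_act m g u) ` GL0 m)"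
    by (intro connected_continuous_image continuous_on_matrix_act continuous_on_id continuous_on_const)
      (simp add: GL0_def connected_connected_component)
  moreover have "(\<lambda>g. matrix_act m g u) ` GL0 m = Lg m"
    using trans[OF uv(1)] GL0_subset uv(1) by (auto intro!: matrix_act_Lg)
  ultimately have conn: "connected (Lg m :: (nat \<Rightarrow> 'a) set)"
    by simp
  show "path_component (Lg m) u v"
    using conn uv
  proof (rule connected_equivalence_relation)
    show "\<exists>T. openin (top_of_set (Lg m)) T \<and> p \<in> T \<and> (\<forall>q\<in>T. path_component (Lg m) p q)"
      if p: "p \<in> Lg m" for p :: "nat \<Rightarrow> 'a"
    proof -
      obtain c where c: "(\<Sum>i<m. c i * p i) = 1"
        using p by (auto simp: Lg_iff)
      let ?d = "\<lambda>q. norm (1 - (\<Sum>i<m. c i * q i))"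
      have "continuous_on (Lg m) ?d"
        by (intro continuous_on_norm continuous_on_diff continuous_on_const continuous_on_sum
            continuous_on_mult continuous_on_apply[OF continuous_on_id])
      then have op: "openin (top_of_set (Lg m)) (Lg m \<inter> ?d -` {..<1})"
        by (intro continuous_openin_preimage_gen) auto
      have "path_component (Lg m) p q" if q: "q \<in> Lg m" "?d q < 1" for q
        unfolding path_component_def
      proof (intro exI conjI)
        let ?g = "\<lambda>s::real. \<lambda>i. (1 - s) *\<^sub>R p i + s *\<^sub>R q i"
        show "path ?g"
          unfolding path_def
          by (intro continuous_on_coordinatewise_then_product continuous_intros)
        show "path_image ?g \<subseteq> Lg m"
          unfolding path_image_def
        proof safe
          fix s :: real assume s: "s \<in> {0..1}"
          have "(\<Sum>i<m. c i * ?g s i) = (1 - s) *\<^sub>R 1 + s *\<^sub>R (\<Sum>i<m. c i * q i)"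
            by (simp add: c[symmetric] distrib_left sum.distrib scaleR_sum_right del: scaleR_diff_left)
          then have "1 - (\<Sum>i<m. c i * ?g s i) = s *\<^sub>R (1 - (\<Sum>i<m. c i * q i))"
            by (simp add: algebra_simps)
          then have "norm (1 - (\<Sum>i<m. c i * ?g s i)) \<le> ?d q"
            using s by (simp add: mult_left_le_one_le)
          then show "?g s \<in> Lg m"
            using q(2) Lg_vectors[OF p] Lg_vectors[OF q(1)] by (intro Lg_near[of _ m c]) (auto simp: vectors_def)
        qed
      qed (simp_all add: pathstart_def pathfinish_def)
      then show ?thesis
        using op p by (intro exI[of _ "Lg m \<inter> ?d -` {..<1}"]) (auto simp: c)
    qed
  qed (auto intro: path_component_sym path_component_trans)
qed

lemma fillable_1:
  fixes Y :: "'b::topological_space set"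
  assumes "path_connected Y"
  shows "fillable 1 Y"
  unfolding fillable_def
proof (intro allI impI, elim conjE)
  fix f :: "(nat \<Rightarrow> real) \<Rightarrow> 'b"
  assume f: "f ` cube_boundary 1 \<subseteq> Y"
  define e :: "real \<Rightarrow> nat \<Rightarrow> real" where "e s = (\<lambda>i. if i = 0 then s else 0)" for s
  have B: "cube_boundary 1 = {e 0, e 1}"
  proof (intro equalityI subsetI)
    fix t assume "t \<in> cube_boundary 1"
    then have "t 0 = 0 \<or> t 0 = 1" "\<And>i. i \<ge> 1 \<Longrightarrow> t i = 0"
      by (auto simp: cube_boundary_def unit_cube_def)
    then have "t = e (t 0)"
      by (auto simp: e_def fun_eq_iff)
    then show "t \<in> {e 0, e 1}"
      using \<open>t 0 = 0 \<or> t 0 = 1\<close> by auto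
  qed (auto simp: cube_boundary_def unit_cube_def e_def)
  have "f (e 0) \<in> Y" "f (e 1) \<in> Y"
    using f unfolding B by auto
  then obtain g where g: "path g" "path_image g \<subseteq> Y" "pathstart g = f (e 0)" "pathfinish g = f (e 1)"
    using assms unfolding path_connected_def by blast
  show "\<exists>h. continuous_on (unit_cube 1) h \<and> h ` unit_cube 1 \<subseteq> Y \<and> (\<forall>t\<in>cube_boundary 1. h t = f t)"
  proof (intro exI conjI)
    have im: "(\<lambda>t. t 0) ` unit_cube 1 \<subseteq> {0..1}"
      by (auto simp: unit_cube_def)
    show "continuous_on (unit_cube 1) (\<lambda>t. g (t 0))"
      by (rule continuous_on_compose2[OF g(1)[unfolded path_def] continuous_on_apply[OF continuous_on_id] im])
    show "(\<lambda>t. g (t 0)) ` unit_cube 1 \<subseteq> Y"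
      using im g(2) unfolding path_image_def by blast
    show "\<forall>t\<in>cube_boundary 1. g (t 0) = f t"
      using g(3,4) unfolding B by (auto simp: e_def pathstart_def pathfinish_def)
  qed
qed

lemma fillable_Lg:
  assumes m: "m \<ge> 1"
    and trans: "\<And>u v :: nat \<Rightarrow> 'a::unital_cstar_algebra. u \<in> Lg m \<Longrightarrow> v \<in> Lg m \<Longrightarrow> \<exists>g\<in>GL0 m. matrix_act m g u = v"
    and inj: "\<And>k. 1 \<le> k \<Longrightarrow> k \<le> n \<Longrightarrow>
      inj_on (GL_stabilisation TYPE('a) (k - 1) m) (GL_homotopy_group TYPE('a) (k - 1) (m - 1))"
    and surj: "\<And>k. 1 \<le> k \<Longrightarrow> k \<le> n \<Longrightarrow>
      GL_stabilisation TYPE('a) k m ` GL_homotopy_group TYPE('a) k (m - 1) = GL_homotopy_group TYPE('a) k m"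
    and k: "1 \<le> k" "k \<le> n + 1"
  shows "fillable k (Lg m :: (nat \<Rightarrow> 'a) set)"
proof (cases "k = 1")
  case True
  then show ?thesis
    using fillable_1[OF path_connected_Lg[OF trans]] by simp
next
  case False
  \<comment> \<open>Filling a cube of dimension \<open>j + 2\<close> concerns degree
    \<open>j + 1\<close> of \<open>Lg m\<close>, hence surjectivity in degree \<open>j + 1\<close>
    and injectivity in degree \<open>j\<close>.\<close>
  define j where "j = k - 2"
  have j: "k = Suc (Suc j)"
    using False k(1) by (simp add: j_def)
  have j': "1 \<le> Suc j" "Suc j \<le> n"
    using k(2) unfolding j by linarith+
  have inj': "inj_on (GL_stabilisation TYPE('a) j m) (GL_homotopy_group TYPE('a) j (m - 1))"
    using inj[OF j'] by (simp only: diff_Suc_1)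
  have "(f, \<lambda>_. last_vector m) \<in> cube_homotopy (Suc j) (Lg m) (last_vector m)"
    if f: "f \<in> cube_maps (Suc j) (Lg m) (last_vector m)" for f :: "(nat \<Rightarrow> real) \<Rightarrow> nat \<Rightarrow> 'a"
    using m trans inj' surj[OF j'] f by (rule Lg_cube_map_null)
  with m trans show ?thesis
    unfolding j by (rule Lg_fillable_Suc)
qed

section \<open>Maps from finite-dimensional compact spaces\<close>

text \<open>Coordinates are indexed by the vertices and not renumbered, so two faces meet in the
  face of the intersection and maps on them can be glued.\<close>

definition cube_face :: "nat set \<Rightarrow> (nat \<Rightarrow> real) set" where
  "cube_face \<sigma> = {t. (\<forall>i\<in>\<sigma>. 0 \<le> t i \<and> t i \<le> 1) \<and> (\<forall>i. i \<notin> \<sigma> \<longrightarrow> t i = 0)}"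

lemma continuous_on_coordinate: "continuous_on S (\<lambda>t :: nat \<Rightarrow> 'b::topological_space. t i)"
  by (rule continuous_on_apply[OF continuous_on_id])

lemma closed_cube_face: "closed (cube_face \<sigma>)"
proof -
  have "closed {t. i \<in> \<sigma> \<longrightarrow> 0 \<le> t i \<and> t i \<le> (1::real)}" "closed {t. i \<notin> \<sigma> \<longrightarrow> t i = (0::real)}" for i
    by (cases "i \<in> \<sigma>"; simp add: closed_Collect_conj closed_Collect_le closed_Collect_eq
        continuous_on_coordinate)+
  moreover have "cube_face \<sigma> = (\<Inter>i. {t. i \<in> \<sigma> \<longrightarrow> 0 \<le> t i \<and> t i \<le> 1} \<inter> {t. i \<notin> \<sigma> \<longrightarrow> t i = 0})"
    by (auto simp: cube_face_def)
  ultimately show ?thesis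
    by (simp add: closed_INT closed_Int)
qed

text \<open>An enumeration of \<sigma> identifies the face with the standard cube to which
  \<open>fillable\<close> refers.\<close>

lemma fill_cube_face:
  fixes g :: "(nat \<Rightarrow> real) \<Rightarrow> 'b::topological_space"
  assumes fill: "fillable (card \<sigma>) Y" and \<sigma>: "finite \<sigma>"
    and g: "continuous_on {t \<in> cube_face \<sigma>. \<exists>i\<in>\<sigma>. t i = 0 \<or> t i = 1} g"
    "\<And>t i. t \<in> cube_face \<sigma> \<Longrightarrow> i \<in> \<sigma> \<Longrightarrow> t i = 0 \<or> t i = 1 \<Longrightarrow> g t \<in> Y"
  obtains h where "continuous_on (cube_face \<sigma>) h" "h ` cube_face \<sigma> \<subseteq> Y"
    "\<And>t i. t \<in> cube_face \<sigma> \<Longrightarrow> i \<in> \<sigma> \<Longrightarrow> t i = 0 \<or> t i = 1 \<Longrightarrow> h t = g t"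
proof -
  define k where "k = card \<sigma>"
  obtain e where e: "bij_betw e {0..<k} \<sigma>"
    using ex_bij_betw_nat_finite[OF \<sigma>] unfolding k_def by blast
  define d where "d = the_inv_into {0..<k} e"
  have ed: "d (e a) = a" "e a \<in> \<sigma>" if "a < k" for a
    using that e by (auto simp: d_def bij_betw_def the_inv_into_f_f)
  have de: "e (d i) = i" "d i < k" if "i \<in> \<sigma>" for i
  proof -
    have "i \<in> e ` {0..<k}" "inj_on e {0..<k}"
      using that e by (auto simp: bij_betw_def)
    then show "e (d i) = i" "d i < k"
      using the_inv_into_into[of e "{0..<k}" i "{0..<k}"] by (auto simp: d_def f_the_inv_into_f)
  qed
  define push where "push t = (\<lambda>i. if i \<in> \<sigma> then t (d i) else 0 :: real)" for t
  define pull where "pull t = (\<lambda>a. if a < k then t (e a) else 0 :: real)" for t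
  have push_cont: "continuous_on S push" for S
  proof (rule continuous_on_coordinatewise_then_product)
    fix i
    show "continuous_on S (\<lambda>t. push t i)"
      by (cases "i \<in> \<sigma>") (simp_all add: push_def continuous_on_coordinate)
  qed
  have pull_cont: "continuous_on S pull" for S
  proof (rule continuous_on_coordinatewise_then_product)
    fix a
    show "continuous_on S (\<lambda>t. pull t a)"
      by (cases "a < k") (simp_all add: pull_def continuous_on_coordinate)
  qed
  have push_mem: "push t \<in> cube_face \<sigma>" if "t \<in> unit_cube k" for t
    using that de(2) by (simp add: push_def cube_face_def unit_cube_def)
  have push_bd: "\<exists>i\<in>\<sigma>. push t i = 0 \<or> push t i = 1" if t: "t \<in> cube_boundary k" for t
  proof -
    obtain a where "a < k" "t a = 0 \<or> t a = 1"
      using t by (auto simp: cube_boundary_def)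
    then show ?thesis
      by (intro bexI[of _ "e a"]) (simp_all add: push_def ed)
  qed
  have pull_mem: "pull t \<in> unit_cube k" if "t \<in> cube_face \<sigma>" for t
    using that ed(2) by (simp add: pull_def cube_face_def unit_cube_def)
  have pull_bd: "pull t \<in> cube_boundary k" if "t \<in> cube_face \<sigma>" "i \<in> \<sigma>" "t i = 0 \<or> t i = 1" for t i
    using pull_mem[OF that(1)] that(2,3) de[OF that(2)] unfolding cube_boundary_def
    by (intro CollectI conjI exI[of _ "d i"]) (simp_all add: pull_def)
  have push_pull: "push (pull t) = t" if "t \<in> cube_face \<sigma>" for t
    using that de by (auto simp: push_def pull_def cube_face_def fun_eq_iff)
  have "continuous_on (cube_boundary k) (\<lambda>t. g (push t))"
    by (rule continuous_on_compose2[OF g(1) push_cont])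
      (use push_mem push_bd cube_boundary_subset in blast)
  moreover have "(\<lambda>t. g (push t)) ` cube_boundary k \<subseteq> Y"
    using g(2) push_mem push_bd cube_boundary_subset by blast
  ultimately obtain h where h: "continuous_on (unit_cube k) h" "h ` unit_cube k \<subseteq> Y"
    "\<forall>t\<in>cube_boundary k. h t = g (push t)"
    using fill unfolding fillable_def k_def by blast
  show ?thesis
  proof
    show "continuous_on (cube_face \<sigma>) (\<lambda>t. h (pull t))"
      by (rule continuous_on_compose2[OF h(1) pull_cont]) (use pull_mem in blast)
    show "(\<lambda>t. h (pull t)) ` cube_face \<sigma> \<subseteq> Y"
      using h(2) pull_mem by blast
    show "h (pull t) = g t" if "t \<in> cube_face \<sigma>" "i \<in> \<sigma>" "t i = 0 \<or> t i = 1" for t i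
      using h(3) pull_bd[OF that] push_pull[OF that(1)] by simp
  qed
qed

text \<open>The cone over a finite simplicial complex \<open>K\<close> is realised cubically as the union of the faces
  \<open>[0, 1]\<^sup>\<sigma>\<close> for \<open>\<sigma> \<in> K\<close>: the cone point is \<open>0\<close> and the base consists of the points whose largest
  coordinate is \<open>1\<close>.  The extension is built cube by cube.\<close>

lemma extend_over_cone:
  fixes f :: "(nat \<Rightarrow> real) \<Rightarrow> 'b::topological_space"
  assumes K: "finite K" "\<And>\<sigma>. \<sigma> \<in> K \<Longrightarrow> finite \<sigma>" "\<And>\<sigma> \<tau>. \<sigma> \<in> K \<Longrightarrow> \<tau> \<subseteq> \<sigma> \<Longrightarrow> \<tau> \<in> K"
    and fill: "\<And>\<sigma>. \<sigma> \<in> K \<Longrightarrow> \<sigma> \<noteq> {} \<Longrightarrow> fillable (card \<sigma>) Y"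
    and y: "y \<in> Y"
    and f: "continuous_on {t \<in> (\<Union>\<sigma>\<in>K. cube_face \<sigma>). \<exists>i. t i = 1} f"
    "\<And>t i. t \<in> (\<Union>\<sigma>\<in>K. cube_face \<sigma>) \<Longrightarrow> t i = 1 \<Longrightarrow> f t \<in> Y"
  obtains F where "continuous_on (\<Union>\<sigma>\<in>K. cube_face \<sigma>) F" "F ` (\<Union>\<sigma>\<in>K. cube_face \<sigma>) \<subseteq> Y"
    "\<And>t i. t \<in> (\<Union>\<sigma>\<in>K. cube_face \<sigma>) \<Longrightarrow> t i = 1 \<Longrightarrow> F t = f t" "{} \<in> K \<Longrightarrow> F (\<lambda>_. 0) = y"
proof -
  define B where "B = {t \<in> (\<Union>\<sigma>\<in>K. cube_face \<sigma>). \<exists>i. t i = 1}"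
  have one_mem: "i \<in> \<sigma>" if "t \<in> cube_face \<sigma>" "t i = 1" for t i \<sigma>
    using that by (auto simp: cube_face_def)
  have B_eq: "B = (\<Union>\<sigma>\<in>K. \<Union>i\<in>\<sigma>. cube_face \<sigma> \<inter> {t. t i = 1})"
    unfolding B_def using one_mem by blast
  have closed_B: "closed B"
    unfolding B_eq using K(1,2)
    by (intro closed_UN ballI closed_Int closed_cube_face closed_Collect_eq continuous_on_coordinate
        continuous_on_const)
  \<comment> \<open>Induction over downward closed sets \<open>L\<close> of simplices. The base
    \<open>B\<close> belongs to every domain, so the prescribed values are present from the
    start.\<close>
  have step: "\<exists>F. continuous_on (B \<union> \<Union>(cube_face ` L)) F \<and> F ` (B \<union> \<Union>(cube_face ` L)) \<subseteq> Y \<and>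
      (\<forall>t\<in>B. F t = f t) \<and> ({} \<in> L \<longrightarrow> F (\<lambda>_. 0) = y)"
    if "L \<subseteq> K" "\<And>\<sigma> \<tau>. \<sigma> \<in> L \<Longrightarrow> \<tau> \<subseteq> \<sigma> \<Longrightarrow> \<tau> \<in> L" for L
    using that
  proof (induction "card L" arbitrary: L)
    case 0
    then have "L = {}"
      using K(1) by (metis card_0_eq finite_subset)
    then show ?case
      using f by (intro exI[of _ f]) (auto simp: B_def)
  next
    case (Suc c)
    have finL: "finite L"
      using Suc.prems(1) K(1) by (rule finite_subset)
    have "L \<noteq> {}"
      using Suc.hyps(2) by auto
    \<comment> \<open>Removing a maximal simplex leaves a downward closed set.\<close>
    then obtain \<sigma> where \<sigma>: "\<sigma> \<in> L" "\<And>\<tau>. \<tau> \<in> L \<Longrightarrow> \<sigma> \<subseteq> \<tau> \<Longrightarrow> \<sigma> = \<tau>"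
      using finite_has_maximal[OF finL] by blast
    define L' where "L' = L - {\<sigma>}"
    have \<sigma>K: "\<sigma> \<in> K"
      using \<sigma>(1) Suc.prems(1) by blast
    have "c = card L'"
      using Suc.hyps(2) \<sigma>(1) finL by (simp add: L'_def)
    moreover have "L' \<subseteq> K"
      using Suc.prems(1) by (auto simp: L'_def)
    moreover have "\<rho> \<in> L'" if "\<tau> \<in> L'" "\<rho> \<subseteq> \<tau>" for \<tau> \<rho>
      using that \<sigma>(2)[of \<tau>] Suc.prems(2)[of \<tau> \<rho>] by (auto simp: L'_def)
    ultimately obtain F where F: "continuous_on (B \<union> \<Union>(cube_face ` L')) F"
      "F ` (B \<union> \<Union>(cube_face ` L')) \<subseteq> Y" "\<forall>t\<in>B. F t = f t" "{} \<in> L' \<longrightarrow> F (\<lambda>_. 0) = y"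
      using Suc.hyps(1)[of L'] by blast
    define P where "P = B \<union> \<Union>(cube_face ` L')"
    have closed_P: "closed P"
      using finL unfolding P_def L'_def by (intro closed_Un closed_B closed_UN closed_cube_face ballI) auto
    have "\<exists>h. continuous_on (cube_face \<sigma>) h \<and> h ` cube_face \<sigma> \<subseteq> Y \<and> (\<forall>t\<in>P \<inter> cube_face \<sigma>. h t = F t) \<and>
        ({} \<in> L \<longrightarrow> h (\<lambda>_. 0) = y)"
    \<comment> \<open>The empty simplex is maximal only when it is alone. Its cube is the cone
      point, which is not in \<open>B\<close>, so the value \<open>y\<close> can be chosen
      freely.\<close>
    proof (cases "\<sigma> = {}")
      case True
      then have "cube_face \<sigma> = {\<lambda>_. 0}"
        by (auto simp: cube_face_def)
      moreover have "L' = {}"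
        using \<sigma>(2) True by (auto simp: L'_def)
      ultimately have "P \<inter> cube_face \<sigma> = {}"
        by (auto simp: P_def B_def)
      then show ?thesis
        using y by (intro exI[of _ "\<lambda>_. y"]) auto
    next
      case False
      have bd: "t \<in> P" if t: "t \<in> cube_face \<sigma>" "i \<in> \<sigma>" "t i = 0 \<or> t i = 1" for t i
        using t(3)
      proof
        assume "t i = 0"
        then have "t \<in> cube_face (\<sigma> - {i})"
          using t(1) by (auto simp: cube_face_def)
        moreover have "\<sigma> - {i} \<in> L'"
          using Suc.prems(2)[OF \<sigma>(1), of "\<sigma> - {i}"] t(2) by (auto simp: L'_def)
        ultimately show ?thesis
          unfolding P_def by blast
      next
        assume "t i = 1"
        then show ?thesis
          using t(1) \<sigma>K by (auto simp: P_def B_def)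
      qed
      \<comment> \<open>The cube meets the part already treated only in its boundary: another
        simplex misses some vertex of \<sigma> by maximality, and a coordinate equal to 1 belongs to
        \<sigma>.\<close>
      have bd': "\<exists>i\<in>\<sigma>. t i = 0 \<or> t i = 1" if t: "t \<in> P" "t \<in> cube_face \<sigma>" for t
      proof (cases "t \<in> B")
        case True
        then show ?thesis
          using one_mem[OF t(2)] unfolding B_def by blast
      next
        case False
        then obtain \<tau> where \<tau>: "\<tau> \<in> L" "\<tau> \<noteq> \<sigma>" "t \<in> cube_face \<tau>"
          using t(1) by (auto simp: P_def L'_def)
        then obtain i where "i \<in> \<sigma>" "i \<notin> \<tau>"
          using \<sigma>(2) by blast
        then show ?thesis
          using \<tau>(3) by (auto simp: cube_face_def)
      qed
      have c1: "continuous_on {t \<in> cube_face \<sigma>. \<exists>i\<in>\<sigma>. t i = 0 \<or> t i = 1} F"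
        by (rule continuous_on_subset[OF F(1)[folded P_def]]) (use bd in blast)
      have c2: "F t \<in> Y" if "t \<in> cube_face \<sigma>" "i \<in> \<sigma>" "t i = 0 \<or> t i = 1" for t i
        using F(2)[folded P_def] bd[OF that] by blast
      obtain h where h: "continuous_on (cube_face \<sigma>) h" "h ` cube_face \<sigma> \<subseteq> Y"
        "\<And>t i. t \<in> cube_face \<sigma> \<Longrightarrow> i \<in> \<sigma> \<Longrightarrow> t i = 0 \<or> t i = 1 \<Longrightarrow> h t = F t"
        by (rule fill_cube_face[OF fill[OF \<sigma>K False] K(2)[OF \<sigma>K] c1 c2]) blast+
      have "h (\<lambda>_. 0) = y" if "{} \<in> L"
      proof -
        have "{} \<in> L'"
          using that False by (simp add: L'_def)
        moreover have "h (\<lambda>_. 0) = F (\<lambda>_. 0)"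
        proof -
          obtain i where "i \<in> \<sigma>"
            using False by blast
          then show ?thesis
            by (intro h(3)[of _ i]) (simp_all add: cube_face_def)
        qed
        ultimately show ?thesis
          using F(4) by simp
      qed
      moreover have "h t = F t" if "t \<in> P \<inter> cube_face \<sigma>" for t
        using bd'[of t] h(3)[of t] that by blast
      ultimately show ?thesis
        using h(1,2) by blast
    qed
    then obtain h where h: "continuous_on (cube_face \<sigma>) h" "h ` cube_face \<sigma> \<subseteq> Y"
      "\<And>t. t \<in> P \<Longrightarrow> t \<in> cube_face \<sigma> \<Longrightarrow> h t = F t" "{} \<in> L \<longrightarrow> h (\<lambda>_. 0) = y"
      by blast
    let ?F = "\<lambda>t. if t \<in> cube_face \<sigma> then h t else F t"
    have PL: "B \<union> \<Union>(cube_face ` L) = cube_face \<sigma> \<union> P"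
      using \<sigma>(1) by (auto simp: P_def L'_def)
    show ?case
      unfolding PL
    proof (intro exI conjI)
      show "continuous_on (cube_face \<sigma> \<union> P) ?F"
        by (rule continuous_on_cases[OF closed_cube_face closed_P h(1) F(1)[folded P_def]]) (use h(3) in blast)
      show "?F ` (cube_face \<sigma> \<union> P) \<subseteq> Y"
        using h(2) F(2)[folded P_def] by (auto simp: image_subset_iff)
      show "\<forall>t\<in>B. ?F t = f t"
        using h(3) F(3) by (simp add: P_def)
      show "{} \<in> L \<longrightarrow> ?F (\<lambda>_. 0) = y"
        using h(4) by (simp add: cube_face_def)
    qed
  qed
  have BK: "B \<union> \<Union>(cube_face ` K) = (\<Union>\<sigma>\<in>K. cube_face \<sigma>)"
    by (auto simp: B_def)
  have "\<exists>F. continuous_on (B \<union> \<Union>(cube_face ` K)) F \<and> F ` (B \<union> \<Union>(cube_face ` K)) \<subseteq> Y \<and>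
      (\<forall>t\<in>B. F t = f t) \<and> ({} \<in> K \<longrightarrow> F (\<lambda>_. 0) = y)"
    by (rule step) (use K(3) in blast)+
  then obtain F where "continuous_on (\<Union>\<sigma>\<in>K. cube_face \<sigma>) F" "F ` (\<Union>\<sigma>\<in>K. cube_face \<sigma>) \<subseteq> Y"
    "\<forall>t\<in>B. F t = f t" "{} \<in> K \<longrightarrow> F (\<lambda>_. 0) = y"
    unfolding BK by blast
  then show ?thesis
    by (intro that[of F]) (auto simp: B_def)
qed

section \<open>Approximation of maps through the nerve of a cover\<close>

lemma norm_weighted_sum_diff_le:
  fixes p :: "'i \<Rightarrow> 'b::real_normed_vector"
  assumes "\<And>a. a \<in> I \<Longrightarrow> 0 \<le> w a" "(\<Sum>a\<in>I. w a) = 1"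
    and "\<And>a. a \<in> I \<Longrightarrow> w a \<noteq> 0 \<Longrightarrow> norm (p a - q) \<le> e"
  shows "norm ((\<Sum>a\<in>I. w a *\<^sub>R p a) - q) \<le> e"
proof -
  have "(\<Sum>a\<in>I. w a *\<^sub>R p a) - q = (\<Sum>a\<in>I. w a *\<^sub>R (p a - q))"
    by (simp add: scaleR_diff_right sum_subtractf assms(2) flip: scaleR_sum_left)
  also have "norm \<dots> \<le> (\<Sum>a\<in>I. w a * e)"
  proof (rule sum_norm_le)
    fix a assume a: "a \<in> I"
    show "norm (w a *\<^sub>R (p a - q)) \<le> w a * e"
      using assms(1)[OF a] assms(3)[OF a] by (cases "w a = 0") (simp_all add: mult_left_mono)
  qed
  also have "\<dots> = e"
    by (simp add: assms(2) flip: sum_distrib_right)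
  finally show ?thesis .
qed

text \<open>A continuous left inverse is bounded on the compact \<open>S\<close>, say by
  \<open>M\<close>. Moving entries by at most \<open>1/(2 M)\<close> changes \<open>c u = 1\<close>
  by at most 1/2, inside the Neumann range.\<close>

lemma Lg_uniform_neighbourhood:
  fixes u :: "'x::t2_space \<Rightarrow> nat \<Rightarrow> 'a::unital_cstar_algebra"
  assumes S: "compact S" and u: "continuous_on S u" "u ` S \<subseteq> Lg m"
  obtains e where "e > 0"
    "\<And>x v. x \<in> S \<Longrightarrow> v \<in> vectors m \<Longrightarrow> (\<And>i. i < m \<Longrightarrow> norm (v i - u x i) \<le> e) \<Longrightarrow> v \<in> Lg m"
proof -
  obtain c where c: "continuous_on S c" "\<And>x. x \<in> S \<Longrightarrow> (\<Sum>i<m. c x i * u x i) = 1"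
    using continuous_left_inverse[OF S u] by blast
  have "continuous_on S (\<lambda>x. \<Sum>i<m. norm (c x i))"
    by (intro continuous_on_sum continuous_on_norm continuous_on_apply[OF c(1)])
  then have "bounded ((\<lambda>x. \<Sum>i<m. norm (c x i)) ` S)"
    using S by (intro compact_imp_bounded compact_continuous_image)
  then obtain M where M: "M > 0" "\<And>x. x \<in> S \<Longrightarrow> norm (\<Sum>i<m. norm (c x i)) \<le> M"
    unfolding bounded_pos by blast
  have M': "(\<Sum>i<m. norm (c x i)) \<le> M" if "x \<in> S" for x
    using M(2)[OF that] by (simp add: abs_le_iff)
  show ?thesis
  proof
    show "inverse (2 * M) > 0"
      using M(1) by simp
    fix x v
    assume x: "x \<in> S" and v: "v \<in> vectors m" and near: "\<And>i. i < m \<Longrightarrow> norm (v i - u x i) \<le> inverse (2 * M)"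
    have "1 - (\<Sum>i<m. c x i * v i) = (\<Sum>i<m. c x i * (u x i - v i))"
      by (simp add: c(2)[OF x] right_diff_distrib sum_subtractf)
    also have "norm \<dots> \<le> (\<Sum>i<m. norm (c x i) * inverse (2 * M))"
      using near by (intro sum_norm_le order_trans[OF norm_mult_ineq] mult_left_mono)
        (auto simp: norm_minus_commute)
    also have "\<dots> \<le> M * inverse (2 * M)"
      unfolding sum_distrib_right[symmetric] using M(1) M'[OF x] by (intro mult_right_mono) auto
    also have "\<dots> < 1"
      using M(1) by simp
    finally show "v \<in> Lg m"
      by (rule Lg_near[OF v])
  qed
qed

lemma homotopic_mapsI:
  fixes H :: "real \<times> 'x::topological_space \<Rightarrow> 'b::topological_space"
  assumes "continuous_on ({0..1} \<times> UNIV) H" "\<And>s x. 0 \<le> s \<Longrightarrow> s \<le> 1 \<Longrightarrow> H (s, x) \<in> Y"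
    and "\<And>x. H (0, x) = f x" "\<And>x. H (1, x) = g x"
  shows "homotopic_with_canon (\<lambda>_. True) UNIV Y f g"
  unfolding homotopic_with_def
proof (intro exI[of _ H] conjI)
  show "continuous_map (prod_topology (top_of_set {0..1}) (top_of_set UNIV)) (top_of_set Y) H"
    using assms(1,2) unfolding prod_topology_subtopology_eu by auto
qed (simp_all add: assms)

text \<open>The refinement in the definition may be infinite; a finite subcover has no larger
  multiplicity, and an injective indexing makes counting indices the same as counting sets.\<close>

lemma covering_dim_finite_refinement:
  fixes U :: "'x::topological_space set set"
  assumes X: "compact (UNIV :: 'x set)" and dim: "covering_dim_le TYPE('x) n"
    and U: "finite U" "\<And>A. A \<in> U \<Longrightarrow> open A" "\<Union>U = (UNIV :: 'x set)"
  obtains V :: "nat \<Rightarrow> 'x set" and N where "\<And>i. i < N \<Longrightarrow> open (V i)" "(\<Union>i<N. V i) = UNIV"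
    "\<And>i. i < N \<Longrightarrow> \<exists>A\<in>U. V i \<subseteq> A" "\<And>x. card {i. i < N \<and> x \<in> V i} \<le> n + 1"
proof -
  have "finite U \<and> (\<forall>A\<in>U. open A) \<and> \<Union>U = UNIV"
    using U by blast
  from dim[unfolded covering_dim_le_def, THEN spec, THEN mp, OF this]
  obtain \<V> where \<V>: "\<forall>A\<in>\<V>. open A" "\<Union>\<V> = (UNIV :: 'x set)" "\<forall>A\<in>\<V>. \<exists>B\<in>U. A \<subseteq> B"
    "\<forall>x. finite {A \<in> \<V>. x \<in> A} \<and> card {A \<in> \<V>. x \<in> A} \<le> n + 1"
    by (elim exE conjE)
  obtain \<W> where \<W>: "\<W> \<subseteq> \<V>" "finite \<W>" "UNIV \<subseteq> \<Union>\<W>"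
    by (rule compactE[OF X, of \<V>]) (use \<V>(1,2) in auto)
  obtain N and V :: "nat \<Rightarrow> 'x set" where V: "\<W> = V ` {i. i < N}" "inj_on V {i. i < N}"
    using finite_imp_nat_seg_image_inj_on[OF \<W>(2)] by blast
  have mem: "V i \<in> \<V>" if "i < N" for i
    using V(1) \<W>(1) that by blast
  show ?thesis
  proof
    show "(\<Union>i<N. V i) = UNIV"
      using \<W>(3) unfolding V(1) lessThan_def by blast
    show "card {i. i < N \<and> x \<in> V i} \<le> n + 1" for x
    proof -
      have "card {i. i < N \<and> x \<in> V i} = card (V ` {i. i < N \<and> x \<in> V i})"
        by (rule card_image[symmetric], rule inj_on_subset[OF V(2)]) blast
      also have "\<dots> \<le> card {A \<in> \<V>. x \<in> A}"
        using \<V>(4) mem by (intro card_mono) auto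
      also have "\<dots> \<le> n + 1"
        using \<V>(4) by blast
      finally show ?thesis .
    qed
  qed (use mem \<V> in blast)+
qed

text \<open>A map on a space of dimension at most \<open>n\<close> is homotopic, through nearby maps, to one that factors
  through the nerve of a fine cover, and the latter map extends over the cone of the nerve.\<close>

lemma Lg_map_homotopic_constant:
  fixes u :: "'x::t2_space \<Rightarrow> nat \<Rightarrow> 'a::unital_cstar_algebra"
  assumes X: "compact (UNIV :: 'x set)" and dim: "covering_dim_le TYPE('x) n"
    and fill: "\<And>k. 1 \<le> k \<Longrightarrow> k \<le> n + 1 \<Longrightarrow> fillable k (Lg m :: (nat \<Rightarrow> 'a) set)"
    and u: "continuous_on UNIV u" "\<And>x. u x \<in> Lg m" and y: "y \<in> Lg m"
  shows "homotopic_with_canon (\<lambda>_. True) UNIV (Lg m) u (\<lambda>_. y)"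
proof -
  obtain e where e: "e > 0"
    "\<And>x v. v \<in> vectors m \<Longrightarrow> (\<And>i. i < m \<Longrightarrow> norm (v i - u x i) \<le> e) \<Longrightarrow> v \<in> Lg m"
  proof (rule Lg_uniform_neighbourhood[OF X u(1), of m])
    show "range u \<subseteq> Lg m"
      using u(2) by blast
  qed blast
  \<comment> \<open>If \<open>x\<close> lies in \<open>V i\<close> for all vertices \<open>i\<close>
    of a simplex, every \<open>u (z i)\<close> is entrywise within \<open>e\<close> of
    \<open>u x\<close>. The same then holds for their convex combinations, which therefore stay in
    \<open>Lg m\<close>.\<close>
  define W where "W z = {x. (\<Sum>i<m. norm (u x i - u z i)) < e}" for z
  have openW: "open (W z)" for z
    unfolding W_def
    by (intro open_Collect_less continuous_on_sum continuous_on_norm continuous_on_diff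
        continuous_on_const continuous_on_apply[OF u(1)])
  have W: "norm (u x i - u z i) \<le> e" if "x \<in> W z" "i < m" for x z i
  proof -
    have "norm (u x i - u z i) \<le> (\<Sum>i<m. norm (u x i - u z i))"
      using that(2) by (intro member_le_sum) auto
    then show ?thesis
      using that(1) by (simp add: W_def)
  qed
  have "x \<in> W x" for x
    using e(1) by (simp add: W_def)
  then have "UNIV \<subseteq> (\<Union>z\<in>UNIV. W z)"
    by blast
  then obtain D where D: "finite D" "UNIV \<subseteq> (\<Union>z\<in>D. W z)"
    using compactE_image[OF X, of UNIV W] openW by metis
  obtain V :: "nat \<Rightarrow> 'x set" and N where V: "\<And>i. i < N \<Longrightarrow> open (V i)" "(\<Union>i<N. V i) = UNIV"
    "\<And>i. i < N \<Longrightarrow> \<exists>A\<in>W ` D. V i \<subseteq> A" "\<And>x. card {i. i < N \<and> x \<in> V i} \<le> n + 1"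
    by (rule covering_dim_finite_refinement[OF X dim, of "W ` D"]) (use D openW in auto)
  have "\<exists>z. V i \<subseteq> W z" if "i < N" for i
    using V(3)[OF that] by blast
  then obtain z where z: "\<And>i. i < N \<Longrightarrow> V i \<subseteq> W (z i)"
    by metis
  obtain \<psi> where \<psi>: "\<And>i. continuous_on UNIV (\<psi> i)" "\<And>i x. 0 \<le> \<psi> i x \<and> \<psi> i x \<le> (1::real)"
    "\<And>i x. \<psi> i x \<noteq> 0 \<Longrightarrow> x \<in> V i" "\<And>x. \<exists>i\<in>{..<N}. \<psi> i x = 1"
    by (rule bump_functions[OF X, of "{..<N}" V]) (use V in auto)
  define \<phi> where "\<phi> x = (\<lambda>i. if i < N then \<psi> i x else 0)" for x
  have \<phi>: "continuous_on UNIV \<phi>"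
  proof (rule continuous_on_coordinatewise_then_product)
    fix i
    show "continuous_on UNIV (\<lambda>x. \<phi> x i)"
      using \<psi>(1) by (cases "i < N") (simp_all add: \<phi>_def)
  qed
  define \<sigma> where "\<sigma> x = {i. i < N \<and> x \<in> V i}" for x
  \<comment> \<open>The nerve of the cover together with the empty simplex, whose face is the cone
    point 0.\<close>
  define K where "K = {\<tau>. \<exists>x. \<tau> \<subseteq> \<sigma> x}"
  define C where "C = (\<Union>\<tau>\<in>K. cube_face \<tau>)"
  have finite_\<sigma>: "finite (\<sigma> x)" for x
    by (simp add: \<sigma>_def)
  have K: "finite K" "\<And>\<tau>. \<tau> \<in> K \<Longrightarrow> finite \<tau>" "\<And>\<tau> \<rho>. \<tau> \<in> K \<Longrightarrow> \<rho> \<subseteq> \<tau> \<Longrightarrow> \<rho> \<in> K"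
  proof -
    have "K \<subseteq> Pow {..<N}"
      by (auto simp: K_def \<sigma>_def)
    then show "finite K"
      by (rule finite_subset) simp
    show "finite \<tau>" if "\<tau> \<in> K" for \<tau>
      using that finite_\<sigma> finite_subset unfolding K_def by blast
    show "\<rho> \<in> K" if "\<tau> \<in> K" "\<rho> \<subseteq> \<tau>" for \<tau> \<rho>
      using that unfolding K_def by blast
  qed
  have fillK: "fillable (card \<tau>) (Lg m :: (nat \<Rightarrow> 'a) set)" if \<tau>: "\<tau> \<in> K" "\<tau> \<noteq> {}" for \<tau>
  proof (rule fill)
    obtain x where "\<tau> \<subseteq> \<sigma> x"
      using \<tau>(1) by (auto simp: K_def)
    then have "card \<tau> \<le> card (\<sigma> x)"
      by (intro card_mono finite_\<sigma>)
    then show "card \<tau> \<le> n + 1"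
      using V(4)[of x] by (simp add: \<sigma>_def)
    show "1 \<le> card \<tau>"
      using K(2)[OF \<tau>(1)] \<tau>(2) by (simp add: Suc_le_eq card_gt_0_iff)
  qed
  \<comment> \<open>Dividing by the coordinate sum turns cubical coordinates into barycentric ones,
    so on the base \<open>f\<close> interpolates the values \<open>u (z a)\<close> at the
    vertices.\<close>
  define f where "f t = (\<lambda>i. \<Sum>a<N. (t a / (\<Sum>b<N. t b)) *\<^sub>R u (z a) i)" for t :: "nat \<Rightarrow> real"
  have sum_pos: "(\<Sum>b<N. t b) > 0" if t: "t \<in> C" "t i = 1" for t i
  proof -
    obtain \<tau> x where \<tau>: "t \<in> cube_face \<tau>" "\<tau> \<subseteq> \<sigma> x"
      using t(1) by (auto simp: C_def K_def)
    have nonneg: "0 \<le> t b" for b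
      using \<tau>(1) by (cases "b \<in> \<tau>") (auto simp: cube_face_def)
    have "i < N"
      using \<tau> t(2) by (cases "i \<in> \<tau>") (auto simp: cube_face_def \<sigma>_def)
    then have "t i \<le> (\<Sum>b<N. t b)"
      using nonneg by (intro member_le_sum) auto
    then show ?thesis
      using t(2) by simp
  qed
  have f_near: "norm (f t i - u x i) \<le> e"
    if t: "t \<in> cube_face \<tau>" "\<tau> \<subseteq> \<sigma> x" "(\<Sum>b<N. t b) > 0" and i: "i < m" for t \<tau> x i
    unfolding f_def
  proof (rule norm_weighted_sum_diff_le)
    show "0 \<le> t a / (\<Sum>b<N. t b)" for a
      using t(1,3) by (cases "a \<in> \<tau>") (auto simp: cube_face_def)
    show "(\<Sum>a<N. t a / (\<Sum>b<N. t b)) = 1"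
      using t(3) by (simp flip: sum_divide_distrib)
    show "norm (u (z a) i - u x i) \<le> e" if a: "t a / (\<Sum>b<N. t b) \<noteq> 0" for a
    proof -
      have "a \<in> \<tau>"
        using a t(1) by (auto simp: cube_face_def)
      then have "x \<in> W (z a)"
        using t(2) z by (auto simp: \<sigma>_def)
      then show ?thesis
        using W[OF _ i] by (simp add: norm_minus_commute)
    qed
  qed
  have f_vec: "f t \<in> vectors m" for t
    using Lg_vectors[OF u(2)] by (simp add: f_def vectors_def)
  have fL: "f t \<in> Lg m" if t: "t \<in> C" "t i = 1" for t i
  proof -
    obtain \<tau> x where \<tau>: "t \<in> cube_face \<tau>" "\<tau> \<subseteq> \<sigma> x"
      using t(1) by (auto simp: C_def K_def)
    show ?thesis
      using e(2)[OF f_vec] f_near[OF \<tau> sum_pos[OF t]] by blast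
  qed
  have fC: "continuous_on {t \<in> C. \<exists>i. t i = 1} f"
    unfolding f_def
  proof (intro continuous_on_coordinatewise_then_product continuous_on_sum continuous_on_scaleR
      continuous_on_divide continuous_on_coordinate continuous_on_const ballI)
    show "(\<Sum>b<N. t b) \<noteq> 0" if "t \<in> {t \<in> C. \<exists>i. t i = 1}" for t
      using sum_pos that by force
  qed
  obtain F where F: "continuous_on C F" "F ` C \<subseteq> Lg m" "\<And>t i. t \<in> C \<Longrightarrow> t i = 1 \<Longrightarrow> F t = f t"
    "{} \<in> K \<Longrightarrow> F (\<lambda>_. 0) = y"
    unfolding C_def
    by (rule extend_over_cone[OF K fillK y fC[unfolded C_def] fL[unfolded C_def]]) blast+
  have F0: "F (\<lambda>_. 0) = y"
    by (rule F(4)) (auto simp: K_def)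
  have \<phi>_face: "(\<lambda>i. s * \<phi> x i) \<in> cube_face (\<sigma> x)" if "0 \<le> s" "s \<le> 1" for s x
    using that \<psi>(2,3) by (auto simp: cube_face_def \<phi>_def \<sigma>_def mult_le_one)
  have \<phi>_mem: "(\<lambda>i. s * \<phi> x i) \<in> C" if "0 \<le> s" "s \<le> 1" for s x
    using \<phi>_face[OF that] by (auto simp: C_def K_def)
  have \<phi>1: "\<exists>i. \<phi> x i = 1" for x
    using \<psi>(4)[of x] by (auto simp: \<phi>_def)
  have F\<phi>: "F (\<phi> x) = f (\<phi> x)" for x
    using \<phi>1[of x] \<phi>_mem[of 1 x] F(3) by auto
  have \<phi>_near: "norm (f (\<phi> x) i - u x i) \<le> e" if "i < m" for x i
    using f_near[of "\<phi> x" "\<sigma> x" x i] \<phi>_face[of 1 x] \<phi>_mem[of 1 x] \<phi>1[of x] sum_pos[of "\<phi> x"] that by auto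
  have f\<phi>: "continuous_on UNIV (\<lambda>x. f (\<phi> x))"
    by (rule continuous_on_compose2[OF fC \<phi>]) (use \<phi>_mem[of 1] \<phi>1 in auto)
  have "homotopic_with_canon (\<lambda>_. True) UNIV (Lg m) u (\<lambda>x. f (\<phi> x))"
  proof (rule homotopic_mapsI)
    let ?H = "\<lambda>p i. (1 - fst p) *\<^sub>R u (snd p) i + fst p *\<^sub>R f (\<phi> (snd p)) i"
    show "continuous_on ({0..1} \<times> UNIV) ?H"
      by (intro continuous_on_coordinatewise_then_product continuous_on_add continuous_on_scaleR
          continuous_on_diff continuous_on_const continuous_on_fst continuous_on_id
          continuous_on_compose2[OF continuous_on_apply[OF u(1)] continuous_on_snd]
          continuous_on_compose2[OF continuous_on_apply[OF f\<phi>] continuous_on_snd]) auto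
    show "?H (s, x) \<in> Lg m" if s: "0 \<le> s" "s \<le> 1" for s x
    proof (rule e(2)[of _ x])
      show "?H (s, x) \<in> vectors m"
        using Lg_vectors[OF u(2)[of x]] f_vec[of "\<phi> x"] by (simp add: vectors_def)
      show "norm (?H (s, x) i - u x i) \<le> e" if i: "i < m" for i
      proof -
        have "?H (s, x) i - u x i = s *\<^sub>R (f (\<phi> x) i - u x i)"
          by (simp add: algebra_simps)
        also have "norm \<dots> \<le> 1 * e"
          unfolding norm_scaleR using s \<phi>_near[OF i, of x] by (intro mult_mono) auto
        finally show ?thesis
          by simp
      qed
    qed
  qed simp_all
  moreover have "homotopic_with_canon (\<lambda>_. True) UNIV (Lg m) (\<lambda>x. f (\<phi> x)) (\<lambda>_. y)"
  proof (rule homotopic_mapsI)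
    \<comment> \<open>Scaling \<open>\<phi> x\<close> to 0 follows the line of the cone from the
      base to the cone point, where \<open>F\<close> has the value \<open>y\<close>.\<close>
    let ?t = "\<lambda>p i. (1 - fst p) * \<phi> (snd p) i"
    have t_mem: "?t p \<in> C" if "p \<in> {0..1} \<times> UNIV" for p
      using \<phi>_mem[of "1 - fst p" "snd p"] that by auto
    have t: "continuous_on ({0..1} \<times> UNIV) ?t"
      by (intro continuous_on_coordinatewise_then_product continuous_on_mult continuous_on_diff
          continuous_on_const continuous_on_fst continuous_on_id
          continuous_on_compose2[OF continuous_on_apply[OF \<phi>] continuous_on_snd]) auto
    show "continuous_on ({0..1} \<times> UNIV) (\<lambda>p. F (?t p))"
      by (rule continuous_on_compose2[OF F(1) t]) (use t_mem in blast)
    show "F (?t (s, x)) \<in> Lg m" if "0 \<le> s" "s \<le> 1" for s x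
      using F(2) t_mem[of "(s, x)"] that by auto
  qed (simp_all add: F\<phi> F0)
  ultimately show ?thesis
    by (rule homotopic_with_trans)
qed

section \<open>Continuous functions with values in the algebra\<close>

definition C_eval :: "'x::topological_space \<Rightarrow> ('x, 'a::unital_cstar_algebra) C_tensor \<Rightarrow> 'a" where
  "C_eval x a = apply_bcontfun (Rep_C_tensor a) x"

lemma C_tensor_eqI: "(\<And>x. C_eval x a = C_eval x b) \<Longrightarrow> a = b"
  unfolding C_eval_def by (metis bcontfun_eqI Rep_C_tensor_inject)

lemma C_eval_zero [simp]: "C_eval x 0 = 0"
  by (simp add: C_eval_def zero_C_tensor.rep_eq)

lemma C_eval_one [simp]: "C_eval x 1 = 1"
  by (simp add: C_eval_def one_C_tensor.rep_eq)

lemma C_eval_plus [simp]: "C_eval x (a + b) = C_eval x a + C_eval x b"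
  by (simp add: C_eval_def plus_C_tensor.rep_eq)

lemma C_eval_mult [simp]: "C_eval x (a * b) = C_eval x a * C_eval x b"
  by (simp add: C_eval_def times_C_tensor.rep_eq)

lemma C_eval_sum [simp]: "C_eval x (\<Sum>i\<in>I. a i) = (\<Sum>i\<in>I. C_eval x (a i))"
  by (induction I rule: infinite_finite_induct) simp_all

lemma continuous_on_C_eval: "continuous_on S (\<lambda>x. C_eval x a)"
  by (simp add: C_eval_def)

lemma dist_C_tensor_le:
  assumes "\<And>x. dist (C_eval x a) (C_eval x b) \<le> e"
  shows "dist a b \<le> e"
  unfolding dist_C_tensor.rep_eq using assms by (intro dist_bound) (simp add: C_eval_def)

lemma apply_bcontfun_sum:
  "apply_bcontfun (\<Sum>i\<in>I. f i) x = (\<Sum>i\<in>I. apply_bcontfun (f i) x)"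
  by (induction I rule: infinite_finite_induct) simp_all

lemma bcontfun_of_compact:
  assumes "compact (UNIV :: 'x::topological_space set)" "continuous_on UNIV f"
  shows "(f :: 'x \<Rightarrow> 'b::metric_space) \<in> bcontfun"
  using assms compact_imp_bounded[OF compact_continuous_image[OF assms(2,1)]] by (simp add: bcontfun_def)

text \<open>By a partition of unity every continuous function is a uniform limit of sums of elementary
  tensors.\<close>

lemma ex_C_tensor:
  fixes f :: "'x::t2_space \<Rightarrow> 'a::unital_cstar_algebra"
  assumes X: "compact (UNIV :: 'x set)" and f: "continuous_on UNIV f"
  shows "\<exists>a. \<forall>x. C_eval x a = f x"
proof -
  define b where "b = Bcontfun f"
  have b: "apply_bcontfun b x = f x" for x
    by (simp add: b_def Bcontfun_inverse bcontfun_of_compact[OF X f])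
  have "b \<in> closure tensor_span"
    unfolding closure_approachable
  proof (intro allI impI)
    fix e :: real assume e: "e > 0"
    define U where "U z = {x. norm (f x - f z) < e/2}" for z
    have "openin (top_of_set UNIV) (U z) \<and> z \<in> U z" for z
    proof
      have "open (U z)"
        unfolding U_def
        by (intro open_Collect_less continuous_on_norm continuous_on_diff continuous_on_const f)
      then show "openin (top_of_set UNIV) (U z)"
        by simp
      show "z \<in> U z"
        using e by (simp add: U_def)
    qed
    then obtain D and \<phi> :: "'x \<Rightarrow> 'x \<Rightarrow> real" where D: "finite D"
      and \<phi>: "\<And>z. continuous_on UNIV (\<phi> z)" "\<And>z x. 0 \<le> \<phi> z x" "\<And>z x. \<phi> z x \<noteq> 0 \<Longrightarrow> x \<in> U z"
      "\<And>x. (\<Sum>z\<in>D. \<phi> z x) = 1"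
      using partition_of_unity[OF X, of U] by auto
    define \<psi> where "\<psi> z = Bcontfun (\<lambda>x. complex_of_real (\<phi> z x))" for z
    have \<psi>: "apply_bcontfun (\<psi> z) x = complex_of_real (\<phi> z x)" for z x
      by (simp add: \<psi>_def Bcontfun_inverse bcontfun_of_compact[OF X] continuous_on_of_real \<phi>(1))
    define s where "s = (\<Sum>z\<in>D. elementary_tensor (\<psi> z) (f z))"
    have s: "apply_bcontfun s x = (\<Sum>z\<in>D. \<phi> z x *\<^sub>R f z)" for x
      by (simp add: s_def apply_bcontfun_sum \<psi> scaleC_of_real)
    have "dist s b \<le> e/2"
    proof (rule dist_bound)
      fix x
      have "norm ((\<Sum>z\<in>D. \<phi> z x *\<^sub>R f z) - f x) \<le> e/2"
      proof (rule norm_weighted_sum_diff_le)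
        show "norm (f z - f x) \<le> e/2" if "\<phi> z x \<noteq> 0" for z
          using \<phi>(3)[OF that] by (simp add: U_def norm_minus_commute)
      qed (use \<phi> in auto)
      then show "dist (apply_bcontfun s x) (apply_bcontfun b x) \<le> e/2"
        by (simp add: s b dist_norm)
    qed
    moreover have "s \<in> tensor_span"
      unfolding s_def tensor_span_def by (intro span_sum span_base) blast
    ultimately show "\<exists>s\<in>tensor_span. dist s b < e"
      using e by (intro bexI[of _ s]) auto
  qed
  then show ?thesis
    by (intro exI[of _ "Abs_C_tensor b"]) (simp add: C_eval_def Abs_C_tensor_inverse b)
qed

definition C_of_fun :: "('x::topological_space \<Rightarrow> 'a::unital_cstar_algebra) \<Rightarrow> ('x, 'a) C_tensor" where
  "C_of_fun f = (SOME a. \<forall>x. C_eval x a = f x)"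

lemma C_eval_C_of_fun:
  fixes f :: "'x::t2_space \<Rightarrow> 'a::unital_cstar_algebra"
  assumes "compact (UNIV :: 'x set)" "continuous_on UNIV f"
  shows "C_eval x (C_of_fun f) = f x"
  using someI_ex[OF ex_C_tensor[OF assms]] by (simp add: C_of_fun_def)

lemma Lg_C_eval:
  assumes "u \<in> Lg m"
  shows "(\<lambda>i. C_eval x (u i)) \<in> Lg m"
proof -
  obtain c where "(\<Sum>i<m. c i * u i) = 1"
    using assms by (auto simp: Lg_iff)
  then have "C_eval x (\<Sum>i<m. c i * u i) = 1"
    by simp
  then show ?thesis
    using Lg_vectors[OF assms] by (intro Lg_I[where c = "\<lambda>i. C_eval x (c i)"]) (simp_all add: vectors_def)
qed

section \<open>Matrices over the tensor product as families of matrices\<close>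

definition C_matrix ::
  "('x::topological_space \<Rightarrow> nat \<Rightarrow> nat \<Rightarrow> 'a::unital_cstar_algebra) \<Rightarrow> nat \<Rightarrow> nat \<Rightarrow> ('x, 'a) C_tensor" where
  "C_matrix g = (\<lambda>i j. C_of_fun (\<lambda>x. g x i j))"

lemma C_eval_C_matrix:
  fixes g :: "'x::t2_space \<Rightarrow> nat \<Rightarrow> nat \<Rightarrow> 'a::unital_cstar_algebra"
  assumes "compact (UNIV :: 'x set)" "continuous_on UNIV g"
  shows "C_eval x (C_matrix g i j) = g x i j"
  unfolding C_matrix_def by (rule C_eval_C_of_fun[OF assms(1) continuous_on_apply2[OF assms(2)]])

lemma C_eval_matrix_one: "C_eval x (matrix_one m i j) = matrix_one m i j"
  by (simp add: matrix_one_def)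

text \<open>Inversion is continuous, so the pointwise inverses form a matrix over the tensor
  product, and the identities hold because they hold at every point.\<close>

lemma C_matrix_GL:
  fixes g :: "'x::t2_space \<Rightarrow> nat \<Rightarrow> nat \<Rightarrow> 'a::unital_cstar_algebra"
  assumes X: "compact (UNIV :: 'x set)" and g: "continuous_on UNIV g" "\<And>x. g x \<in> GL m"
  shows "C_matrix g \<in> GL m"
proof -
  have h: "continuous_on UNIV (\<lambda>x. GL_inv m (g x))"
    using g by (intro continuous_on_GL_inv) auto
  note ev = C_eval_C_matrix[OF X g(1)] C_eval_C_matrix[OF X h]
  have mult: "matrix_mult m a b = matrix_one m"
    if "\<And>x. matrix_mult m (\<lambda>i j. C_eval x (a i j)) (\<lambda>i j. C_eval x (b i j)) = matrix_one m"
    for a b :: "nat \<Rightarrow> nat \<Rightarrow> ('x, 'a) C_tensor"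
  proof (intro ext C_tensor_eqI)
    fix i j x
    show "C_eval x (matrix_mult m a b i j) = C_eval x (matrix_one m i j)"
      using fun_cong[OF fun_cong[OF that[of x]], of i j]
      by (simp add: matrix_mult_def C_eval_matrix_one)
  qed
  show ?thesis
  proof (rule GL_I)
    show "C_matrix g \<in> matrices m"
      using GL_matrices[OF g(2)] by (auto simp: matrices_def ev intro!: C_tensor_eqI)
    show "C_matrix (\<lambda>x. GL_inv m (g x)) \<in> matrices m"
      using GL_inv_matrices[OF g(2)] by (auto simp: matrices_def ev intro!: C_tensor_eqI)
    show "matrix_mult m (C_matrix g) (C_matrix (\<lambda>x. GL_inv m (g x))) = matrix_one m"
      by (rule mult) (simp add: ev GL_inv_right[OF g(2)])
    show "matrix_mult m (C_matrix (\<lambda>x. GL_inv m (g x))) (C_matrix g) = matrix_one m"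
      by (rule mult) (simp add: ev GL_inv_left[OF g(2)])
  qed
qed

text \<open>A homotopy through \<open>GL m\<close> is a path of matrices over the tensor product,
  continuous in the supremum norm by uniformity in the parameter. Its image is a connected set
  containing the identity.\<close>

lemma C_matrix_path_GL0:
  fixes G :: "'x::t2_space \<times> real \<Rightarrow> nat \<Rightarrow> nat \<Rightarrow> 'a::unital_cstar_algebra"
  assumes X: "compact (UNIV :: 'x set)" and G: "continuous_on (UNIV \<times> {0..1}) G"
    "G ` (UNIV \<times> {0..1}) \<subseteq> GL m" "\<And>x. G (x, 0) = matrix_one m"
  shows "C_matrix (\<lambda>x. G (x, 1)) \<in> GL0 m"
proof -
  have Gs: "continuous_on UNIV (\<lambda>x. G (x, s))" if "s \<in> {0..1}" for s
    by (rule continuous_on_compose2[OF G(1)])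
      (use that in \<open>auto intro!: continuous_on_Pair continuous_on_id continuous_on_const\<close>)
  note ev = C_eval_C_matrix[OF X Gs]
  define \<gamma> where "\<gamma> s = C_matrix (\<lambda>x. G (x, s))" for s
  have "continuous_on {0..1} \<gamma>"
  proof (intro continuous_on_coordinatewise_then_product)
    fix i j
    show "continuous_on {0..1} (\<lambda>s. \<gamma> s i j)"
      unfolding continuous_on_iff
    proof (intro ballI allI impI)
      fix s e :: real assume s: "s \<in> {0..1}" and e: "e > 0"
      have e2: "e/2 > 0"
        using e by simp
      obtain d where d: "d > 0" "\<And>x s s'. s \<in> {0..1} \<Longrightarrow> s' \<in> {0..1} \<Longrightarrow> \<bar>s - s'\<bar> < d \<Longrightarrow>
          dist (G (x, s) i j) (G (x, s') i j) < e/2"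
        by (rule uniformly_continuous_in_parameter[OF X continuous_on_apply2[OF G(1)] e2]) (auto intro: that)
      show "\<exists>d>0. \<forall>s'\<in>{0..1}. dist s' s < d \<longrightarrow> dist (\<gamma> s' i j) (\<gamma> s i j) < e"
      proof (intro exI[of _ d] conjI d(1) ballI impI)
        fix s' :: real assume s': "s' \<in> {0..1}" "dist s' s < d"
        have "dist (\<gamma> s' i j) (\<gamma> s i j) \<le> e/2"
        proof (rule dist_C_tensor_le)
          fix x
          show "dist (C_eval x (\<gamma> s' i j)) (C_eval x (\<gamma> s i j)) \<le> e/2"
            unfolding \<gamma>_def ev[OF s] ev[OF s'(1)]
            using d(2)[OF s'(1) s, of x] s'(2) by (simp add: dist_real_def)
        qed
        then show "dist (\<gamma> s' i j) (\<gamma> s i j) < e"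
          using e by simp
      qed
    qed
  qed
  then have "connected (\<gamma> ` {0..1})"
    by (intro connected_continuous_image) auto
  moreover have "\<gamma> ` {0..1} \<subseteq> GL m"
    using G(2) unfolding \<gamma>_def by (intro image_subsetI C_matrix_GL[OF X Gs]) auto
  moreover have "matrix_one m = \<gamma> 0"
  proof (intro ext C_tensor_eqI)
    fix i j x
    show "C_eval x (matrix_one m i j) = C_eval x (\<gamma> 0 i j)"
      using ev[of 0 x i j] by (simp add: \<gamma>_def G(3) C_eval_matrix_one)
  qed
  moreover have "\<gamma> 0 \<in> \<gamma> ` {0..1}" "\<gamma> 1 \<in> \<gamma> ` {0..1}"
    by (intro imageI; simp)+
  ultimately have "connected_component (GL m) (matrix_one m) (\<gamma> 1)"
    unfolding connected_component_def by (intro exI[of _ "\<gamma> ` {0..1}"]) simp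
  then show ?thesis
    by (simp add: GL0_def \<gamma>_def)
qed

lemma GL0_transitive_C_tensor:
  fixes u v :: "nat \<Rightarrow> ('x::t2_space, 'a::unital_cstar_algebra) C_tensor"
  assumes X: "compact (UNIV :: 'x set)" and dim: "covering_dim_le TYPE('x) n" and m: "m \<ge> 1"
    and fill: "\<And>k. 1 \<le> k \<Longrightarrow> k \<le> n + 1 \<Longrightarrow> fillable k (Lg m :: (nat \<Rightarrow> 'a) set)"
    and uv: "u \<in> Lg m" "v \<in> Lg m"
  shows "\<exists>g\<in>GL0 m. matrix_act m g u = v"
proof -
  let ?ev = "\<lambda>w x i. C_eval x (w i :: ('x, 'a) C_tensor)"
  have null: "homotopic_with_canon (\<lambda>_. True) UNIV (Lg m) (?ev w) (\<lambda>_. last_vector m)" if "w \<in> Lg m" for w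
  proof (rule Lg_map_homotopic_constant[OF X dim fill])
    show "continuous_on UNIV (?ev w)"
      by (intro continuous_on_coordinatewise_then_product continuous_on_C_eval)
  qed (simp_all add: Lg_C_eval[OF that] last_vector_Lg[OF m])
  \<comment> \<open>Both maps contract to the same constant, so one contraction followed by the
    reverse of the other joins them.\<close>
  have "homotopic_with_canon (\<lambda>_. True) UNIV (Lg m) (?ev u) (?ev v)"
    using null[OF uv(1)] null[OF uv(2)] homotopic_with_trans homotopic_with_symD by blast
  then obtain h where h: "continuous_map (prod_topology (top_of_set {0..1}) (top_of_set UNIV)) (top_of_set (Lg m)) h"
    "\<And>x. h (0::real, x) = ?ev u x" "\<And>x. h (1, x) = ?ev v x"
    unfolding homotopic_with_def by blast
  have hC: "continuous_on ({0..1} \<times> UNIV) h" "h ` ({0..1} \<times> UNIV) \<subseteq> Lg m"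
    using h(1) unfolding prod_topology_subtopology_eu by auto
  have hs: "continuous_on (UNIV \<times> {0..1}) (\<lambda>p. h (snd p, fst p))"
    by (rule continuous_on_compose2[OF hC(1)])
      (auto intro!: continuous_on_Pair continuous_on_fst continuous_on_snd continuous_on_id)
  have hs_Lg: "(\<lambda>p. h (snd p, fst p)) ` (UNIV \<times> {0..1}) \<subseteq> Lg m"
    using hC(2) by auto
  obtain G where G: "continuous_on (UNIV \<times> {0..1::real}) G" "G ` (UNIV \<times> {0..1}) \<subseteq> GL m"
    "\<And>x. G (x, 0) = matrix_one m" "\<And>x. matrix_act m (G (x, 1)) (h (0, x)) = h (1, x)"
  proof (rule lift_homotopy[OF X hs hs_Lg])
    fix G
    assume *: "continuous_on (UNIV \<times> {0..1}) G" "G ` (UNIV \<times> {0..1}) \<subseteq> GL m"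
      "\<And>x. x \<in> UNIV \<Longrightarrow> G (x, 0) = matrix_one m"
      "\<And>x s. x \<in> UNIV \<Longrightarrow> s \<in> {0..1} \<Longrightarrow>
        matrix_act m (G (x, s)) (h (snd (x, 0::real), fst (x, 0::real))) = h (snd (x, s), fst (x, s))"
    show thesis
    proof (rule that[OF *(1,2)])
      show "matrix_act m (G (x, 1)) (h (0, x)) = h (1, x)" for x
        using *(4)[of x 1] by simp
    qed (simp add: *(3))
  qed
  have G1: "continuous_on UNIV (\<lambda>x. G (x, 1))"
    by (rule continuous_on_compose2[OF G(1)])
      (auto intro!: continuous_on_Pair continuous_on_id continuous_on_const)
  have "matrix_act m (C_matrix (\<lambda>x. G (x, 1))) u = v"
  proof (intro ext C_tensor_eqI)
    fix i x
    have "matrix_act m (G (x, 1)) (?ev u x) i = ?ev v x i"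
      using G(4)[of x] by (simp add: h(2,3))
    then show "C_eval x (matrix_act m (C_matrix (\<lambda>x. G (x, 1))) u i) = C_eval x (v i)"
      by (simp add: matrix_act_def C_eval_C_matrix[OF X G1])
  qed
  moreover have "C_matrix (\<lambda>x. G (x, 1)) \<in> GL0 m"
    by (rule C_matrix_path_GL0[OF X G(1-3)])
  ultimately show ?thesis
    by blast
qed

section \<open>The bound on the connected stable rank\<close>

text \<open>A finite bound rules out the empty set, whose infimum is infinite, and a nonempty set of
  naturals attains its infimum.\<close>

lemma Inf_enat_leD:
  assumes "Inf {enat N | N. P N} \<le> enat m"
  obtains N where "P N" "N \<le> m"
proof -
  have "{enat N | N. P N} \<noteq> {}"
    using assms by (auto simp: Inf_enat_def top_enat_def split: if_splits)
  then have "Inf {enat N | N. P N} \<in> {enat N | N. P N}"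
    unfolding Inf_enat_def by (auto intro: LeastI)
  then show ?thesis
    using assms that by auto
qed

theorem theorem3p10:
  fixes n :: nat
  assumes "compact (UNIV :: 'x::t2_space set)"
    and "covering_dim TYPE('x) \<le> enat n"
  shows "csr TYPE(('x, 'a::unital_cstar_algebra) C_tensor) \<le>
    Max ({csr TYPE('a)} \<union>
         (\<Union>k\<in>{1..n}. {surj_rank k TYPE('a), inj_rank (k - 1) TYPE('a)}))"
proof -
  let ?R = "{csr TYPE('a)} \<union> (\<Union>k\<in>{1..n}. {surj_rank k TYPE('a), inj_rank (k - 1) TYPE('a)})"
  have fin: "finite ?R"
    by simp
  show ?thesis
  \<comment> \<open>An infinite maximum leaves nothing to prove; a finite one is the
    \<open>N\<close> from which all ranges are stable simultaneously.\<close>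
  proof (cases "Max ?R")
    case (enat N)
    have le: "r \<le> enat m" if "r \<in> ?R" "m \<ge> N" for r m
    proof -
      have "r \<le> enat N"
        using Max_ge[OF fin that(1)] unfolding enat .
      also have "\<dots> \<le> enat m"
        using that(2) by simp
      finally show ?thesis .
    qed
    \<comment> \<open>The covering dimension is attained at some \<open>n'\<close>, possibly below
      \<open>n\<close>; the cubes to be filled then have dimension at most
      \<open>n' + 1\<close>.\<close>
    obtain n' where n': "covering_dim_le TYPE('x) n'" "n' \<le> n"
      using assms(2) unfolding covering_dim_def by (rule Inf_enat_leD)
    have csr: "m \<ge> 1 \<and> (\<forall>u\<in>Lg m. \<forall>v\<in>(Lg m :: (nat \<Rightarrow> 'a) set). \<exists>g\<in>GL0 m. matrix_act m g u = v)"
      if m: "m \<ge> N" for m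
    proof -
      have "csr TYPE('a) \<le> enat m"
        by (rule le[OF _ m]) simp
      then show ?thesis
        unfolding csr_def by (rule Inf_enat_leD) (meson order_trans)
    qed
    have inj: "inj_on (GL_stabilisation TYPE('a) (k - 1) m) (GL_homotopy_group TYPE('a) (k - 1) (m - 1))"
      if m: "m \<ge> N" and k: "1 \<le> k" "k \<le> n" for m k
    proof -
      have "inj_rank (k - 1) TYPE('a) \<le> enat m"
        by (rule le[OF _ m]) (use k in auto)
      then show ?thesis
        unfolding inj_rank_def by (rule Inf_enat_leD) blast
    qed
    have surj: "GL_stabilisation TYPE('a) k m ` GL_homotopy_group TYPE('a) k (m - 1) = GL_homotopy_group TYPE('a) k m"
      if m: "m \<ge> N" and k: "1 \<le> k" "k \<le> n" for m k
    proof -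
      have "surj_rank k TYPE('a) \<le> enat m"
        by (rule le[OF _ m]) (use k in auto)
      then show ?thesis
        unfolding surj_rank_def by (rule Inf_enat_leD) blast
    qed
    have trans: "\<exists>g\<in>GL0 m. matrix_act m g u = v"
      if m: "m \<ge> N" and uv: "u \<in> Lg m" "v \<in> Lg m" for m and u v :: "nat \<Rightarrow> ('x, 'a) C_tensor"
    proof (rule GL0_transitive_C_tensor[OF assms(1) n'(1) _ _ uv])
      show "m \<ge> 1"
        using csr[OF m] by blast
      show "fillable k (Lg m :: (nat \<Rightarrow> 'a) set)" if k: "1 \<le> k" "k \<le> n' + 1" for k
      proof (rule fillable_Lg[of m n])
        show "m \<ge> 1"
          using csr[OF m] by blast
        show "\<exists>g\<in>GL0 m. matrix_act m g u = v" if "u \<in> Lg m" "v \<in> Lg m" for u v :: "nat \<Rightarrow> 'a"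
          using csr[OF m] that by blast
        show "k \<le> n + 1"
          using k(2) n'(2) by simp
      qed (fact inj[OF m] surj[OF m] k(1))+
    qed
    have "enat N \<in> {enat N | N. N \<ge> 1 \<and> (\<forall>m\<ge>N. \<forall>u\<in>Lg m. \<forall>v\<in>(Lg m :: (nat \<Rightarrow> ('x, 'a) C_tensor) set).
        \<exists>g\<in>GL0 m. matrix_act m g u = v)}"
      using csr[of N] trans by blast
    then have "csr TYPE(('x, 'a) C_tensor) \<le> enat N"
      unfolding csr_def by (rule Inf_lower)
    then show ?thesis
      unfolding enat .
  qed simp
qed

end
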